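(* Let $G$ be a finitely generated group with contracting boundary $\partial_{c}^{\mathcal{F}\mathcal{Q}}G$ (the contracting boundary equipped with the topology of fellow travelling quasi-geodesics). Let $H$ be a subgroup of $G$ such that the limit set $\Lambda(H)$ of $H$ in $\partial_{c}^{\mathcal{F}\mathcal{Q}}G$ contains at least three elements. If $\Lambda(H)$ is a compact subset of $\partial_{c}^{\mathcal{F}\mathcal{Q}}G$, then the diagonal action of $H$ on the space of distinct triples $\Theta_3(\Lambda(H))$ is properly discontinuous.
   Context: Quasi-geodesics. For $L\ge 1$, $A\ge 0$, an $(L,A)$-quasi-geodesic in a metric space $(X,d)$ is a map $c:I\to X$ from an interval $I\subseteq\mathbb{R}$ with $\frac1L|s-t|-A\le d(c(s),c(t))\le L|s-t|+A$ for all $s,t\in I$. Paths are often identified with their images. Contracting. A function $\rho$ is sublinear if it is non-decreasing, eventually non-negative, and $\lim_{r\to\infty}\rho(r)/r=0$. For $Z\subseteq X$ let $\pi_Z(x)=\{z\in Z: d(x,z)=d(x,Z)\}$. $Z$ (or a quasi-geodesic with image $Z$) is $\rho$-contracting if for all $x,y\in X$, $d(x,y)\le d(x,Z)$ implies $\operatorname{diam}(\pi_Z(x)\cup\pi_Z(y))\le\rho(d(x,Z))$. It is contracting if it is $\rho$-contracting for some sublinear $\rho$. Contracting boundary. Let $X$ be a proper geodesic metric space with basepoint $o$. $\partial_cX$ is the set of contracting quasi-geodesic rays based at $o$, modulo being at finite Hausdorff distance. Each $\zeta\in\partial_cX$ contains a geodesic ray from $o$, and $\rho_\zeta(r):=\sup\operatorname{diam}(\pi_\alpha(x)\cup\pi_\alpha(y))$,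 the supremum being over geodesic rays $\alpha\in\zeta$ and points $x,y$ with $d(x,y)\le d(x,\alpha)\le r$, is a sublinear function such that every geodesic ray in $\zeta$ is $\rho_\zeta$-contracting. Topology. For sublinear $\rho$, $L\ge1$, $A\ge0$ set $k(\rho,L,A):=\max\{3A,\,3L^2,\,1+\inf\{R>0:\ 3L^2\rho(r)\le r\text{ for all }r\ge R\}\}$. Let $N^c_ro=\{x\in X: d(o,x)\ge r\}$. For each $\zeta\in\partial_cX$ fix a geodesic ray $\alpha^\zeta\in\zeta$ from $o$. For $r\ge1$, $U(\zeta,r)$ is the set of $\eta\in\partial_cX$ such that for all $L\ge1$, $A\ge0$ and every continuous $(L,A)$-quasi-geodesic ray $\beta\in\eta$, $d(\beta,\alpha^\zeta\cap N^c_ro)\le k(\rho_\zeta,L,A)$. The topology of fellow travelling quasi-geodesics on $\partial_cX$ consists of all $U\subseteq\partial_cX$ such that for every $\zeta\in U$ there is $r\ge1$ with $U(\zeta,r)\subseteq U$; the resulting space is $\partial_c^{\mathcal{F}\mathcal{Q}}X$. Bordification. $\overline X=X\cup\partial_cX$. Let $\widehat U(\zeta,r)$ be the union of $U(\zeta,r)$ and the set of $x\in X$ such that $d(\gamma,N^c_ro\cap\alpha^\zeta)\le k(\rho_\zeta,L,A)$ for every $L\ge1$, $A\ge0$ and every continuous $(L,A)$-quasi-geodesic segment $\gamma$ with endpoints $o$ and $x$. A set $U\subseteq\overline X$ is open if every $x\in U\cap X$ has a metric ball $B(x;r)\subseteq U$ and every $\zeta\in U\cap\partial_cX$ has some $r\ge1$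 with $\widehat U(\zeta,r)\subseteq U$. This is a first countable Hausdorff topology in which $X$ is open and dense, and it induces on $\partial_cX$ the topology of fellow travelling quasi-geodesics. Groups. For a finitely generated group $G$, $\partial_c^{\mathcal{F}\mathcal{Q}}G$ denotes $\partial_c^{\mathcal{F}\mathcal{Q}}X$ with $X$ the Cayley graph of $G$ with respect to a finite generating set; it is metrizable, and $G$ acts on it by homeomorphisms. For a subgroup $H\le G$, the limit set is $\Lambda(H):=\overline{Ho}\setminus Ho$, closure taken in $\overline X$; it is an $H$-invariant subset of $\partial_c^{\mathcal{F}\mathcal{Q}}G$ and carries the subspace topology. Triples. $\Theta_3(M)=\{(x_1,x_2,x_3)\in M^3: x_1\ne x_2,\ x_2\ne x_3,\ x_1\ne x_3\}$ with the subspace topology from $M^3$. An action of a (discrete) group $H$ on a space $Y$ is properly discontinuous if for every compact $K\subseteq Y$ the set $\{h\in H: hK\cap K\ne\emptyset\}$ is finite. *)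

theory Defs
  imports "HOL-Analysis.Analysis" "HOL-Algebra.Generated_Groups"
begin

section \<open>Distances, diameters and paths in a metric space\<close>

type_synonym 'p path = "real \<Rightarrow> 'p"

definition mset_dist :: "'p metric \<Rightarrow> 'p set \<Rightarrow> 'p set \<Rightarrow> real" where
  "mset_dist X Y Z = Inf {mdist X y z | y z. y \<in> Y \<and> z \<in> Z}"

definition mdiam :: "'p metric \<Rightarrow> 'p set \<Rightarrow> real" where
  "mdiam X Z = Sup {mdist X y z | y z. y \<in> Z \<and> z \<in> Z}"

definition finite_hausdorff :: "'p metric \<Rightarrow> 'p set \<Rightarrow> 'p set \<Rightarrow> bool" where
  "finite_hausdorff X Y Z \<longleftrightarrow>
     (\<exists>C. (\<forall>y\<in>Y. \<exists>z\<in>Z. mdist X y z \<le> C) \<and> (\<forall>z\<in>Z. \<exists>y\<in>Y. mdist X y z \<le> C))"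

definition quasi_geodesic :: "'p metric \<Rightarrow> real \<Rightarrow> real \<Rightarrow> real set \<Rightarrow> 'p path \<Rightarrow> bool" where
  "quasi_geodesic X L A I c \<longleftrightarrow> is_interval I \<and> c ` I \<subseteq> mspace X \<and>
     (\<forall>s\<in>I. \<forall>t\<in>I. 1 / L * \<bar>s - t\<bar> - A \<le> mdist X (c s) (c t) \<and>
                   mdist X (c s) (c t) \<le> L * \<bar>s - t\<bar> + A)"

definition continuous_path :: "'p metric \<Rightarrow> real set \<Rightarrow> 'p path \<Rightarrow> bool" where
  "continuous_path X I c \<longleftrightarrow> continuous_map (top_of_set I) (mtopology_of X) c"

text \<open>Rays are parametrised by the half line \<open>{0..}\<close>; values at negative parameters are ignored.\<close>

definition ray_image :: "'p path \<Rightarrow> 'p set" where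
  "ray_image c = c ` {0..}"

definition geodesic_ray :: "'p metric \<Rightarrow> 'p \<Rightarrow> 'p path \<Rightarrow> bool" where
  "geodesic_ray X b c \<longleftrightarrow> quasi_geodesic X 1 0 {0..} c \<and> c 0 = b"


section \<open>Contracting sets\<close>

definition sublinear :: "(real \<Rightarrow> real) \<Rightarrow> bool" where
  "sublinear \<rho> \<longleftrightarrow> mono_on {0..} \<rho> \<and> (\<forall>\<^sub>F r in at_top. 0 \<le> \<rho> r) \<and>
     ((\<lambda>r. \<rho> r / r) \<longlongrightarrow> 0) at_top"

definition closest_proj :: "'p metric \<Rightarrow> 'p set \<Rightarrow> 'p \<Rightarrow> 'p set" where
  "closest_proj X Z x = {z \<in> Z. mdist X x z = mset_dist X {x} Z}"

text \<open>
  The closest point projection to \<open>Z\<close> is required to be defined, i.e. non-empty, everywhere. In a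
  proper space this says that \<open>Z\<close> is closed and non-empty. It is automatic for images of
  continuous quasi-geodesic rays, but a discontinuous quasi-geodesic can have a
  non-closed image all of whose relevant projections are empty, and it must not count as contracting
  for that reason: the open edges of a straight ray in the Cayley graph of the rank two free abelian
  group are an example.
\<close>

definition contracting_for :: "'p metric \<Rightarrow> (real \<Rightarrow> real) \<Rightarrow> 'p set \<Rightarrow> bool" where
  "contracting_for X \<rho> Z \<longleftrightarrow> (\<forall>x\<in>mspace X. closest_proj X Z x \<noteq> {}) \<and>
     (\<forall>x\<in>mspace X. \<forall>y\<in>mspace X. mdist X x y \<le> mset_dist X {x} Z \<longrightarrow>
        mdiam X (closest_proj X Z x \<union> closest_proj X Z y) \<le> \<rho> (mset_dist X {x} Z))"

definition contracting :: "'p metric \<Rightarrow> 'p set \<Rightarrow> bool" where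
  "contracting X Z \<longleftrightarrow> (\<exists>\<rho>. sublinear \<rho> \<and> contracting_for X \<rho> Z)"


section \<open>The contracting boundary and its topology\<close>

definition contracting_rays :: "'p metric \<Rightarrow> 'p \<Rightarrow> 'p path set" where
  "contracting_rays X b = {c. (\<exists>L\<ge>1. \<exists>A\<ge>0. quasi_geodesic X L A {0..} c) \<and> c 0 = b \<and>
     contracting X (ray_image c)}"

definition fellow_rays :: "'p metric \<Rightarrow> 'p \<Rightarrow> ('p path \<times> 'p path) set" where
  "fellow_rays X b = {(c, c'). c \<in> contracting_rays X b \<and> c' \<in> contracting_rays X b \<and>
     finite_hausdorff X (ray_image c) (ray_image c')}"

definition contracting_boundary :: "'p metric \<Rightarrow> 'p \<Rightarrow> 'p path set set" where
  "contracting_boundary X b = contracting_rays X b // fellow_rays X b"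

definition rho_class :: "'p metric \<Rightarrow> 'p \<Rightarrow> 'p path set \<Rightarrow> real \<Rightarrow> real" where
  "rho_class X b \<zeta> r = Sup {mdiam X (closest_proj X (ray_image a) x \<union> closest_proj X (ray_image a) y)
     | a x y. a \<in> \<zeta> \<and> geodesic_ray X b a \<and> x \<in> mspace X \<and> y \<in> mspace X \<and>
       mdist X x y \<le> mset_dist X {x} (ray_image a) \<and> mset_dist X {x} (ray_image a) \<le> r}"

definition kappa :: "(real \<Rightarrow> real) \<Rightarrow> real \<Rightarrow> real \<Rightarrow> real" where
  "kappa \<rho> L A = Max {3 * A, 3 * L\<^sup>2, 1 + Inf {R. R > 0 \<and> (\<forall>r\<ge>R. 3 * L\<^sup>2 * \<rho> r \<le> r)}}"

definition far_points :: "'p metric \<Rightarrow> 'p \<Rightarrow> real \<Rightarrow> 'p set" where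
  "far_points X b r = {x \<in> mspace X. r \<le> mdist X b x}"

definition ray_choice :: "'p metric \<Rightarrow> 'p \<Rightarrow> ('p path set \<Rightarrow> 'p path) \<Rightarrow> bool" where
  "ray_choice X b \<alpha> \<longleftrightarrow> (\<forall>\<zeta>\<in>contracting_boundary X b. \<alpha> \<zeta> \<in> \<zeta> \<and> geodesic_ray X b (\<alpha> \<zeta>))"

definition boundary_nbhd ::
  "'p metric \<Rightarrow> 'p \<Rightarrow> ('p path set \<Rightarrow> 'p path) \<Rightarrow> 'p path set \<Rightarrow> real \<Rightarrow> 'p path set set" where
  "boundary_nbhd X b \<alpha> \<zeta> r = {\<eta> \<in> contracting_boundary X b.
     \<forall>L\<ge>1. \<forall>A\<ge>0. \<forall>\<beta>\<in>\<eta>. quasi_geodesic X L A {0..} \<beta> \<and> continuous_path X {0..} \<beta> \<longrightarrow>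
       mset_dist X (ray_image \<beta>) (ray_image (\<alpha> \<zeta>) \<inter> far_points X b r)
         \<le> kappa (rho_class X b \<zeta>) L A}"

definition FQ_topology :: "'p metric \<Rightarrow> 'p \<Rightarrow> ('p path set \<Rightarrow> 'p path) \<Rightarrow> 'p path set topology" where
  "FQ_topology X b \<alpha> = topology (\<lambda>U. U \<subseteq> contracting_boundary X b \<and>
     (\<forall>\<zeta>\<in>U. \<exists>r\<ge>1. boundary_nbhd X b \<alpha> \<zeta> r \<subseteq> U))"


section \<open>The bordification\<close>

text \<open>
  The space and its boundary are the two summands of the disjoint union. A segment with endpoints
  \<open>b\<close> and \<open>x\<close> is parametrised by \<open>{0..l}\<close> starting at \<open>b\<close>; translating or reversing the
  parameter interval does not change the image.
\<close>

definition bord_nbhd ::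
  "'p metric \<Rightarrow> 'p \<Rightarrow> ('p path set \<Rightarrow> 'p path) \<Rightarrow> 'p path set \<Rightarrow> real \<Rightarrow> ('p + 'p path set) set" where
  "bord_nbhd X b \<alpha> \<zeta> r = Inr ` boundary_nbhd X b \<alpha> \<zeta> r \<union>
     Inl ` {x \<in> mspace X. \<forall>L\<ge>1. \<forall>A\<ge>0. \<forall>l\<ge>0. \<forall>\<gamma>.
       quasi_geodesic X L A {0..l} \<gamma> \<and> continuous_path X {0..l} \<gamma> \<and> \<gamma> 0 = b \<and> \<gamma> l = x \<longrightarrow>
         mset_dist X (\<gamma> ` {0..l}) (far_points X b r \<inter> ray_image (\<alpha> \<zeta>))
           \<le> kappa (rho_class X b \<zeta>) L A}"

definition bord_topology ::
  "'p metric \<Rightarrow> 'p \<Rightarrow> ('p path set \<Rightarrow> 'p path) \<Rightarrow> ('p + 'p path set) topology" where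
  "bord_topology X b \<alpha> = topology (\<lambda>U. U \<subseteq> Inl ` mspace X \<union> Inr ` contracting_boundary X b \<and>
     (\<forall>x. Inl x \<in> U \<longrightarrow> (\<exists>r>0. Inl ` mball_of X x r \<subseteq> U)) \<and>
     (\<forall>\<zeta>. Inr \<zeta> \<in> U \<longrightarrow> (\<exists>r\<ge>1. bord_nbhd X b \<alpha> \<zeta> r \<subseteq> U)))"


section \<open>Cayley graphs\<close>

text \<open>
  The Cayley graph of \<open>G\<close> with respect to \<open>S\<close> is the geometric realisation of the simplicial graph
  with vertex set \<open>carrier G\<close> and edges \<open>{g, g s}\<close>: its points are given by their barycentric
  coordinates, functions on the group supported on a vertex or on an edge. Taking \<open>\<one>\<close> into account
  along with \<open>S\<close> adds the vertices as cells, which only matters when there is no edge.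
\<close>

definition cayley_cells :: "('a, 'b) monoid_scheme \<Rightarrow> 'a set \<Rightarrow> 'a set set" where
  "cayley_cells G S = {{g, g \<otimes>\<^bsub>G\<^esub> s} | g s. g \<in> carrier G \<and> s \<in> insert \<one>\<^bsub>G\<^esub> S}"

definition cell_points :: "'a set \<Rightarrow> ('a \<Rightarrow> real) set" where
  "cell_points e = {x. (\<forall>g. 0 \<le> x g) \<and> (\<forall>g. g \<notin> e \<longrightarrow> x g = 0) \<and> (\<Sum>g\<in>e. x g) = 1}"

definition cayley_points :: "('a, 'b) monoid_scheme \<Rightarrow> 'a set \<Rightarrow> ('a \<Rightarrow> real) set" where
  "cayley_points G S = \<Union> (cell_points ` cayley_cells G S)"

text \<open>
  On a single edge, half the \<open>\<ell>\<^sup>1\<close>-distance of barycentric coordinates identifies the edge with the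
  unit interval. The distance on the graph is the induced length metric: the infimum of
  the lengths of piecewise linear paths, given by chains of points in which successive ones share
  a cell.
\<close>

definition bary_dist :: "('a \<Rightarrow> real) \<Rightarrow> ('a \<Rightarrow> real) \<Rightarrow> real" where
  "bary_dist x y = (\<Sum>g | x g \<noteq> 0 \<or> y g \<noteq> 0. \<bar>x g - y g\<bar>) / 2"

definition cayley_chain ::
  "('a, 'b) monoid_scheme \<Rightarrow> 'a set \<Rightarrow> ('a \<Rightarrow> real) \<Rightarrow> ('a \<Rightarrow> real) \<Rightarrow> ('a \<Rightarrow> real) list \<Rightarrow> bool" where
  "cayley_chain G S x y ps \<longleftrightarrow> ps \<noteq> [] \<and> hd ps = x \<and> last ps = y \<and>
     successively (\<lambda>p q. \<exists>e\<in>cayley_cells G S. p \<in> cell_points e \<and> q \<in> cell_points e) ps"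

definition chain_length :: "('a \<Rightarrow> real) list \<Rightarrow> real" where
  "chain_length ps = sum_list (map2 bary_dist ps (tl ps))"

definition cayley_dist ::
  "('a, 'b) monoid_scheme \<Rightarrow> 'a set \<Rightarrow> ('a \<Rightarrow> real) \<Rightarrow> ('a \<Rightarrow> real) \<Rightarrow> real" where
  "cayley_dist G S x y =
     (if x \<in> cayley_points G S \<and> y \<in> cayley_points G S
      then Inf (chain_length ` {ps. cayley_chain G S x y ps}) else 0)"

definition cayley_graph :: "('a, 'b) monoid_scheme \<Rightarrow> 'a set \<Rightarrow> ('a \<Rightarrow> real) metric" where
  "cayley_graph G S = metric (cayley_points G S, cayley_dist G S)"

text \<open>The left translation action of the group on its Cayley graph.\<close>

definition cayley_act :: "('a, 'b) monoid_scheme \<Rightarrow> 'a \<Rightarrow> ('a \<Rightarrow> real) \<Rightarrow> ('a \<Rightarrow> real)" where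
  "cayley_act G h x = (\<lambda>g. if g \<in> carrier G then x (inv\<^bsub>G\<^esub> h \<otimes>\<^bsub>G\<^esub> g) else 0)"

text \<open>
  The action on the boundary: translates of rays in a class no longer start at the basepoint, so
  the translated class consists of the contracting quasi-geodesic rays based at \<open>b\<close> that are at
  finite Hausdorff distance from such translates.
\<close>

definition boundary_act ::
  "('a, 'b) monoid_scheme \<Rightarrow> 'a set \<Rightarrow> ('a \<Rightarrow> real) \<Rightarrow> 'a \<Rightarrow> ('a \<Rightarrow> real) path set \<Rightarrow> ('a \<Rightarrow> real) path set"
  where
  "boundary_act G S b h \<zeta> = {c \<in> contracting_rays (cayley_graph G S) b.
     \<exists>c'\<in>\<zeta>. finite_hausdorff (cayley_graph G S) (ray_image c) (cayley_act G h ` ray_image c')}"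


section \<open>Limit sets\<close>

text \<open>
  The limit set does not meet \<open>X\<close>; it is pulled back along \<open>Inr\<close> to be
  a subset of the contracting boundary.
\<close>

definition limit_set ::
  "('a, 'b) monoid_scheme \<Rightarrow> 'a set \<Rightarrow> ('a \<Rightarrow> real) \<Rightarrow> (('a \<Rightarrow> real) path set \<Rightarrow> ('a \<Rightarrow> real) path)
     \<Rightarrow> 'a set \<Rightarrow> ('a \<Rightarrow> real) path set set" where
  "limit_set G S b \<alpha> H =
     (let Hb = Inl ` (\<lambda>h. cayley_act G h b) ` H
      in Inr -` (bord_topology (cayley_graph G S) b \<alpha> closure_of Hb - Hb))"


section \<open>Distinct triples and properly discontinuous actions\<close>

definition distinct_triples :: "'m topology \<Rightarrow> ('m \<times> 'm \<times> 'm) topology" where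
  "distinct_triples M = subtopology (prod_topology M (prod_topology M M))
     {(x, y, z). x \<noteq> y \<and> y \<noteq> z \<and> x \<noteq> z}"

definition diagonal_act :: "('h \<Rightarrow> 'm \<Rightarrow> 'm) \<Rightarrow> 'h \<Rightarrow> 'm \<times> 'm \<times> 'm \<Rightarrow> 'm \<times> 'm \<times> 'm" where
  "diagonal_act \<phi> h = (\<lambda>(x, y, z). (\<phi> h x, \<phi> h y, \<phi> h z))"

definition properly_discontinuous :: "'h set \<Rightarrow> ('h \<Rightarrow> 'y \<Rightarrow> 'y) \<Rightarrow> 'y topology \<Rightarrow> bool" where
  "properly_discontinuous H \<phi> Y \<longleftrightarrow>
     (\<forall>K. compactin Y K \<longrightarrow> finite {h \<in> H. \<phi> h ` K \<inter> K \<noteq> {}})"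


section \<open>The metrics and topologies above are well defined\<close>

lemma bary_dist_alt:
  assumes "finite F" "{g. x g \<noteq> 0 \<or> y g \<noteq> 0} \<subseteq> F"
  shows "bary_dist x y = (\<Sum>g\<in>F. \<bar>x g - y g\<bar>) / 2"
proof -
  have "(\<Sum>g | x g \<noteq> 0 \<or> y g \<noteq> 0. \<bar>x g - y g\<bar>) = (\<Sum>g\<in>F. \<bar>x g - y g\<bar>)"
    using assms by (intro sum.mono_neutral_left) auto
  then show ?thesis by (simp add: bary_dist_def)
qed

lemma bary_dist_nonneg: "0 \<le> bary_dist x y"
  by (simp add: bary_dist_def sum_nonneg)

lemma bary_dist_commute: "bary_dist x y = bary_dist y x"
  by (simp add: bary_dist_def disj_commute abs_minus_commute)

lemma bary_dist_self: "bary_dist x x = 0"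
  by (simp add: bary_dist_def)

lemma finite_cayley_cell: "e \<in> cayley_cells G S \<Longrightarrow> finite e"
  by (auto simp: cayley_cells_def)

lemma finite_support_cell_points:
  assumes "e \<in> cayley_cells G S" "x \<in> cell_points e"
  shows "finite {g. x g \<noteq> 0}"
  by (rule finite_subset [OF _ finite_cayley_cell [OF assms(1)]])
     (use assms(2) in \<open>auto simp: cell_points_def\<close>)

lemma finite_support_cayley_points:
  "x \<in> cayley_points G S \<Longrightarrow> finite {g. x g \<noteq> 0}"
  by (auto simp: cayley_points_def intro: finite_support_cell_points)

lemma bary_dist_triangle:
  assumes "finite {g. x g \<noteq> 0}" "finite {g. y g \<noteq> 0}" "finite {g. z g \<noteq> 0}"
  shows "bary_dist x z \<le> bary_dist x y + bary_dist y z"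
proof -
  define F where "F = {g. x g \<noteq> 0} \<union> {g. y g \<noteq> 0} \<union> {g. z g \<noteq> 0}"
  have F: "finite F" using assms by (simp add: F_def)
  have "(\<Sum>g\<in>F. \<bar>x g - z g\<bar>) \<le> (\<Sum>g\<in>F. \<bar>x g - y g\<bar> + \<bar>y g - z g\<bar>)"
    by (intro sum_mono) simp
  moreover have "bary_dist x z = (\<Sum>g\<in>F. \<bar>x g - z g\<bar>) / 2"
      "bary_dist x y = (\<Sum>g\<in>F. \<bar>x g - y g\<bar>) / 2"
      "bary_dist y z = (\<Sum>g\<in>F. \<bar>y g - z g\<bar>) / 2"
    by (intro bary_dist_alt F; auto simp: F_def)+
  ultimately show ?thesis by (simp add: sum.distrib)
qed

lemma bary_dist_eq_0:
  assumes "finite {g. x g \<noteq> 0}" "finite {g. y g \<noteq> 0}" "bary_dist x y = 0"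
  shows "x = y"
proof
  fix g
  have fin: "finite {g. x g \<noteq> 0 \<or> y g \<noteq> 0}"
    by (rule finite_subset [OF _ finite_UnI [OF assms(1,2)]]) auto
  have "\<forall>g\<in>{g. x g \<noteq> 0 \<or> y g \<noteq> 0}. \<bar>x g - y g\<bar> = 0"
    using assms(3) sum_nonneg_eq_0_iff [OF fin, of "\<lambda>g. \<bar>x g - y g\<bar>"]
    by (simp add: bary_dist_def)
  then show "x g = y g" by (cases "x g \<noteq> 0 \<or> y g \<noteq> 0") auto
qed

lemma chain_length_simps [simp]:
  "chain_length [] = 0" "chain_length [p] = 0"
  "chain_length (p # q # ps) = bary_dist p q + chain_length (q # ps)"
  by (simp_all add: chain_length_def)

lemma chain_length_nonneg: "0 \<le> chain_length ps"
  by (induction ps rule: induct_list012) (simp_all add: bary_dist_nonneg)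

lemma chain_length_append:
  "chain_length (ps @ q # qs) = chain_length (ps @ [q]) + chain_length (q # qs)"
proof (induction ps)
  case (Cons p ps)
  then show ?case by (cases ps) simp_all
qed simp

lemma chain_length_rev: "chain_length (rev ps) = chain_length ps"
proof (induction ps rule: induct_list012)
  case (3 p q ps)
  have "chain_length (rev (p # q # ps)) = chain_length (rev ps @ [q]) + chain_length [q, p]"
    using chain_length_append [of "rev ps" q "[p]"] by simp
  also have "chain_length (rev ps @ [q]) = chain_length (q # ps)"
    using 3 by simp
  finally show ?case by (simp add: bary_dist_commute)
qed simp_all

lemma cayley_chain_rev:
  assumes "cayley_chain G S x y ps"
  shows "cayley_chain G S y x (rev ps)"
proof -
  show ?thesis
    using assms by (auto simp: cayley_chain_def successively_rev hd_rev last_rev conj_commute)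
qed

lemma cayley_chain_append:
  assumes "cayley_chain G S x y ps" "cayley_chain G S y z qs"
  shows "cayley_chain G S x z (butlast ps @ qs)"
    and "chain_length (butlast ps @ qs) = chain_length ps + chain_length qs"
proof -
  from assms obtain qs' where qs: "qs = y # qs'"
    by (cases qs) (auto simp: cayley_chain_def)
  from assms have ps: "ps = butlast ps @ [y]"
    by (metis append_butlast_last_id cayley_chain_def)
  show "chain_length (butlast ps @ qs) = chain_length ps + chain_length qs"
    using chain_length_append [of "butlast ps" y qs'] ps qs by simp
  let ?R = "\<lambda>p q. \<exists>e\<in>cayley_cells G S. p \<in> cell_points e \<and> q \<in> cell_points e"
  have "successively ?R (butlast ps @ [y])" "successively ?R (y # qs')"
    using assms ps qs by (simp_all add: cayley_chain_def)
  then have "successively ?R (butlast ps @ y # qs')"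
    by (auto simp: successively_append_iff)
  moreover have "hd (butlast ps @ qs) = x"
  proof -
    have "hd (butlast ps @ [y]) = x"
      using assms(1) ps by (metis cayley_chain_def)
    then show ?thesis using qs by (cases "butlast ps") simp_all
  qed
  ultimately show "cayley_chain G S x z (butlast ps @ qs)"
    using assms qs by (simp add: cayley_chain_def)
qed

lemma bary_dist_le_chain_length:
  assumes "cayley_chain G S x y ps"
    and "finite {g. x g \<noteq> 0}"
  shows "bary_dist x y \<le> chain_length ps"
  using assms
proof (induction ps arbitrary: x rule: induct_list012)
  case 1
  then show ?case by (simp add: cayley_chain_def)
next
  case (2 p)
  then show ?case by (auto simp: cayley_chain_def bary_dist_self)
next
  case (3 p q ps)
  have p: "p = x" and y: "y = last (q # ps)" using 3 by (auto simp: cayley_chain_def)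
  have ch: "cayley_chain G S q y (q # ps)" using 3 by (auto simp: cayley_chain_def)
  have q: "finite {g. q g \<noteq> 0}"
    using "3.prems"(1) finite_support_cell_points by (fastforce simp: cayley_chain_def)
  have fin: "finite {g. y g \<noteq> 0}"
    using ch
  proof (cases ps rule: rev_cases)
    case Nil
    then show ?thesis using q y by simp
  next
    case (snoc qs r)
    let ?R = "\<lambda>p q. \<exists>e\<in>cayley_cells G S. p \<in> cell_points e \<and> q \<in> cell_points e"
    have "q # ps = (q # qs) @ [r]" using snoc by simp
    moreover from this have "r = y" using y by simp
    moreover have "successively ?R (q # ps)" using ch unfolding cayley_chain_def by blast
    ultimately have "successively ?R ((q # qs) @ [y])" by metis
    then have "?R (last (q # qs)) y"
      unfolding successively_append_iff by simp
    then show ?thesis using finite_support_cell_points by blast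
  qed
  have "bary_dist x y \<le> bary_dist x q + bary_dist q y"
    using 3 q fin by (intro bary_dist_triangle) auto
  also have "bary_dist q y \<le> chain_length (q # ps)"
    using 3(2) ch q by blast
  finally show ?case using p by simp
qed

lemma cayley_chain_trans:
  "\<exists>ps. cayley_chain G S x y ps \<Longrightarrow> \<exists>ps. cayley_chain G S y z ps \<Longrightarrow> \<exists>ps. cayley_chain G S x z ps"
  using cayley_chain_append(1) by blast

lemma cayley_chain_sym:
  "\<exists>ps. cayley_chain G S x y ps \<Longrightarrow> \<exists>ps. cayley_chain G S y x ps"
  using cayley_chain_rev by blast

lemma cayley_chain_refl: "cayley_chain G S x x [x]"
  by (simp add: cayley_chain_def)

lemma cayley_chain_cell:
  assumes "e \<in> cayley_cells G S" "x \<in> cell_points e" "y \<in> cell_points e"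
  shows "\<exists>ps. cayley_chain G S x y ps"
  by (rule exI [of _ "[x, y]"]) (use assms in \<open>auto simp: cayley_chain_def\<close>)

definition cayley_vertex :: "'a \<Rightarrow> 'a \<Rightarrow> real" where
  "cayley_vertex g = (\<lambda>a. if a = g then 1 else 0)"

lemma cayley_vertex_in_cell: "finite e \<Longrightarrow> g \<in> e \<Longrightarrow> cayley_vertex g \<in> cell_points e"
  by (auto simp: cell_points_def cayley_vertex_def)

lemma cayley_chain_vertices:
  assumes "group G" "S \<subseteq> carrier G" "h \<in> generate G S" "g \<in> carrier G"
  shows "\<exists>ps. cayley_chain G S (cayley_vertex g) (cayley_vertex (g \<otimes>\<^bsub>G\<^esub> h)) ps"
  using assms(3,4)
proof (induction arbitrary: g rule: generate.induct)
  case one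
  then show ?case
    using cayley_chain_refl assms(1) by (metis group.is_monoid monoid.r_one)
next
  case (incl h)
  then have "{g, g \<otimes>\<^bsub>G\<^esub> h} \<in> cayley_cells G S" by (auto simp: cayley_cells_def)
  then show ?case by (rule cayley_chain_cell) (simp_all add: cayley_vertex_in_cell)
next
  case (inv h)
  interpret group G by fact
  have h: "h \<in> carrier G" using inv assms(2) by blast
  let ?k = "g \<otimes>\<^bsub>G\<^esub> inv\<^bsub>G\<^esub> h"
  have "?k \<in> carrier G" using inv h by simp
  then have "{?k, ?k \<otimes>\<^bsub>G\<^esub> h} \<in> cayley_cells G S" using inv by (auto simp: cayley_cells_def)
  moreover have "?k \<otimes>\<^bsub>G\<^esub> h = g" using h inv by (simp add: m_assoc)
  ultimately have "{?k, g} \<in> cayley_cells G S" by simp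
  then show ?case by (rule cayley_chain_cell) (simp_all add: cayley_vertex_in_cell)
next
  case (eng h k)
  interpret group G by fact
  have "h \<in> carrier G" "k \<in> carrier G"
    using eng generate_in_carrier [OF assms(2)] by blast+
  then show ?case
    using eng.IH(1) [of g] eng.IH(2) [of "g \<otimes>\<^bsub>G\<^esub> h"] eng.prems
    by (metis m_assoc m_closed cayley_chain_trans)
qed

lemma cayley_connected:
  assumes "group G" "S \<subseteq> carrier G" "generate G S = carrier G"
    and "x \<in> cayley_points G S" "y \<in> cayley_points G S"
  shows "\<exists>ps. cayley_chain G S x y ps"
proof -
  interpret group G by fact
  have vert: "\<exists>g\<in>carrier G. \<exists>ps. cayley_chain G S z (cayley_vertex g) ps"
    if "z \<in> cayley_points G S" for z
  proof -
    from that obtain g s where gs: "g \<in> carrier G" "{g, g \<otimes>\<^bsub>G\<^esub> s} \<in> cayley_cells G S"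
        "z \<in> cell_points {g, g \<otimes>\<^bsub>G\<^esub> s}"
      by (auto simp: cayley_points_def cayley_cells_def)
    have "\<exists>ps. cayley_chain G S z (cayley_vertex g) ps"
      by (rule cayley_chain_cell [OF gs(2,3)]) (simp add: cayley_vertex_in_cell)
    then show ?thesis using gs(1) by (rule bexI)
  qed
  obtain g where g: "g \<in> carrier G" "\<exists>ps. cayley_chain G S x (cayley_vertex g) ps"
    using vert [OF assms(4)] by (rule bexE)
  obtain h where h: "h \<in> carrier G" "\<exists>ps. cayley_chain G S y (cayley_vertex h) ps"
    using vert [OF assms(5)] by (rule bexE)
  have "inv\<^bsub>G\<^esub> g \<otimes>\<^bsub>G\<^esub> h \<in> generate G S"
    using g(1) h(1) assms(3) by simp
  then have "\<exists>ps. cayley_chain G S (cayley_vertex g) (cayley_vertex (g \<otimes>\<^bsub>G\<^esub> (inv\<^bsub>G\<^esub> g \<otimes>\<^bsub>G\<^esub> h))) ps"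
    by (rule cayley_chain_vertices [OF assms(1,2) _ g(1)])
  moreover have "g \<otimes>\<^bsub>G\<^esub> (inv\<^bsub>G\<^esub> g \<otimes>\<^bsub>G\<^esub> h) = h"
    using m_assoc [OF g(1) inv_closed [OF g(1)] h(1)] r_inv [OF g(1)] l_one [OF h(1)] by simp
  ultimately have "\<exists>ps. cayley_chain G S (cayley_vertex g) (cayley_vertex h) ps" by simp
  then have "\<exists>ps. cayley_chain G S x (cayley_vertex h) ps"
    by (rule cayley_chain_trans [OF g(2)])
  then show ?thesis
    by (rule cayley_chain_trans) (rule cayley_chain_sym [OF h(2)])
qed

lemma Metric_space_cayley:
  assumes "group G" "S \<subseteq> carrier G" "generate G S = carrier G"
  shows "Metric_space (cayley_points G S) (cayley_dist G S)"
proof -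
  let ?P = "cayley_points G S" and ?L = "\<lambda>x y. chain_length ` {ps. cayley_chain G S x y ps}"
  have bdd: "bdd_below (?L x y)" for x y
    by (rule bdd_belowI [of _ 0]) (auto simp: chain_length_nonneg)
  have ne: "?L x y \<noteq> {}" if "x \<in> ?P" "y \<in> ?P" for x y
    using cayley_connected [OF assms that] by simp
  have ge: "bary_dist x y \<le> cayley_dist G S x y" if "x \<in> ?P" "y \<in> ?P" for x y
    using that ne [OF that] finite_support_cayley_points [OF that(1)]
    by (auto simp: cayley_dist_def intro!: cInf_greatest bary_dist_le_chain_length)
  show ?thesis
  proof
    fix x y
    show "0 \<le> cayley_dist G S x y"
      using ge [of x y] bary_dist_nonneg [of x y] by (cases "x \<in> ?P \<and> y \<in> ?P") (auto simp: cayley_dist_def)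
    have "?L x y \<subseteq> ?L y x" for x y
    proof
      fix t assume "t \<in> ?L x y"
      then obtain ps where "cayley_chain G S x y ps" "t = chain_length (rev ps)"
        by (auto simp: chain_length_rev)
      then show "t \<in> ?L y x" using cayley_chain_rev by blast
    qed
    then have "?L x y = ?L y x" by blast
    then show "cayley_dist G S x y = cayley_dist G S y x"
      by (simp add: cayley_dist_def)
  next
    fix x y assume xy: "x \<in> ?P" "y \<in> ?P"
    have "cayley_dist G S x x \<le> chain_length [x]"
      using xy bdd [of x x] cayley_chain_refl [of G S x]
      by (auto simp: cayley_dist_def simp del: chain_length_simps intro!: cInf_lower)
    moreover have "x = y" if "cayley_dist G S x y = 0"
      using that ge [OF xy] bary_dist_nonneg [of x y] finite_support_cayley_points xy bary_dist_eq_0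
      by (metis order_antisym)
    moreover have "0 \<le> cayley_dist G S x x"
      using ge [OF xy(1) xy(1)] bary_dist_nonneg [of x x] by linarith
    ultimately show "cayley_dist G S x y = 0 \<longleftrightarrow> x = y" by auto
  next
    fix x y z assume xyz: "x \<in> ?P" "y \<in> ?P" "z \<in> ?P"
    have "cayley_dist G S x z \<le> a + b" if ab: "a \<in> ?L x y" "b \<in> ?L y z" for a b
    proof -
      obtain ps qs where "cayley_chain G S x y ps" "a = chain_length ps"
          "cayley_chain G S y z qs" "b = chain_length qs" using ab by blast
      then have "cayley_chain G S x z (butlast ps @ qs)" "a + b = chain_length (butlast ps @ qs)"
        using cayley_chain_append [of G S x y ps z qs] by auto
      then have "a + b \<in> ?L x z" by blast
      then show ?thesis using bdd xyz by (auto simp: cayley_dist_def intro!: cInf_lower)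
    qed
    then have "cayley_dist G S x z - a \<le> Inf (?L y z)" if "a \<in> ?L x y" for a
      using that ne xyz by (intro cInf_greatest) (auto simp: algebra_simps)
    then have "cayley_dist G S x z - Inf (?L y z) \<le> Inf (?L x y)"
      using ne xyz by (intro cInf_greatest) (auto simp: algebra_simps)
    then show "cayley_dist G S x z \<le> cayley_dist G S x y + cayley_dist G S y z"
      using xyz by (simp add: cayley_dist_def)
  qed
qed

lemma
  assumes "group G" "S \<subseteq> carrier G" "generate G S = carrier G"
  shows mspace_cayley_graph: "mspace (cayley_graph G S) = cayley_points G S"
    and mdist_cayley_graph: "mdist (cayley_graph G S) = cayley_dist G S"
  using Metric_space_cayley [OF assms]
  by (simp_all add: cayley_graph_def Metric_space.mspace_metric Metric_space.mdist_metric)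

lemma mset_dist_antimono:
  assumes "Z' \<subseteq> Z" "Y \<noteq> {}" "Z' \<noteq> {}"
  shows "mset_dist X Y Z \<le> mset_dist X Y Z'"
  unfolding mset_dist_def
  by (rule cInf_superset_mono) (use assms in \<open>auto intro!: bdd_belowI [of _ 0]\<close>)

lemma geodesic_ray_far:
  assumes "geodesic_ray X b a"
  shows "ray_image a \<inter> far_points X b r \<noteq> {}"
proof -
  let ?t = "max r 0"
  have q: "a ` {0..} \<subseteq> mspace X" "a 0 = b"
      "\<forall>s\<in>{0..}. \<forall>t\<in>{0..}. \<bar>s - t\<bar> \<le> mdist X (a s) (a t)"
    using assms by (simp_all add: geodesic_ray_def quasi_geodesic_def)
  then have "a ?t \<in> mspace X" "a 0 = b" by auto
  moreover have "?t \<le> mdist X (a 0) (a ?t)" using q(3) [rule_format, of 0 ?t] by simp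
  ultimately have "a ?t \<in> ray_image a \<inter> far_points X b r"
    by (auto simp: ray_image_def far_points_def)
  then show ?thesis by blast
qed

lemma far_points_antimono: "r \<le> s \<Longrightarrow> far_points X b s \<subseteq> far_points X b r"
  by (auto simp: far_points_def)

lemma boundary_nbhd_antimono:
  assumes "ray_choice X b \<alpha>" "\<zeta> \<in> contracting_boundary X b" "r \<le> s"
  shows "boundary_nbhd X b \<alpha> \<zeta> s \<subseteq> boundary_nbhd X b \<alpha> \<zeta> r"
proof -
  have "geodesic_ray X b (\<alpha> \<zeta>)" using assms by (simp add: ray_choice_def)
  then have "mset_dist X (ray_image \<beta>) (ray_image (\<alpha> \<zeta>) \<inter> far_points X b r)
      \<le> mset_dist X (ray_image \<beta>) (ray_image (\<alpha> \<zeta>) \<inter> far_points X b s)" for \<beta>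
    using far_points_antimono [OF assms(3), of X b] geodesic_ray_far [of X b "\<alpha> \<zeta>" s]
    by (intro mset_dist_antimono) (blast, simp add: ray_image_def, blast)
  then show ?thesis unfolding boundary_nbhd_def by (blast intro: order_trans)
qed

lemma bord_nbhd_antimono:
  assumes "ray_choice X b \<alpha>" "\<zeta> \<in> contracting_boundary X b" "r \<le> s"
  shows "bord_nbhd X b \<alpha> \<zeta> s \<subseteq> bord_nbhd X b \<alpha> \<zeta> r"
proof -
  have "geodesic_ray X b (\<alpha> \<zeta>)" using assms by (simp add: ray_choice_def)
  then have le: "mset_dist X (\<gamma> ` {0..l}) (far_points X b r \<inter> ray_image (\<alpha> \<zeta>))
      \<le> mset_dist X (\<gamma> ` {0..l}) (far_points X b s \<inter> ray_image (\<alpha> \<zeta>))" if "0 \<le> l" for \<gamma> and l :: real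
    using far_points_antimono [OF assms(3), of X b] geodesic_ray_far [of X b "\<alpha> \<zeta>" s] that
    by (intro mset_dist_antimono) (blast, simp, blast)
  show ?thesis
    unfolding bord_nbhd_def
  proof (intro Un_mono image_mono boundary_nbhd_antimono [OF assms] Collect_mono impI conjI allI;
      elim conjE)
    fix x L A l \<gamma>
    assume "0 \<le> l" "1 \<le> L" "0 \<le> A" "quasi_geodesic X L A {0..l} \<gamma>" "continuous_path X {0..l} \<gamma>"
      "\<gamma> 0 = b" "\<gamma> l = x"
      and *: "\<forall>L\<ge>1. \<forall>A\<ge>0. \<forall>l\<ge>0. \<forall>\<gamma>.
        quasi_geodesic X L A {0..l} \<gamma> \<and> continuous_path X {0..l} \<gamma> \<and> \<gamma> 0 = b \<and> \<gamma> l = x \<longrightarrow>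
          mset_dist X (\<gamma> ` {0..l}) (far_points X b s \<inter> ray_image (\<alpha> \<zeta>))
            \<le> kappa (rho_class X b \<zeta>) L A"
    then show "mset_dist X (\<gamma> ` {0..l}) (far_points X b r \<inter> ray_image (\<alpha> \<zeta>))
        \<le> kappa (rho_class X b \<zeta>) L A"
      using le [of l \<gamma>] * [rule_format, of L A l \<gamma>] by linarith
  qed assumption
qed

lemma openin_FQ_topology:
  assumes "ray_choice X b \<alpha>"
  shows "openin (FQ_topology X b \<alpha>) U \<longleftrightarrow> U \<subseteq> contracting_boundary X b \<and>
     (\<forall>\<zeta>\<in>U. \<exists>r\<ge>1. boundary_nbhd X b \<alpha> \<zeta> r \<subseteq> U)"
proof -
  let ?P = "\<lambda>U. U \<subseteq> contracting_boundary X b \<and> (\<forall>\<zeta>\<in>U. \<exists>r\<ge>1. boundary_nbhd X b \<alpha> \<zeta> r \<subseteq> U)"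
  have "?P (U \<inter> V)" if U: "?P U" and V: "?P V" for U V
  proof (intro conjI ballI)
    show "U \<inter> V \<subseteq> contracting_boundary X b" using U by blast
    fix \<zeta> assume "\<zeta> \<in> U \<inter> V"
    then obtain r s where "r \<ge> 1" "boundary_nbhd X b \<alpha> \<zeta> r \<subseteq> U" "s \<ge> 1" "boundary_nbhd X b \<alpha> \<zeta> s \<subseteq> V"
      and \<zeta>: "\<zeta> \<in> contracting_boundary X b" using U V by blast
    moreover have "boundary_nbhd X b \<alpha> \<zeta> (max r s) \<subseteq> boundary_nbhd X b \<alpha> \<zeta> r \<inter> boundary_nbhd X b \<alpha> \<zeta> s"
      using boundary_nbhd_antimono [OF assms \<zeta>] by simp
    ultimately show "\<exists>r\<ge>1. boundary_nbhd X b \<alpha> \<zeta> r \<subseteq> U \<inter> V"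
      by (intro exI [of _ "max r s"]) auto
  qed
  moreover have "?P (\<Union>\<K>)" if "\<forall>K\<in>\<K>. ?P K" for \<K>
    using that by (intro conjI ballI) (blast, meson Union_iff Union_upper order_trans)
  ultimately have "istopology ?P" unfolding istopology_def by blast
  then show ?thesis by (simp add: FQ_topology_def topology_inverse')
qed

lemma openin_bord_topology:
  assumes "ray_choice X b \<alpha>"
  shows "openin (bord_topology X b \<alpha>) U \<longleftrightarrow> U \<subseteq> Inl ` mspace X \<union> Inr ` contracting_boundary X b \<and>
     (\<forall>x. Inl x \<in> U \<longrightarrow> (\<exists>r>0. Inl ` mball_of X x r \<subseteq> U)) \<and>
     (\<forall>\<zeta>. Inr \<zeta> \<in> U \<longrightarrow> (\<exists>r\<ge>1. bord_nbhd X b \<alpha> \<zeta> r \<subseteq> U))"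
proof -
  let ?P = "\<lambda>U. U \<subseteq> Inl ` mspace X \<union> Inr ` contracting_boundary X b \<and>
     (\<forall>x. Inl x \<in> U \<longrightarrow> (\<exists>r>0. Inl ` mball_of X x r \<subseteq> U)) \<and>
     (\<forall>\<zeta>. Inr \<zeta> \<in> U \<longrightarrow> (\<exists>r\<ge>1. bord_nbhd X b \<alpha> \<zeta> r \<subseteq> U))"
  have Int: "?P (U \<inter> V)" if U: "?P U" and V: "?P V" for U V
  proof (intro conjI allI impI)
    show "U \<inter> V \<subseteq> Inl ` mspace X \<union> Inr ` contracting_boundary X b" using U by blast
    fix x assume x: "Inl x \<in> U \<inter> V"
    obtain r where r: "r > 0" "Inl ` mball_of X x r \<subseteq> U" using U x by blast
    obtain s where s: "s > 0" "Inl ` mball_of X x s \<subseteq> V" using V x by blast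
    have "Inl ` mball_of X x (min r s) \<subseteq> Inl ` mball_of X x r \<inter> Inl ` mball_of X x s" by auto
    then show "\<exists>r>0. Inl ` mball_of X x r \<subseteq> U \<inter> V"
      using r s by (intro exI [of _ "min r s"]) auto
  next
    fix \<zeta> assume *: "Inr \<zeta> \<in> U \<inter> V"
    obtain r where r: "r \<ge> 1" "bord_nbhd X b \<alpha> \<zeta> r \<subseteq> U" using U * by blast
    obtain s where s: "s \<ge> 1" "bord_nbhd X b \<alpha> \<zeta> s \<subseteq> V" using V * by blast
    have \<zeta>: "\<zeta> \<in> contracting_boundary X b" using U * by blast
    have "bord_nbhd X b \<alpha> \<zeta> (max r s) \<subseteq> bord_nbhd X b \<alpha> \<zeta> r \<inter> bord_nbhd X b \<alpha> \<zeta> s"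
      using bord_nbhd_antimono [OF assms \<zeta>] by simp
    then show "\<exists>r\<ge>1. bord_nbhd X b \<alpha> \<zeta> r \<subseteq> U \<inter> V"
      using r s by (intro exI [of _ "max r s"]) auto
  qed
  have Un: "?P (\<Union>\<K>)" if K: "\<forall>K\<in>\<K>. ?P K" for \<K>
  proof (intro conjI allI impI)
    show "\<Union>\<K> \<subseteq> Inl ` mspace X \<union> Inr ` contracting_boundary X b"
      by (rule Union_least) (rule bspec [OF K, THEN conjunct1])
  next
    fix x assume "Inl x \<in> \<Union>\<K>"
    then obtain A where A: "A \<in> \<K>" "Inl x \<in> A" by blast
    then obtain r where "r > 0" "Inl ` mball_of X x r \<subseteq> A"
      using bspec [OF K A(1), THEN conjunct2, THEN conjunct1] by blast
    then show "\<exists>r>0. Inl ` mball_of X x r \<subseteq> \<Union>\<K>" using A by blast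
  next
    fix \<zeta> assume "Inr \<zeta> \<in> \<Union>\<K>"
    then obtain A where A: "A \<in> \<K>" "Inr \<zeta> \<in> A" by blast
    then obtain r where "r \<ge> 1" "bord_nbhd X b \<alpha> \<zeta> r \<subseteq> A"
      using bspec [OF K A(1), THEN conjunct2, THEN conjunct2] by blast
    then show "\<exists>r\<ge>1. bord_nbhd X b \<alpha> \<zeta> r \<subseteq> \<Union>\<K>" using A by blast
  qed
  have "istopology ?P"
    unfolding istopology_def
  proof (rule conjI; intro allI impI)
    show "?P (U \<inter> V)" if "?P U" "?P V" for U V by (rule Int [OF that])
    show "?P (\<Union>\<K>)" if "\<forall>K\<in>\<K>. ?P K" for \<K> using that by (rule Un)
  qed
  then show ?thesis by (simp add: bord_topology_def topology_inverse')
qed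

end

theory Submission
  imports Defs "HOL-Real_Asymp.Real_Asymp"
begin

text \<open>
  Let \<open>\<beta>, \<gamma>\<close> be continuous \<open>(L, A)\<close>-quasi-geodesic rays from \<open>b\<close> to boundary points close to \<open>y\<close> and
  \<open>z\<close>, where \<open>y \<noteq> z\<close>. They follow the geodesic rays of \<open>y\<close> and \<open>z\<close> for a long time, so the initial
  segment on which they agree has bounded length. This single principle is used twice. Applied to
  rays obtained by surgery, it shows that the geodesic rays to points near \<open>y\<close> and \<open>z\<close> diverge at a
  uniform linear rate. Hence a compact set \<open>K\<close> of distinct triples spans tripods with uniform
  constants, and any point \<open>p\<close> is joined to at least two of the three ends of each of them by uniform
  quasi-geodesics which agree from \<open>p\<close> to \<open>b\<close>: go to a closest point of the tripod and follow its
  leg back to \<open>b\<close>. If \<open>h\<close> moves a triple of \<open>K\<close> into \<open>K\<close>, take \<open>p = h\<^sup>-\<^sup>1 b\<close> and translate these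
  rays by \<open>h\<close>. They now start at \<open>b\<close>, end at distinct entries of a triple in \<open>K\<close> and agree for time at
  least \<open>d(p, b)\<close>, which is thereby bounded in terms of \<open>K\<close>. Only finitely many \<open>h\<close> remain.
\<close>

section \<open>Distances, projections and contraction\<close>

text \<open>The obstacle is a lack of uniformity: every boundary point has its own sublinear
  contraction function, and nothing bounds these over \<open>K\<close>. For a ray towards a point
  near \<open>y\<close>, the uniform bounds therefore use only its constants \<open>L\<close>,
  \<open>A\<close> and the contraction of the fixed ray of \<open>y\<close>. This is why surgery
  must produce constants independent of the distance between the two rays, and why the order of the
  two compactness arguments matters: the first yields the divergence constant \<open>N\<close>,
  which fixes the additive constant \<open>4 * N + 8\<close> of the tripod rays, and only for rays
  of this quality is the time of agreement then bounded.

  Compactness needs open sets, whereas the sets U(\<zeta>, r) are not known to be open. That each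
  contains an open set around \<zeta> is a second use of surgery: a ray ending near \<eta> is
  redirected to \<eta>, late enough to profit from what is known about \<eta>.

  Behind the fellow travelling is a race: far from a contracting set, the projection of a
  quasi-geodesic moves at no more than half of the guaranteed speed, so the quasi-geodesic cannot
  stay far away for long.\<close>

lemma mdist_self [simp]: "x \<in> mspace X \<Longrightarrow> mdist X x x = 0"
  by simp

lemma mset_dist_le:
  assumes "y \<in> Y" "z \<in> Z"
  shows "mset_dist X Y Z \<le> mdist X y z"
  unfolding mset_dist_def
  by (rule cInf_lower) (use assms in \<open>auto intro!: bdd_belowI [of _ 0]\<close>)

lemma mset_dist_approx:
  assumes "Y \<noteq> {}" "Z \<noteq> {}" "0 < e"
  shows "\<exists>y\<in>Y. \<exists>z\<in>Z. mdist X y z < mset_dist X Y Z + e"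
proof -
  have "{mdist X y z | y z. y \<in> Y \<and> z \<in> Z} \<noteq> {}" using assms by blast
  then show ?thesis
    using cInf_lessD [of "{mdist X y z | y z. y \<in> Y \<and> z \<in> Z}" "mset_dist X Y Z + e"] assms(3)
    by (auto simp: mset_dist_def)
qed

lemma mset_dist_greatest:
  assumes "Y \<noteq> {}" "Z \<noteq> {}" "\<And>y z. y \<in> Y \<Longrightarrow> z \<in> Z \<Longrightarrow> e \<le> mdist X y z"
  shows "e \<le> mset_dist X Y Z"
  unfolding mset_dist_def
  by (rule cInf_greatest) (use assms in auto)

lemma mset_dist_nonneg: "Y \<noteq> {} \<Longrightarrow> Z \<noteq> {} \<Longrightarrow> 0 \<le> mset_dist X Y Z"
  by (rule mset_dist_greatest) auto

lemma mset_dist_point_triangle: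
  assumes "Z \<noteq> {}" "Z \<subseteq> mspace X" "x \<in> mspace X" "y \<in> mspace X"
  shows "mset_dist X {x} Z \<le> mdist X x y + mset_dist X {y} Z"
proof -
  have "mset_dist X {x} Z - mdist X x y \<le> mset_dist X {y} Z"
  proof (rule mset_dist_greatest)
    fix y' z assume "y' \<in> {y}" "z \<in> Z"
    then have "mset_dist X {x} Z \<le> mdist X x z" "mdist X x z \<le> mdist X x y + mdist X y' z"
      using assms mdist_triangle [of x X y z] by (auto intro: mset_dist_le)
    then show "mset_dist X {x} Z - mdist X x y \<le> mdist X y' z" by linarith
  qed (use assms in auto)
  then show ?thesis by linarith
qed

lemma mset_dist_lipschitz:
  assumes "Z \<noteq> {}" "Z \<subseteq> mspace X" "x \<in> mspace X" "y \<in> mspace X"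
  shows "\<bar>mset_dist X {x} Z - mset_dist X {y} Z\<bar> \<le> mdist X x y"
  using mset_dist_point_triangle [OF assms] mset_dist_point_triangle [OF assms(1,2,4,3)]
    mdist_commute [of X x y] by simp

lemma mdiam_le:
  assumes "Z \<noteq> {}" "\<And>y z. y \<in> Z \<Longrightarrow> z \<in> Z \<Longrightarrow> mdist X y z \<le> B"
  shows "mdiam X Z \<le> B"
proof -
  have "{mdist X y z | y z. y \<in> Z \<and> z \<in> Z} \<noteq> {}" using assms(1) by blast
  then show ?thesis unfolding mdiam_def by (rule cSup_least) (use assms(2) in auto)
qed

lemma mdist_le_mdiam:
  assumes "\<And>y z. y \<in> Z \<Longrightarrow> z \<in> Z \<Longrightarrow> mdist X y z \<le> B" "y \<in> Z" "z \<in> Z"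
  shows "mdist X y z \<le> mdiam X Z"
proof -
  have "bdd_above {mdist X y z | y z. y \<in> Z \<and> z \<in> Z}" using assms(1) by (auto intro!: bdd_aboveI [of _ B])
  then show ?thesis unfolding mdiam_def by (rule cSup_upper [rotated]) (use assms in auto)
qed

lemma closest_projD:
  assumes "p \<in> closest_proj X Z x"
  shows "p \<in> Z" "mdist X x p = mset_dist X {x} Z"
  using assms by (auto simp: closest_proj_def)

text \<open>\<open>mdiam\<close> is a supremum of reals and bounds the distances in a set only if
  that set is bounded. This crude estimate through \<open>x\<close> supplies the
  boundedness.\<close>

lemma closest_proj_union_bounded:
  assumes "Z \<subseteq> mspace X" "x \<in> mspace X" "y \<in> mspace X"
    "p \<in> closest_proj X Z x \<union> closest_proj X Z y" "q \<in> closest_proj X Z x \<union> closest_proj X Z y"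
  shows "mdist X p q \<le> 2 * (mset_dist X {x} Z + mset_dist X {y} Z + mdist X x y)"
proof -
  have *: "mdist X x u \<le> mset_dist X {x} Z + mset_dist X {y} Z + mdist X x y" "u \<in> mspace X"
    if "u \<in> closest_proj X Z x \<union> closest_proj X Z y" for u
  proof -
    show u: "u \<in> mspace X" using that assms(1) by (auto simp: closest_proj_def)
    have "Z \<noteq> {}" using that by (auto simp: closest_proj_def)
    then have "0 \<le> mset_dist X {x} Z" "0 \<le> mset_dist X {y} Z" by (simp_all add: mset_dist_nonneg)
    then show "mdist X x u \<le> mset_dist X {x} Z + mset_dist X {y} Z + mdist X x y"
      using that closest_projD(2) [of u X Z x] closest_projD(2) [of u X Z y]
        mdist_triangle [OF assms(2,3) u] mdist_nonneg [of X x y] by (auto simp del: mdist_nonneg)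
  qed
  show ?thesis
    using *[OF assms(4)] *[OF assms(5)] mdist_triangle [of p X x q] mdist_commute [of X p x] assms(2)
    by simp
qed

lemma contracting_forD:
  assumes "contracting_for X \<rho> Z" "Z \<subseteq> mspace X" "x \<in> mspace X" "y \<in> mspace X"
    "mdist X x y \<le> mset_dist X {x} Z"
    "p \<in> closest_proj X Z x \<union> closest_proj X Z y" "q \<in> closest_proj X Z x \<union> closest_proj X Z y"
  shows "mdist X p q \<le> \<rho> (mset_dist X {x} Z)"
proof -
  have "mdist X p q \<le> mdiam X (closest_proj X Z x \<union> closest_proj X Z y)"
    by (rule mdist_le_mdiam [OF closest_proj_union_bounded [OF assms(2-4)]]) (use assms in auto)
  also have "\<dots> \<le> \<rho> (mset_dist X {x} Z)"
    using assms by (auto simp: contracting_for_def)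
  finally show ?thesis .
qed

lemma contracting_forI:
  assumes "Z \<subseteq> mspace X" "\<And>x. x \<in> mspace X \<Longrightarrow> closest_proj X Z x \<noteq> {}"
    and "\<And>x y p q. \<lbrakk>x \<in> mspace X; y \<in> mspace X; mdist X x y \<le> mset_dist X {x} Z;
       p \<in> closest_proj X Z x \<union> closest_proj X Z y; q \<in> closest_proj X Z x \<union> closest_proj X Z y\<rbrakk>
       \<Longrightarrow> mdist X p q \<le> \<rho> (mset_dist X {x} Z)"
  shows "contracting_for X \<rho> Z"
  unfolding contracting_for_def
proof (intro conjI ballI impI)
  fix x y assume "x \<in> mspace X" "y \<in> mspace X" "mdist X x y \<le> mset_dist X {x} Z"
  then show "mdiam X (closest_proj X Z x \<union> closest_proj X Z y) \<le> \<rho> (mset_dist X {x} Z)"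
    using assms(2) assms(3) [of x y] by (intro mdiam_le) blast+
qed (use assms(2) in blast)

lemma contracting_for_proj:
  assumes "contracting_for X \<rho> Z" "x \<in> mspace X"
  obtains p where "p \<in> closest_proj X Z x"
proof -
  have "closest_proj X Z x \<noteq> {}" using assms by (simp add: contracting_for_def)
  then show ?thesis using that by blast
qed

text \<open>Sublinearity makes \<open>\<rho>\<close> nonnegative only eventually. At distances that
  actually occur, contraction with \<open>y = x\<close> gives it.\<close>

lemma contracting_for_nonneg:
  assumes "contracting_for X \<rho> Z" "Z \<subseteq> mspace X" "x \<in> mspace X"
  shows "0 \<le> \<rho> (mset_dist X {x} Z)"
proof -
  obtain p where p: "p \<in> closest_proj X Z x" using assms contracting_for_proj by metis
  then have "Z \<noteq> {}" by (auto simp: closest_proj_def)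
  then have "mdist X x x \<le> mset_dist X {x} Z"
    using mset_dist_nonneg [of "{x}" Z X] mdist_zero [OF assms(3,3)] by simp
  then have "mdist X p p \<le> \<rho> (mset_dist X {x} Z)"
    by (rule contracting_forD [OF assms assms(3)]) (use p in auto)
  then show ?thesis using mdist_nonneg [of X p p] by linarith
qed

lemma quasi_geodesicD:
  assumes "quasi_geodesic X L A I c" "s \<in> I" "t \<in> I"
  shows "mdist X (c s) (c t) \<le> L * \<bar>s - t\<bar> + A" "\<bar>s - t\<bar> / L - A \<le> mdist X (c s) (c t)"
    "c s \<in> mspace X"
  using assms by (auto simp: quasi_geodesic_def)

lemma quasi_geodesic_mono:
  assumes "quasi_geodesic X L A I c" "L \<le> L'" "A \<le> A'" "1 \<le> L"
  shows "quasi_geodesic X L' A' I c"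
proof -
  have "1 / L' * \<bar>s - t\<bar> \<le> 1 / L * \<bar>s - t\<bar>" "L * \<bar>s - t\<bar> \<le> L' * \<bar>s - t\<bar>" for s t
    using assms by (auto intro!: mult_right_mono simp: frac_le)
  then show ?thesis using assms(1,3) unfolding quasi_geodesic_def by (smt (verit))
qed

section \<open>Travelling outside a neighbourhood of a contracting set\<close>

text \<open>
  Outside the \<open>k\<close>-neighbourhood of \<open>Z\<close> one moves by steps of duration \<open>(\<delta> - A) / L\<close>, where
  \<open>\<delta>\<close> is the current distance to \<open>Z\<close>; each step displaces the projection by at most
  \<open>\<rho> \<delta> \<le> \<delta> / (3 L\<^sup>2)\<close>, which is at most half the speed forced by the quasi-geodesic inequality.
\<close>

lemma projection_outside:
  assumes Z: "contracting_for X \<rho> Z" "Z \<subseteq> mspace X"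
    and L: "1 \<le> L" and A: "0 \<le> A" and k: "0 < k" "3 * A \<le> k" "\<forall>r\<ge>k. 3 * L\<^sup>2 * \<rho> r \<le> r"
    and qg: "quasi_geodesic X L A I \<beta>" "{s..t} \<subseteq> I" "s \<le> t"
    and out: "\<And>u. u \<in> {s..t} \<Longrightarrow> k \<le> mset_dist X {\<beta> u} Z"
    and pq: "p \<in> closest_proj X Z (\<beta> s)" "q \<in> closest_proj X Z (\<beta> t)"
  shows "mdist X p q \<le> (t - s) / (2 * L) + (mset_dist X {\<beta> t} Z + A) / 3"
proof -
  let ?D = "\<lambda>u. mset_dist X {\<beta> u} Z"
  \<comment> \<open>The final step, of any duration up to the permitted one. Here
    \<open>?D s\<close> is at most \<open>L * (t - s) + A + ?D t\<close>, which turns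
    \<open>?D s / (3 * L\<^sup>2)\<close> into a share of the time spent plus the end term
    \<open>(?D t + A) / 3\<close>.\<close>
  have small: "mdist X p q \<le> (t - s) / (2 * L) + (?D t + A) / 3"
    if "t - s \<le> (?D s - A) / L" "{s..t} \<subseteq> I" "s \<le> t" "k \<le> ?D s"
      "p \<in> closest_proj X Z (\<beta> s)" for s p
  proof -
    have st: "s \<in> I" "t \<in> I" using that by auto
    note qst = quasi_geodesicD [OF qg(1) st] quasi_geodesicD(3) [OF qg(1) st(2,1)]
    have "L * (t - s) \<le> ?D s - A" using that(1) L by (simp add: field_simps)
    then have "mdist X (\<beta> s) (\<beta> t) \<le> ?D s" using qst that(3) by simp
    then have "mdist X p q \<le> \<rho> (?D s)"
      using contracting_forD [OF Z qst(3,4)] pq(2) that(5) by blast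
    then have "3 * L\<^sup>2 * mdist X p q \<le> 3 * L\<^sup>2 * \<rho> (?D s)" by (intro mult_left_mono) auto
    also have "\<dots> \<le> ?D s" using k(3) that(4) by blast
    finally have 1: "3 * L\<^sup>2 * mdist X p q \<le> ?D s" .
    have "Z \<noteq> {}" using that(5) by (auto simp: closest_proj_def)
    then have "?D s \<le> mdist X (\<beta> s) (\<beta> t) + ?D t"
      by (rule mset_dist_point_triangle) (use Z qst in auto)
    then have 2: "?D s \<le> L * (t - s) + A + ?D t" using qst that(3) by simp
    have Dt: "0 \<le> ?D t" using \<open>Z \<noteq> {}\<close> by (simp add: mset_dist_nonneg)
    have "mdist X p q \<le> ?D s / (3 * L\<^sup>2)" using 1 L by (simp add: field_simps)
    also have "\<dots> \<le> (L * (t - s) + (A + ?D t)) / (3 * L\<^sup>2)" using 2 L by (intro divide_right_mono) auto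
    also have "\<dots> = (t - s) / (3 * L) + (A + ?D t) / (3 * L\<^sup>2)"
      using L by (simp add: field_simps power2_eq_square)
    also have "(t - s) / (3 * L) \<le> (t - s) / (2 * L)"
      using L that(3) by (intro divide_left_mono) auto
    also have "(A + ?D t) / (3 * L\<^sup>2) \<le> (A + ?D t) / 3"
      using L A Dt by (intro divide_left_mono) auto
    finally show ?thesis by (simp add: add.commute)
  qed
  \<comment> \<open>Induction on the number of steps: a full one lasts at least
    \<open>2 * k / (3 * L)\<close>, so finitely many exhaust \<open>t - s\<close>.\<close>
  have "mdist X p q \<le> (t - s) / (2 * L) + (mset_dist X {\<beta> t} Z + A) / 3"
    if "t - s \<le> real n * (2 * k / (3 * L))" "{s..t} \<subseteq> I" "s \<le> t"
      "\<And>u. u \<in> {s..t} \<Longrightarrow> k \<le> mset_dist X {\<beta> u} Z" "p \<in> closest_proj X Z (\<beta> s)" for n s p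
    using that
  proof (induction n arbitrary: s p)
    case 0
    have "A \<le> ?D s" using 0(4) [of s] 0(3) k A by auto
    then have "0 \<le> (?D s - A) / L" using L by auto
    then show ?case using 0 by (intro small) auto
  next
    case (Suc n)
    show ?case
    proof (cases "t - s \<le> (?D s - A) / L")
      case True
      then show ?thesis using small Suc.prems by auto
    next
      case False
      \<comment> \<open>The longest duration for which contraction is guaranteed:
        \<open>L * (s' - s) + A\<close> equals \<open>?D s\<close>. Since \<open>A\<close> is at
        most a third of \<open>?D s\<close>, this duration is at least
        \<open>2 * ?D s / (3 * L)\<close>.\<close>
      define s' where "s' = s + (?D s - A) / L"
      have Ds: "k \<le> ?D s" using Suc.prems by auto
      have A3: "A \<le> ?D s / 3" using Ds k by linarith
      then have "2 * ?D s / 3 / L \<le> (?D s - A) / L" using L by (intro divide_right_mono) auto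
      then have step: "2 * ?D s / (3 * L) \<le> s' - s" by (simp add: s'_def)
      have "2 * k / (3 * L) \<le> 2 * ?D s / (3 * L)" using Ds L by (intro divide_right_mono) auto
      with step have step': "2 * k / (3 * L) \<le> s' - s" by linarith
      have "0 \<le> 2 * k / (3 * L)" using k(1) L by simp
      then have s'2: "s \<le> s'" "s' \<le> t" using step' False unfolding s'_def by linarith+
      have ss': "s \<in> I" "s' \<in> I" using Suc.prems s'2 by auto
      note q = quasi_geodesicD [OF qg(1) ss'] quasi_geodesicD(3) [OF qg(1) ss'(2,1)]
      obtain p' where p': "p' \<in> closest_proj X Z (\<beta> s')" using contracting_for_proj [OF Z(1) q(4)] .
      have "L * \<bar>s - s'\<bar> + A = ?D s" using s'2 L A3 Ds k(1) by (simp add: s'_def)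
      then have "mdist X p p' \<le> \<rho> (?D s)"
        using q p' Suc.prems by (intro contracting_forD [OF Z q(3,4)]) auto
      then have "3 * L\<^sup>2 * mdist X p p' \<le> 3 * L\<^sup>2 * \<rho> (?D s)" by (intro mult_left_mono) auto
      also have "\<dots> \<le> ?D s" using k(3) Ds by blast
      finally have "mdist X p p' \<le> (2 * ?D s / (3 * L)) / (2 * L)"
        using L by (simp add: field_simps power2_eq_square)
      also have "\<dots> \<le> (s' - s) / (2 * L)" using step L by (intro divide_right_mono) auto
      finally have 1: "mdist X p p' \<le> (s' - s) / (2 * L)" .
      have 2: "mdist X p' q \<le> (t - s') / (2 * L) + (?D t + A) / 3"
      proof (rule Suc.IH [OF _ _ s'2(2) _ p'])
        have "t - s \<le> real n * (2 * k / (3 * L)) + 2 * k / (3 * L)"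
          using Suc.prems(1) by (simp add: distrib_right add_divide_distrib)
        then show "t - s' \<le> real n * (2 * k / (3 * L))" using step' by linarith
      qed (use Suc.prems s'2 in auto)
      have "p \<in> mspace X" "p' \<in> mspace X" "q \<in> mspace X"
        using Suc.prems(5) p' pq(2) Z(2) by (auto simp: closest_proj_def)
      then have "mdist X p q \<le> mdist X p p' + mdist X p' q" by (rule mdist_triangle)
      also have "\<dots> \<le> (s' - s) / (2 * L) + ((t - s') / (2 * L) + (?D t + A) / 3)" using 1 2 by linarith
      also have "\<dots> = (t - s) / (2 * L) + (?D t + A) / 3" by (simp add: diff_divide_distrib)
      finally show ?thesis .
    qed
  qed
  moreover obtain n where "(t - s) / (2 * k / (3 * L)) \<le> real n" using real_arch_simple by blast
  then have "t - s \<le> real n * (2 * k / (3 * L))" using L k(1) by (simp add: field_simps)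
  ultimately show ?thesis using qg(2,3) out pq(1) by blast
qed

text \<open>A quasi-geodesic covers at least \<open>(t - s) / L - A\<close>, while its projection
  accounts for at most \<open>(t - s) / (2 * L)\<close> plus an end term. The surplus
  \<open>(t - s) / (2 * L)\<close> must be paid by the distances to \<open>Z\<close> at the two
  ends.\<close>

lemma time_outside:
  assumes Z: "contracting_for X \<rho> Z" "Z \<subseteq> mspace X"
    and L: "1 \<le> L" and A: "0 \<le> A" and k: "0 < k" "3 * A \<le> k" "\<forall>r\<ge>k. 3 * L\<^sup>2 * \<rho> r \<le> r"
    and qg: "quasi_geodesic X L A I \<beta>" "{s..t} \<subseteq> I" "s \<le> t"
    and out: "\<And>u. u \<in> {s..t} \<Longrightarrow> k \<le> mset_dist X {\<beta> u} Z"
  shows "t - s \<le> 4 * L * (mset_dist X {\<beta> s} Z + mset_dist X {\<beta> t} Z + A)"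
proof -
  let ?D = "\<lambda>u. mset_dist X {\<beta> u} Z"
  have st: "s \<in> I" "t \<in> I" using qg by auto
  note q = quasi_geodesicD [OF qg(1) st] quasi_geodesicD(3) [OF qg(1) st(2,1)]
  obtain x where x: "x \<in> closest_proj X Z (\<beta> s)" using contracting_for_proj [OF Z(1) q(3)] .
  obtain y where y: "y \<in> closest_proj X Z (\<beta> t)" using contracting_for_proj [OF Z(1) q(4)] .
  have m: "x \<in> mspace X" "y \<in> mspace X" using x y Z(2) by (auto simp: closest_proj_def)
  have "mdist X x y \<le> (t - s) / (2 * L) + (?D t + A) / 3"
    by (rule projection_outside [OF Z L A k qg out x y])
  moreover have "mdist X (\<beta> s) (\<beta> t) \<le> ?D s + mdist X x y + ?D t"
    using mdist_triangle [OF q(3) m(1) q(4)] mdist_triangle [OF m q(4)]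
      closest_projD(2) [OF x] closest_projD(2) [OF y] mdist_commute [of X y "\<beta> t"] by linarith
  moreover have "(t - s) / L - A \<le> mdist X (\<beta> s) (\<beta> t)" using q qg(3) by simp
  moreover define h where "h = (t - s) / (2 * L)"
  moreover have "(t - s) / L = h + h" by (simp add: h_def field_simps)
  moreover have "0 \<le> ?D s" "0 \<le> ?D t" using out [of s] out [of t] k qg by auto
  ultimately have "h \<le> 2 * (?D s + ?D t + A)" using A by argo
  then show ?thesis using L by (simp add: h_def field_simps)
qed

section \<open>Continuous quasi-geodesic rays\<close>

lemma continuous_on_lipschitz_path:
  assumes "continuous_path X I c" "\<And>x y. x \<in> mspace X \<Longrightarrow> y \<in> mspace X \<Longrightarrow> \<bar>g x - g y\<bar> \<le> mdist X x y"
  shows "continuous_on I (\<lambda>t. g (c t) :: real)"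
proof -
  have "Lipschitz_continuous_map X euclidean_metric g"
    unfolding Lipschitz_continuous_map_def
    by (auto intro!: exI [of _ 1] assms(2) simp: dist_real_def)
  then have "continuous_map (mtopology_of X) euclidean g"
    using Lipschitz_continuous_imp_continuous_map by fastforce
  with assms(1) have "continuous_map (top_of_set I) euclidean (g \<circ> c)"
    unfolding continuous_path_def by (rule continuous_map_compose)
  then show ?thesis by (simp add: o_def)
qed

lemma continuous_path_lipschitz:
  assumes "c ` I \<subseteq> mspace X" "\<And>s t. s \<in> I \<Longrightarrow> t \<in> I \<Longrightarrow> mdist X (c s) (c t) \<le> \<bar>s - t\<bar>"
  shows "continuous_path X I c"
proof -
  have "Lipschitz_continuous_map (submetric euclidean_metric I) X c"
    unfolding Lipschitz_continuous_map_def
    using assms by (auto intro!: exI [of _ 1] simp: dist_real_def)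
  then show ?thesis
    using Lipschitz_continuous_imp_continuous_map
    by (fastforce simp: continuous_path_def mtopology_of_submetric)
qed

lemma continuous_path_subset:
  "continuous_path X I c \<Longrightarrow> J \<subseteq> I \<Longrightarrow> continuous_path X J c"
  unfolding continuous_path_def using continuous_map_from_subtopology_mono by blast

lemma first_time:
  fixes f :: "real \<Rightarrow> real"
  assumes "continuous_on {a..b} f" "a \<le> b" "y \<le> f a" "f b \<le> y"
  obtains c where "c \<in> {a..b}" "f c = y" "\<And>u. u \<in> {a..c} \<Longrightarrow> y \<le> f u"
proof -
  define S where "S = {u \<in> {a..b}. f u = y}"
  have "S = {a..b} \<inter> f -` {y}" by (auto simp: S_def)
  then have "closed S" using continuous_closed_preimage [OF assms(1), of "{y}"] by simp
  moreover have "bounded S" by (rule bounded_subset [OF bounded_closed_interval [of a b]]) (auto simp: S_def)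
  ultimately have "compact S" by (simp add: compact_eq_bounded_closed)
  moreover have "S \<noteq> {}" using IVT2' [of f b y a] assms by (auto simp: S_def)
  ultimately obtain c where c: "c \<in> S" "\<forall>u\<in>S. c \<le> u"
    using compact_attains_inf [of S] by blast
  have "y \<le> f u" if u: "u \<in> {a..c}" for u
  proof (rule ccontr)
    assume less: "\<not> y \<le> f u"
    then have "u \<noteq> c" using c(1) by (auto simp: S_def)
    have "continuous_on {a..u} f"
      by (rule continuous_on_subset [OF assms(1)]) (use u c(1) in \<open>auto simp: S_def\<close>)
    then obtain v where "v \<in> {a..u}" "f v = y"
      using IVT2' [of f u y a] less assms(3) u by auto
    then have "v \<in> S" using u c(1) by (auto simp: S_def)
    then have "c \<le> v" using c(2) by blast
    then show False using \<open>v \<in> {a..u}\<close> u \<open>u \<noteq> c\<close> by simp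
  qed
  then show ?thesis using that c(1) by (auto simp: S_def)
qed

lemma last_time:
  fixes f :: "real \<Rightarrow> real"
  assumes "continuous_on {a..b} f" "a \<le> b" "f a \<le> y" "y \<le> f b"
  obtains c where "c \<in> {a..b}" "f c = y" "\<And>u. u \<in> {c..b} \<Longrightarrow> y \<le> f u"
proof -
  have "continuous_on {-b..-a} (\<lambda>u. f (- u))"
    by (rule continuous_on_compose2 [OF assms(1)]) (auto intro!: continuous_intros)
  then obtain c where c: "c \<in> {-b..-a}" "f (- c) = y" "\<And>u. u \<in> {-b..c} \<Longrightarrow> y \<le> f (- u)"
    by (rule first_time [of "-b" "-a" _ y]) (use assms in auto)
  have "y \<le> f u" if "u \<in> {-c..b}" for u using c(3) [of "- u"] that by auto
  then show ?thesis using that [of "- c"] c by auto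
qed

definition quasi_ray :: "'p metric \<Rightarrow> 'p \<Rightarrow> real \<Rightarrow> real \<Rightarrow> 'p path \<Rightarrow> bool" where
  "quasi_ray X b L A \<beta> \<longleftrightarrow> 1 \<le> L \<and> 0 \<le> A \<and> quasi_geodesic X L A {0..} \<beta> \<and>
     continuous_path X {0..} \<beta> \<and> \<beta> 0 = b"

lemma quasi_rayD:
  assumes "quasi_ray X b L A \<beta>"
  shows "1 \<le> L" "0 \<le> A" "quasi_geodesic X L A {0..} \<beta>" "continuous_path X {0..} \<beta>" "\<beta> 0 = b"
    "b \<in> mspace X" "0 \<le> t \<Longrightarrow> \<beta> t \<in> mspace X"
    "0 \<le> s \<Longrightarrow> 0 \<le> t \<Longrightarrow> mdist X (\<beta> s) (\<beta> t) \<le> L * \<bar>s - t\<bar> + A"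
    "0 \<le> s \<Longrightarrow> 0 \<le> t \<Longrightarrow> \<bar>s - t\<bar> / L - A \<le> mdist X (\<beta> s) (\<beta> t)"
    "0 \<le> t \<Longrightarrow> mdist X b (\<beta> t) \<le> L * t + A"
    "0 \<le> t \<Longrightarrow> t \<le> L * (mdist X b (\<beta> t) + A)"
proof -
  show *: "1 \<le> L" "0 \<le> A" "quasi_geodesic X L A {0..} \<beta>" "continuous_path X {0..} \<beta>" "\<beta> 0 = b"
    using assms by (simp_all add: quasi_ray_def)
  show "b \<in> mspace X" using quasi_geodesicD(3) [OF *(3), of 0 0] *(5) by simp
  show "0 \<le> t \<Longrightarrow> \<beta> t \<in> mspace X" using quasi_geodesicD(3) [OF *(3), of t t] by simp
  show d: "0 \<le> s \<Longrightarrow> 0 \<le> t \<Longrightarrow> mdist X (\<beta> s) (\<beta> t) \<le> L * \<bar>s - t\<bar> + A"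
    "0 \<le> s \<Longrightarrow> 0 \<le> t \<Longrightarrow> \<bar>s - t\<bar> / L - A \<le> mdist X (\<beta> s) (\<beta> t)" for s t
    using quasi_geodesicD(1,2) [OF *(3), of s t] by auto
  show "0 \<le> t \<Longrightarrow> mdist X b (\<beta> t) \<le> L * t + A" using d(1) [of 0 t] *(5) by simp
  show "t \<le> L * (mdist X b (\<beta> t) + A)" if "0 \<le> t"
  proof -
    have "t / L \<le> mdist X b (\<beta> t) + A" using d(2) [of 0 t] *(5) that by simp
    then show ?thesis using *(1) by (simp add: field_simps)
  qed
qed

lemma geodesic_rayD:
  assumes "geodesic_ray X b \<alpha>"
  shows "\<alpha> 0 = b" "b \<in> mspace X" "0 \<le> s \<Longrightarrow> \<alpha> s \<in> mspace X"
    "0 \<le> s \<Longrightarrow> 0 \<le> t \<Longrightarrow> mdist X (\<alpha> s) (\<alpha> t) = \<bar>s - t\<bar>"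
    "0 \<le> s \<Longrightarrow> mdist X b (\<alpha> s) = s"
    "ray_image \<alpha> \<subseteq> mspace X" "b \<in> ray_image \<alpha>"
proof -
  have q: "quasi_geodesic X 1 0 {0..} \<alpha>" and 0: "\<alpha> 0 = b"
    using assms by (auto simp: geodesic_ray_def)
  show "\<alpha> 0 = b" by fact
  show m: "\<alpha> s \<in> mspace X" if "0 \<le> s" for s using quasi_geodesicD(3) [OF q, of s s] that by simp
  then show "b \<in> mspace X" "ray_image \<alpha> \<subseteq> mspace X" "b \<in> ray_image \<alpha>"
    using 0 by (force simp: ray_image_def)+
  show d: "mdist X (\<alpha> s) (\<alpha> t) = \<bar>s - t\<bar>" if "0 \<le> s" "0 \<le> t" for s t
    using quasi_geodesicD(1,2) [OF q, of s t] that by simp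
  show "mdist X b (\<alpha> s) = s" if "0 \<le> s" using d [of 0 s] 0 that by simp
qed

lemma geodesic_ray_quasi_ray:
  assumes "geodesic_ray X b \<alpha>" "1 \<le> L" "0 \<le> A"
  shows "quasi_ray X b L A \<alpha>"
proof -
  have "quasi_geodesic X 1 0 {0..} \<alpha>" using assms by (simp add: geodesic_ray_def)
  then have "quasi_geodesic X L A {0..} \<alpha>" using quasi_geodesic_mono assms by fastforce
  moreover have "continuous_path X {0..} \<alpha>"
    using geodesic_rayD [OF assms(1)] by (intro continuous_path_lipschitz) (auto simp: ray_image_def)
  ultimately show ?thesis using assms geodesic_rayD(1) by (auto simp: quasi_ray_def)
qed

lemma continuous_on_mset_dist_path:
  assumes "continuous_path X I c" "Z \<noteq> {}" "Z \<subseteq> mspace X"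
  shows "continuous_on I (\<lambda>t. mset_dist X {c t} Z)"
  using assms(1) by (rule continuous_on_lipschitz_path) (rule mset_dist_lipschitz [OF assms(2,3)])

lemma continuous_on_mdist_path:
  assumes "continuous_path X I c" "x \<in> mspace X"
  shows "continuous_on I (\<lambda>t. mdist X x (c t))"
proof (rule continuous_on_lipschitz_path [OF assms(1)])
  fix y z assume "y \<in> mspace X" "z \<in> mspace X"
  then show "\<bar>mdist X x y - mdist X x z\<bar> \<le> mdist X y z"
    using mdist_triangle [OF assms(2), of y z] mdist_triangle [OF assms(2), of z y]
      mdist_commute [of X y z] by simp
qed

text \<open>The property of the constant k(\<rho>, L, A) on which the estimates rest. It is stated
  for an arbitrary \<open>k\<close> and \<rho> because contraction functions of single rays occur
  before \<open>rho_class\<close> is known to be finite.\<close>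

definition clearing :: "(real \<Rightarrow> real) \<Rightarrow> real \<Rightarrow> real \<Rightarrow> real \<Rightarrow> bool" where
  "clearing \<rho> L A k \<longleftrightarrow> 0 < k \<and> 3 * A \<le> k \<and> (\<forall>r\<ge>k. 3 * L\<^sup>2 * \<rho> r \<le> r)"

text \<open>If \<open>\<beta> t\<close> is outside the \<open>k\<close>-neighbourhood, go back to
  the last time at distance \<open>k\<close>, which exists because the ray starts in
  \<open>Z\<close>, and forward until the distance is at most \<open>C\<close>, which happens by
  time \<open>T\<close>. In between the ray stays outside, so \<open>time_outside\<close> bounds the
  duration.\<close>

lemma excursion:
  assumes Z: "contracting_for X \<rho> Z" "Z \<subseteq> mspace X" "b \<in> Z"
    and k: "clearing \<rho> L A k" and \<beta>: "quasi_ray X b L A \<beta>"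
    and t: "0 \<le> t" "t \<le> T" and C: "mset_dist X {\<beta> T} Z \<le> C" "k \<le> C"
  obtains t1 t2 where "0 \<le> t1" "t1 \<le> t" "t \<le> t2" "t2 \<le> T" "mset_dist X {\<beta> t1} Z \<le> k"
    "mset_dist X {\<beta> t2} Z \<le> C" "t2 - t1 \<le> 4 * L * (k + C + A)"
proof -
  let ?f = "\<lambda>t. mset_dist X {\<beta> t} Z"
  note q = quasi_rayD [OF \<beta>] and k' = k [unfolded clearing_def]
  have cont: "continuous_on I ?f" if "I \<subseteq> {0..}" for I
    using continuous_on_subset [OF continuous_on_mset_dist_path [OF q(4)] that] Z by blast
  have pos: "0 \<le> 4 * L * (k + C + A)" using q k' C by auto
  show ?thesis
  proof (cases "?f t \<le> k")
    case True
    then show ?thesis using that [of t t] t pos C by auto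
  next
    case False
    have "?f 0 \<le> 0" using mset_dist_le [of b "{b}" b Z X] Z(3) q(5,6) by simp
    then obtain t1 where t1: "t1 \<in> {0..t}" "?f t1 = k" "\<And>u. u \<in> {t1..t} \<Longrightarrow> k \<le> ?f u"
      using last_time [of 0 t ?f k] cont [of "{0..t}"] t(1) False k' by auto
    have "\<exists>t2\<in>{t..T}. ?f t2 \<le> C \<and> (\<forall>u\<in>{t..t2}. k \<le> ?f u)"
    proof (cases "?f t \<le> C")
      case True
      then show ?thesis using t False by (intro bexI [of _ t]) auto
    next
      case F: False
      then obtain t2 where "t2 \<in> {t..T}" "?f t2 = C" "\<And>u. u \<in> {t..t2} \<Longrightarrow> C \<le> ?f u"
        using first_time [of t T ?f C] cont [of "{t..T}"] t C(1) by auto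
      then show ?thesis using C(2) by (intro bexI [of _ t2]) force+
    qed
    then obtain t2 where t2: "t2 \<in> {t..T}" "?f t2 \<le> C" "\<And>u. u \<in> {t..t2} \<Longrightarrow> k \<le> ?f u" by blast
    have out: "k \<le> ?f u" if "u \<in> {t1..t2}" for u
      using that t1(3) [of u] t2(3) [of u] by (cases "u \<le> t") auto
    have "t2 - t1 \<le> 4 * L * (?f t1 + ?f t2 + A)"
      using k' t1 t2 out by (intro time_outside [OF Z(1,2) q(1,2) _ _ _ q(3)]) auto
    also have "\<dots> \<le> 4 * L * (k + C + A)" using t1 t2 q by (intro mult_left_mono) auto
    finally show ?thesis using that t1 t2 by auto
  qed
qed

text \<open>An excursion of duration at most \<open>4 * L * (k + C + A)\<close> covers at most
  \<open>L\<close> times this plus \<open>A\<close>; \<open>k\<close> and \<open>C\<close> bound the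
  distances at its two ends.\<close>

definition travel_bound :: "real \<Rightarrow> real \<Rightarrow> real \<Rightarrow> real \<Rightarrow> real" where
  "travel_bound k L A C = k + C + A + 4 * L\<^sup>2 * (k + C + A)"

lemma fellow_travel_dist:
  assumes Z: "contracting_for X \<rho> Z" "Z \<subseteq> mspace X" "b \<in> Z"
    and k: "clearing \<rho> L A k" and \<beta>: "quasi_ray X b L A \<beta>"
    and t: "0 \<le> t" "t \<le> T" and C: "mset_dist X {\<beta> T} Z \<le> C" "k \<le> C"
  shows "mset_dist X {\<beta> t} Z \<le> travel_bound k L A C"
proof -
  note q = quasi_rayD [OF \<beta>]
  obtain t1 t2 where e: "0 \<le> t1" "t1 \<le> t" "t \<le> t2" "mset_dist X {\<beta> t1} Z \<le> k"
      "t2 - t1 \<le> 4 * L * (k + C + A)"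
    using excursion [OF assms] by metis
  have "mset_dist X {\<beta> t} Z \<le> mdist X (\<beta> t) (\<beta> t1) + mset_dist X {\<beta> t1} Z"
    by (rule mset_dist_point_triangle) (use Z q e t in auto)
  also have "\<dots> \<le> (L * (t2 - t1) + A) + k"
  proof -
    have "mdist X (\<beta> t) (\<beta> t1) \<le> L * (t - t1) + A" using q(8) [of t t1] e t by simp
    moreover have "L * (t - t1) \<le> L * (t2 - t1)" using q(1) e by (intro mult_left_mono) auto
    ultimately show ?thesis using e by linarith
  qed
  also have "L * (t2 - t1) \<le> L * (4 * L * (k + C + A))" using q(1) e by (intro mult_left_mono) auto
  finally show ?thesis using C k by (simp add: travel_bound_def power2_eq_square clearing_def)
qed

text \<open>Closeness \<open>C\<close>, however large, is traded for closeness \<open>k\<close> at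
  the cost of at most \<open>travel_bound k L A C\<close> in depth along \<open>\<alpha>\<close>:
  the excursion that contains \<open>T\<close> starts within \<open>k\<close>, and its displacement
  is bounded.\<close>

lemma fellow_travel_reach:
  assumes \<alpha>: "geodesic_ray X b \<alpha>" "contracting_for X \<rho> (ray_image \<alpha>)"
    and k: "clearing \<rho> L A k" and \<beta>: "quasi_ray X b L A \<beta>"
    and T: "0 \<le> T" "0 \<le> s" "mdist X (\<beta> T) (\<alpha> s) \<le> C" "k \<le> C"
  obtains t v where "0 \<le> t" "t \<le> T" "0 \<le> v" "mdist X (\<beta> t) (\<alpha> v) \<le> k" "s - travel_bound k L A C \<le> v"
proof -
  note q = quasi_rayD [OF \<beta>] and g = geodesic_rayD [OF \<alpha>(1)]
  have "mset_dist X {\<beta> T} (ray_image \<alpha>) \<le> C"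
    using mset_dist_le [of "\<beta> T" "{\<beta> T}" "\<alpha> s" "ray_image \<alpha>" X] T by (auto simp: ray_image_def)
  then obtain t1 t2 where e: "0 \<le> t1" "t1 \<le> T" "T \<le> t2" "t2 \<le> T" "mset_dist X {\<beta> t1} (ray_image \<alpha>) \<le> k"
      "t2 - t1 \<le> 4 * L * (k + C + A)"
    using excursion [OF \<alpha>(2) g(6,7) k \<beta> T(1) order_refl _ T(4)] by metis
  obtain z where z: "z \<in> closest_proj X (ray_image \<alpha>) (\<beta> t1)"
    using contracting_for_proj [OF \<alpha>(2) q(7) [OF e(1)]] .
  then obtain v where v: "0 \<le> v" "z = \<alpha> v" by (auto simp: closest_proj_def ray_image_def)
  have d: "mdist X (\<beta> t1) (\<alpha> v) \<le> k" using closest_projD(2) [OF z] e v by simp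
  note m = q(7) [OF e(1)] q(7) [OF T(1)] g(3) [OF v(1)] g(3) [OF T(2)]
  have "\<bar>v - s\<bar> \<le> mdist X (\<alpha> v) (\<beta> t1) + mdist X (\<beta> t1) (\<beta> T) + mdist X (\<beta> T) (\<alpha> s)"
    using g(4) [OF v(1) T(2)] mdist_triangle [OF m(3,1,4)] mdist_triangle [OF m(1,2,4)] by simp
  also have "\<dots> \<le> k + (L * (T - t1) + A) + C"
    using d T mdist_commute [of X "\<beta> t1" "\<alpha> v"] q(8) [OF e(1) T(1)] e by simp
  also have "L * (T - t1) \<le> L * (4 * L * (k + C + A))" using q(1) e by (intro mult_left_mono) auto
  finally have "s - travel_bound k L A C \<le> v" by (simp add: travel_bound_def power2_eq_square)
  then show ?thesis using that e v d by blast
qed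

text \<open>The radius \<open>v\<close> of a closest point \<open>\<alpha> v\<close> differs from
  \<open>R\<close> by at most its distance to \<open>\<beta> t\<close>, hence the factor 2. Working
  at a fixed radius allows one point to be tested against two geodesic rays at once.\<close>

lemma fellow_travel_sphere:
  assumes \<alpha>: "geodesic_ray X b \<alpha>" "contracting_for X \<rho> (ray_image \<alpha>)"
    and k: "clearing \<rho> L A k" and \<beta>: "quasi_ray X b L A \<beta>"
    and T: "0 \<le> T" "0 \<le> s" "mdist X (\<beta> T) (\<alpha> s) \<le> C" "k \<le> C" and R: "0 \<le> R" "R \<le> s - C"
    and t: "0 \<le> t" "t \<le> T" "mdist X b (\<beta> t) = R"
  shows "mdist X (\<beta> t) (\<alpha> R) \<le> 2 * travel_bound k L A C"
proof -
  note q = quasi_rayD [OF \<beta>] and g = geodesic_rayD [OF \<alpha>(1)]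
  have "mset_dist X {\<beta> T} (ray_image \<alpha>) \<le> C"
    using mset_dist_le [of "\<beta> T" "{\<beta> T}" "\<alpha> s" "ray_image \<alpha>" X] T by (auto simp: ray_image_def)
  then have le: "mset_dist X {\<beta> t} (ray_image \<alpha>) \<le> travel_bound k L A C"
    using fellow_travel_dist [OF \<alpha>(2) g(6,7) k \<beta> t(1,2) _ T(4)] by simp
  obtain z where z: "z \<in> closest_proj X (ray_image \<alpha>) (\<beta> t)"
    using contracting_for_proj [OF \<alpha>(2) q(7) [OF t(1)]] .
  then obtain v where v: "0 \<le> v" "z = \<alpha> v" by (auto simp: closest_proj_def ray_image_def)
  have d: "mdist X (\<beta> t) (\<alpha> v) \<le> travel_bound k L A C" using closest_projD(2) [OF z] le v by simp
  note m = g(2) q(7) [OF t(1)] g(3) [OF v(1)] g(3) [OF R(1)]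
  have "\<bar>R - v\<bar> \<le> mdist X (\<beta> t) (\<alpha> v)"
    using mdist_triangle [OF m(1,2,3)] mdist_triangle [OF m(1,3,2)] t(3) g(5) [OF v(1)]
      mdist_commute [of X "\<beta> t" "\<alpha> v"] by simp
  then show ?thesis
    using mdist_triangle [OF m(2-4)] g(4) [OF v(1) R(1)] d by simp
qed

lemma quasi_ray_sphere:
  assumes \<beta>: "quasi_ray X b L A \<beta>" and T: "0 \<le> T" "0 \<le> R" "R \<le> mdist X b (\<beta> T)"
  obtains t where "0 \<le> t" "t \<le> T" "mdist X b (\<beta> t) = R" "t \<le> L * (R + A)"
proof -
  note q = quasi_rayD [OF \<beta>]
  have "continuous_on {0..T} (\<lambda>t. mdist X b (\<beta> t))"
    using continuous_on_subset [OF continuous_on_mdist_path [OF q(4,6)]] by auto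
  moreover have "mdist X b (\<beta> 0) = 0" using q(5,6) by simp
  ultimately obtain t where t: "0 \<le> t" "t \<le> T" "mdist X b (\<beta> t) = R"
    using IVT' [of "\<lambda>t. mdist X b (\<beta> t)" 0 R T] T by auto
  show ?thesis using that [OF t] q(11) [OF t(1)] t(3) by simp
qed

section \<open>Concatenation\<close>

definition path_join :: "real \<Rightarrow> 'p path \<Rightarrow> 'p path \<Rightarrow> 'p path" where
  "path_join p c c' = (\<lambda>t. if t \<le> p then c t else c' (t - p))"

lemma continuous_path_join:
  assumes "continuous_path X {0..p} c" "continuous_path X {0..} c'" "c p = c' 0" "0 \<le> p"
  shows "continuous_path X {0..} (path_join p c c')"
  unfolding continuous_path_def path_join_def
proof (rule continuous_map_cases_le)
  show "continuous_map (subtopology (top_of_set {0..}) {x \<in> topspace (top_of_set {0..}). x \<le> p})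
      (mtopology_of X) c"
  proof -
    have "{x \<in> topspace (top_of_set {0..}). x \<le> p} = {0..p}" "{0..} \<inter> {0..p} = {0..p}" by auto
    then show ?thesis using assms(1) by (simp add: continuous_path_def subtopology_subtopology)
  qed
  have "continuous_map (top_of_set {p..}) (top_of_set {0..}) (\<lambda>t. t - p)"
    by (auto simp: intro!: continuous_intros)
  then have "continuous_map (top_of_set {p..}) (mtopology_of X) (c' \<circ> (\<lambda>t. t - p))"
    using assms(2) unfolding continuous_path_def by (rule continuous_map_compose)
  moreover have "subtopology (top_of_set {0..}) {x \<in> topspace (top_of_set {0..}). p \<le> x} = top_of_set {p..}"
  proof -
    have "{x \<in> topspace (top_of_set {0..}). p \<le> x} = {p..}" "{0..} \<inter> {p..} = {p..}" using assms(4) by auto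
    then show ?thesis by (simp add: subtopology_subtopology)
  qed
  ultimately show "continuous_map (subtopology (top_of_set {0..}) {x \<in> topspace (top_of_set {0..}). p \<le> x})
      (mtopology_of X) (\<lambda>x. c' (x - p))"
    by (simp add: o_def)
qed (use assms(3) in auto)

text \<open>The additive constant doubles because the upper bounds of both pieces add up at the
  junction. The lower bound across it has no general reason and is supplied as
  \<open>cross\<close>.\<close>

lemma quasi_geodesic_join:
  assumes c: "quasi_geodesic X L A {0..p} c" and c': "quasi_geodesic X L A {0..} c'"
    and p: "c p = c' 0" "0 \<le> p" "1 \<le> L" "0 \<le> A"
    and cross: "\<And>u v. 0 \<le> u \<Longrightarrow> u \<le> p \<Longrightarrow> 0 \<le> v \<Longrightarrow> (p - u + v) / L - A \<le> mdist X (c u) (c' v)"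
  shows "quasi_geodesic X L (2 * A) {0..} (path_join p c c')"
proof -
  let ?j = "path_join p c c'"
  have m: "?j t \<in> mspace X" if "0 \<le> t" for t
    using quasi_geodesicD(3) [OF c, of t t] quasi_geodesicD(3) [OF c', of "t - p" "t - p"] that
    by (auto simp: path_join_def)
  have *: "(t - s) / L - 2 * A \<le> mdist X (?j s) (?j t) \<and> mdist X (?j s) (?j t) \<le> L * (t - s) + 2 * A"
    if st: "0 \<le> s" "s \<le> t" for s t
  proof -
    consider "t \<le> p" | "s \<le> p" "p < t" | "p < s" by linarith
    then show ?thesis
    proof cases
      case 1
      then show ?thesis using quasi_geodesicD(1,2) [OF c, of s t] st p by (simp add: path_join_def)
    next
      case 2
      have "mdist X (c s) (c' (t - p)) \<le> mdist X (c s) (c p) + mdist X (c' 0) (c' (t - p))"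
        using mdist_triangle [of "c s" X "c p" "c' (t - p)"] m [of s] m [of t] m [of p] st p 2
        by (simp add: path_join_def)
      also have "\<dots> \<le> (L * (p - s) + A) + (L * (t - p) + A)"
        using quasi_geodesicD(1) [OF c, of s p] quasi_geodesicD(1) [OF c', of 0 "t - p"] st 2 by simp
      finally show ?thesis using cross [of s "t - p"] 2 st p by (simp add: path_join_def algebra_simps)
    next
      case 3
      then show ?thesis using quasi_geodesicD(1,2) [OF c', of "s - p" "t - p"] st p
        by (simp add: path_join_def)
    qed
  qed
  have "1 / L * \<bar>s - t\<bar> - 2 * A \<le> mdist X (?j s) (?j t) \<and> mdist X (?j s) (?j t) \<le> L * \<bar>s - t\<bar> + 2 * A"
    if "0 \<le> s" "0 \<le> t" for s t
    using *[of s t] *[of t s] that mdist_commute [of X "?j s" "?j t"]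
    by (cases "s \<le> t") (auto simp: abs_if)
  then show ?thesis using m unfolding quasi_geodesic_def by (auto simp: is_interval_ci)
qed

lemma ray_image_join:
  "0 \<le> p \<Longrightarrow> c p = c' 0 \<Longrightarrow> ray_image (path_join p c c') = c ` {0..p} \<union> ray_image c'"
proof -
  assume p: "0 \<le> p" "c p = c' 0"
  show ?thesis
  proof
    show "ray_image (path_join p c c') \<subseteq> c ` {0..p} \<union> ray_image c'"
      by (auto simp: ray_image_def path_join_def)
    have "c t \<in> ray_image (path_join p c c')" if "0 \<le> t" "t \<le> p" for t
      using that by (auto simp: ray_image_def path_join_def intro!: image_eqI [of _ _ t])
    moreover have "c' t \<in> ray_image (path_join p c c')" if "0 \<le> t" for t
      using that p by (auto simp: ray_image_def path_join_def intro!: image_eqI [of _ _ "t + p"])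
    ultimately show "c ` {0..p} \<union> ray_image c' \<subseteq> ray_image (path_join p c c')"
      by (auto simp: ray_image_def)
  qed
qed

section \<open>Invariance of the contracting property\<close>

text \<open>The shape of contraction function that \<open>contracting_for_hausdorff\<close> returns.
  The quotient splits into \<open>\<rho> (2 * r + c) / (2 * r + c)\<close>, which tends to 0, and
  \<open>(2 * r + c) / r\<close>, which tends to 2.\<close>

lemma sublinear_affine:
  assumes \<rho>: "sublinear \<rho>" and ab: "0 \<le> a" "0 \<le> c" "0 \<le> e"
  shows "sublinear (\<lambda>r. a * \<rho> (2 * r + c) + e)"
  unfolding sublinear_def
proof (intro conjI)
  have mono: "mono_on {0..} \<rho>" and ev: "\<forall>\<^sub>F r in at_top. 0 \<le> \<rho> r" and lim: "((\<lambda>r. \<rho> r / r) \<longlongrightarrow> 0) at_top"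
    using \<rho> by (auto simp: sublinear_def)
  have top: "filterlim (\<lambda>r :: real. 2 * r + c) at_top at_top" by real_asymp
  show "mono_on {0..} (\<lambda>r. a * \<rho> (2 * r + c) + e)"
    using ab by (auto intro!: mono_onI mult_left_mono mono_onD [OF mono])
  have "\<forall>\<^sub>F r in at_top. 0 \<le> \<rho> (2 * r + c)" using top ev by (rule filterlim_iff [THEN iffD1, rule_format])
  then show "\<forall>\<^sub>F r in at_top. 0 \<le> a * \<rho> (2 * r + c) + e" by eventually_elim (use ab in auto)
  have 1: "((\<lambda>r. \<rho> (2 * r + c) / (2 * r + c)) \<longlongrightarrow> 0) at_top" by (rule filterlim_compose [OF lim top])
  have cancel: "a * (x / (2 * r + c) * ((2 * r + c) / r)) + e / r = (a * x + e) / r" if "0 < r" for x r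
  proof -
    have "2 * r + c \<noteq> 0" using that ab by linarith
    then have "x / (2 * r + c) * ((2 * r + c) / r) = x / r" by simp
    then show ?thesis by (simp only: add_divide_distrib times_divide_eq_right)
  qed
  have 2: "((\<lambda>r. (2 * r + c) / r) \<longlongrightarrow> 2) at_top" by real_asymp
  have 3: "((\<lambda>r. e / r) \<longlongrightarrow> 0) at_top" by real_asymp
  have "((\<lambda>r. a * (\<rho> (2 * r + c) / (2 * r + c) * ((2 * r + c) / r)) + e / r) \<longlongrightarrow> a * (0 * 2) + 0) at_top"
    by (intro tendsto_intros 1 2 3)
  moreover have "\<forall>\<^sub>F r in at_top. a * (\<rho> (2 * r + c) / (2 * r + c) * ((2 * r + c) / r)) + e / r
      = (a * \<rho> (2 * r + c) + e) / r"
    using eventually_gt_at_top [of 0] by eventually_elim (rule cancel)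
  ultimately show "((\<lambda>r. (a * \<rho> (2 * r + c) + e) / r) \<longlongrightarrow> 0) at_top"
    by (simp add: tendsto_cong)
qed

text \<open>
  Every pair of points is joined by a \<open>1\<close>-Lipschitz path whose length exceeds the distance by at
  most \<open>1\<close>. This replaces geodesicity throughout, so that the infimum in the distance of the
  Cayley graph never has to be attained.
\<close>

locale coarse_geodesic =
  fixes X :: "'p metric"
  assumes coarse_geodesic: "x \<in> mspace X \<Longrightarrow> y \<in> mspace X \<Longrightarrow>
    \<exists>c l. 0 \<le> l \<and> l \<le> mdist X x y + 1 \<and> c 0 = x \<and> c l = y \<and> c ` {0..l} \<subseteq> mspace X \<and>
      (\<forall>s\<in>{0..l}. \<forall>t\<in>{0..l}. mdist X (c s) (c t) \<le> \<bar>s - t\<bar>)"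
begin

lemma coarse_between:
  assumes "x \<in> mspace X" "y \<in> mspace X" "0 \<le> r"
  obtains z where "z \<in> mspace X" "mdist X x z \<le> r" "mdist X z y \<le> max 0 (mdist X x y + 1 - r)"
proof -
  obtain c l where c: "0 \<le> l" "l \<le> mdist X x y + 1" "c 0 = x" "c l = y" "c ` {0..l} \<subseteq> mspace X"
    "\<And>s t. s \<in> {0..l} \<Longrightarrow> t \<in> {0..l} \<Longrightarrow> mdist X (c s) (c t) \<le> \<bar>s - t\<bar>"
    using coarse_geodesic [OF assms(1,2)] by metis
  define w where "w = min l r"
  have w: "0 \<le> w" "w \<le> l" "w \<le> r" "l - w \<le> max 0 (mdist X x y + 1 - r)"
    using c(1,2) assms(3) by (auto simp: w_def)
  have "c w \<in> mspace X" using c(5) w by auto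
  moreover have "mdist X x (c w) \<le> r" "mdist X (c w) y \<le> max 0 (mdist X x y + 1 - r)"
    using c(6) [of 0 w] c(6) [of w l] w c(1,3,4) by auto
  ultimately show ?thesis using that by blast
qed

context
  fixes \<rho> Z
  assumes Z: "contracting_for X \<rho> Z" "Z \<subseteq> mspace X"
begin

text \<open>Walk from \<open>x\<close> towards \<open>z\<close> for the distance
  \<open>mset_dist X {x} Z\<close>. The point reached is still in the range of contraction at
  \<open>x\<close>, so its projection is near \<open>p\<close>; it is also within
  \<open>e + 1\<close> of \<open>z\<close>, so its projection is near \<open>z\<close>.\<close>

lemma almost_closest:
  assumes x: "x \<in> mspace X" and z: "z \<in> Z" "mdist X x z \<le> mset_dist X {x} Z + e" "0 \<le> e"
    and p: "p \<in> closest_proj X Z x"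
  shows "mdist X p z \<le> \<rho> (mset_dist X {x} Z) + 2 * (e + 1)"
proof -
  have zM: "z \<in> mspace X" "p \<in> mspace X" using z Z p by (auto simp: closest_proj_def)
  have D: "0 \<le> mset_dist X {x} Z" using z by (intro mset_dist_nonneg) auto
  obtain y where y: "y \<in> mspace X" "mdist X x y \<le> mset_dist X {x} Z"
      "mdist X y z \<le> max 0 (mdist X x z + 1 - mset_dist X {x} Z)"
    using coarse_between [OF x zM(1) D] by metis
  have yz: "mdist X y z \<le> e + 1" using y(3) z by auto
  obtain q where q: "q \<in> closest_proj X Z y" using contracting_for_proj [OF Z(1) y(1)] .
  have qM: "q \<in> mspace X" using q Z by (auto simp: closest_proj_def)
  have "mdist X p q \<le> \<rho> (mset_dist X {x} Z)"
    using contracting_forD [OF Z x y(1,2)] p q by blast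
  moreover have "mdist X y q \<le> mdist X y z"
    using closest_projD(2) [OF q] mset_dist_le [of y "{y}" z Z X] z by simp
  ultimately show ?thesis
    using mdist_triangle [OF zM(2) qM zM(1)] mdist_triangle [OF qM y(1) zM(1)] yz
      mdist_commute [of X q y] by argo
qed

text \<open>A point \<open>z\<close> on a path from \<open>x\<close> to \<open>y\<close> is in the
  contraction range of \<open>x\<close> and within \<open>e + 1\<close> of \<open>y\<close>. If
  \<open>y\<close> is at least that far from \<open>Z\<close>, contraction centred at
  \<open>y\<close> compares the two; otherwise both are so close to \<open>Z\<close> that the
  triangle inequality suffices.\<close>

lemma projection_coarse_contraction:
  assumes x: "x \<in> mspace X" "y \<in> mspace X" "mdist X x y \<le> mset_dist X {x} Z + e" "0 \<le> e"
    and pq: "p \<in> closest_proj X Z x" "q \<in> closest_proj X Z y"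
  shows "mdist X p q \<le> \<rho> (mset_dist X {x} Z) + \<rho> (mset_dist X {y} Z) + 4 * (e + 1)"
proof -
  let ?D = "\<lambda>x. mset_dist X {x} Z"
  have M: "p \<in> mspace X" "q \<in> mspace X" and ne: "Z \<noteq> {}" using Z pq by (auto simp: closest_proj_def)
  have D: "0 \<le> ?D x" using ne by (intro mset_dist_nonneg) auto
  obtain z where z: "z \<in> mspace X" "mdist X x z \<le> ?D x" "mdist X z y \<le> max 0 (mdist X x y + 1 - ?D x)"
    using coarse_between [OF x(1,2) D] by metis
  have zy: "mdist X y z \<le> e + 1" using z(3) x mdist_commute [of X z y] by auto
  obtain r where r: "r \<in> closest_proj X Z z" using contracting_for_proj [OF Z(1) z(1)] .
  have rM: "r \<in> mspace X" using r Z by (auto simp: closest_proj_def)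
  have pr: "mdist X p r \<le> \<rho> (?D x)" using contracting_forD [OF Z x(1) z(1,2)] pq(1) r by blast
  have nn: "0 \<le> \<rho> (?D y)" by (rule contracting_for_nonneg [OF Z x(2)])
  have "mdist X r q \<le> \<rho> (?D y) + 4 * (e + 1)"
  proof (cases "e + 1 \<le> ?D y")
    case True
    then have "mdist X r q \<le> \<rho> (?D y)" using contracting_forD [OF Z x(2) z(1)] zy pq(2) r by auto
    then show ?thesis using x(4) by argo
  next
    case False
    have "?D z \<le> mdist X z y + ?D y" by (rule mset_dist_point_triangle [OF ne Z(2) z(1) x(2)])
    then show ?thesis
      using False nn zy closest_projD(2) [OF r] closest_projD(2) [OF pq(2)]
        mdist_triangle [OF rM z(1) M(2)] mdist_triangle [OF z(1) x(2) M(2)]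
        mdist_commute [of X z y] mdist_commute [of X r z] by argo
  qed
  then show ?thesis using pr mdist_triangle [OF M(1) rM M(2)] by argo
qed

text \<open>A closest point in \<open>Z'\<close> is within \<open>C\<close> of a point of
  \<open>Z\<close> that is closest up to \<open>2 * C\<close>, so \<open>almost_closest\<close>
  places it near the projection to \<open>Z\<close>. The total is \<open>\<rho> + 5 * C + 2\<close>
  for each of the two ends, plus \<open>2 * \<rho> + 4 * (C + 1)\<close> between the projections to
  \<open>Z\<close>.\<close>

lemma contracting_for_hausdorff:
  assumes mono: "mono_on {0..} \<rho>" and Z': "Z' \<subseteq> mspace X" "\<And>x. x \<in> mspace X \<Longrightarrow> closest_proj X Z' x \<noteq> {}"
    and C: "\<And>z. z \<in> Z \<Longrightarrow> \<exists>z'\<in>Z'. mdist X z z' \<le> C" "\<And>z'. z' \<in> Z' \<Longrightarrow> \<exists>z\<in>Z. mdist X z z' \<le> C" "0 \<le> C"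
  shows "contracting_for X (\<lambda>r. 4 * \<rho> (2 * r + C) + (14 * C + 8)) Z'"
proof (rule contracting_forI [OF Z'])
  let ?D = "\<lambda>x. mset_dist X {x} Z" and ?D' = "\<lambda>x. mset_dist X {x} Z'"
  fix x y p q
  assume x: "x \<in> mspace X" and y: "y \<in> mspace X" and xy: "mdist X x y \<le> ?D' x"
    and p: "p \<in> closest_proj X Z' x \<union> closest_proj X Z' y"
    and q: "q \<in> closest_proj X Z' x \<union> closest_proj X Z' y"
  obtain p1 where p1: "p1 \<in> closest_proj X Z x" using contracting_for_proj [OF Z(1) x] .
  obtain q1 where q1: "q1 \<in> closest_proj X Z y" using contracting_for_proj [OF Z(1) y] .
  have M1: "p1 \<in> mspace X" "q1 \<in> mspace X" using p1 q1 Z by (auto simp: closest_proj_def)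
  have ne: "Z \<noteq> {}" "Z' \<noteq> {}" using p1 p by (auto simp: closest_proj_def)
  have DD': "?D u \<le> ?D' u + C" "?D' u \<le> ?D u + C" if u: "u \<in> mspace X" for u
  proof -
    have "?D u - C \<le> ?D' u"
    proof (rule mset_dist_greatest)
      fix v z' assume v: "v \<in> {u}" and z': "z' \<in> Z'"
      obtain z where z: "z \<in> Z" "mdist X z z' \<le> C" using C(2) [OF z'] by blast
      then show "?D u - C \<le> mdist X v z'"
        using v mset_dist_le [of u "{u}" z Z X] mdist_triangle [of u X z' z] u z' Z Z'
          mdist_commute [of X z z'] by fastforce
    qed (use ne in auto)
    moreover have "?D' u - C \<le> ?D u"
    proof (rule mset_dist_greatest)
      fix v z assume v: "v \<in> {u}" and z: "z \<in> Z"
      obtain z' where z': "z' \<in> Z'" "mdist X z z' \<le> C" using C(1) [OF z] by blast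
      then show "?D' u - C \<le> mdist X v z"
        using v mset_dist_le [of u "{u}" z' Z' X] mdist_triangle [of u X z z'] u z Z Z' by fastforce
    qed (use ne in auto)
    ultimately show "?D u \<le> ?D' u + C" "?D' u \<le> ?D u + C" by linarith+
  qed
  let ?r = "?D' x"
  have r: "0 \<le> ?r" using ne by (intro mset_dist_nonneg) auto
  \<comment> \<open>As \<open>y\<close> is within \<open>?r\<close> of \<open>x\<close>, its
    distance to \<open>Z\<close> is at most \<open>?r + (?r + C)\<close>; hence the argument of
    \<open>\<rho>\<close>.\<close>
  have Dle: "?D u \<le> 2 * ?r + C" if "u \<in> {x, y}" for u
  proof -
    have "?D y \<le> mdist X y x + ?D x" by (rule mset_dist_point_triangle [OF ne(1) Z(2) y x])
    then show ?thesis using that DD' [OF x] xy r mdist_commute [of X x y] by auto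
  qed
  have \<rho>le: "\<rho> (?D u) \<le> \<rho> (2 * ?r + C)" if "u \<in> {x, y}" for u
    using Dle [OF that] ne r C(3) by (intro mono_onD [OF mono]) (auto intro: mset_dist_nonneg)
  have pos: "0 \<le> \<rho> (2 * ?r + C)" using \<rho>le [of x] contracting_for_nonneg [OF Z x] by auto
  have near: "mdist X p' p \<le> \<rho> (2 * ?r + C) + (5 * C + 2)"
    if "p' \<in> closest_proj X Z' u" "p \<in> closest_proj X Z u" "u \<in> {x, y}" for u p' p
  proof -
    have u: "u \<in> mspace X" using that x y by auto
    have M: "p' \<in> mspace X" "p \<in> mspace X" using that Z Z' by (auto simp: closest_proj_def)
    have "p' \<in> Z'" by (rule closest_projD(1) [OF that(1)])
    then obtain z where z: "z \<in> Z" "mdist X z p' \<le> C" using C(2) by blast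
    have zM: "z \<in> mspace X" using z Z by auto
    have "mdist X u z \<le> mdist X u p' + mdist X p' z" by (rule mdist_triangle [OF u M(1) zM])
    then have "mdist X u z \<le> ?D u + 2 * C"
      using z DD' [OF u] closest_projD(2) [OF that(1)] mdist_commute [of X p' z] by linarith
    then have "mdist X p z \<le> \<rho> (?D u) + 2 * (2 * C + 1)"
      using almost_closest [OF u z(1) _ _ that(2), of "2 * C"] C(3) by simp
    then show ?thesis
      using mdist_triangle [OF M(1) zM M(2)] z(2) \<rho>le [OF that(3)]
        mdist_commute [of X z p'] mdist_commute [of X p z] by argo
  qed
  have "mdist X p1 q1 \<le> \<rho> (?D x) + \<rho> (?D y) + 4 * (C + 1)"
    by (rule projection_coarse_contraction [OF x y _ C(3) p1 q1]) (use xy DD' [OF x] in linarith)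
  then have p1q1: "mdist X p1 q1 \<le> 2 * \<rho> (2 * ?r + C) + 4 * (C + 1)" using \<rho>le [of x] \<rho>le [of y] by simp
  have M: "p \<in> mspace X" "q \<in> mspace X" using p q Z' by (auto simp: closest_proj_def)
  have via: "mdist X p q \<le> mdist X p a + mdist X a c + mdist X q c"
    if "a \<in> mspace X" "c \<in> mspace X" for a c
    using mdist_triangle [OF M(1) that(1) M(2)] mdist_triangle [OF that M(2)] mdist_commute [of X q c]
    by linarith
  have "\<exists>a\<in>{p1, q1}. mdist X p a \<le> \<rho> (2 * ?r + C) + (5 * C + 2)" using p near p1 q1 by blast
  moreover have "\<exists>c\<in>{p1, q1}. mdist X q c \<le> \<rho> (2 * ?r + C) + (5 * C + 2)" using q near p1 q1 by blast
  ultimately obtain a c where ac: "a \<in> {p1, q1}" "c \<in> {p1, q1}"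
      "mdist X p a \<le> \<rho> (2 * ?r + C) + (5 * C + 2)" "mdist X q c \<le> \<rho> (2 * ?r + C) + (5 * C + 2)"
    by blast
  have "mdist X a c \<le> 2 * \<rho> (2 * ?r + C) + 4 * (C + 1)"
    using ac(1,2) p1q1 M1 mdist_commute [of X p1 q1] pos C(3) by (auto simp del: mdist_zero)
  then show "mdist X p q \<le> 4 * \<rho> (2 * ?r + C) + (14 * C + 8)"
    using via [of a c] ac M1 by fastforce
qed

end

end

lemma quasi_ray_closest_proj:
  assumes \<beta>: "quasi_ray X b L A \<beta>" and x: "x \<in> mspace X"
  shows "closest_proj X (ray_image \<beta>) x \<noteq> {}"
proof -
  note q = quasi_rayD [OF \<beta>]
  \<comment> \<open>After time \<open>T\<close> the ray is more than \<open>2 * mdist X b x\<close>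
    away from \<open>b\<close>, so farther from \<open>x\<close> than \<open>b\<close> is. A minimum
    over \<open>{0..T}\<close> is thus a minimum over the whole ray.\<close>
  define T where "T = L * (2 * mdist X b x + A)"
  have T: "0 \<le> T" using q by (simp add: T_def)
  have "continuous_on {0..T} (\<lambda>t. mdist X x (\<beta> t))"
    using continuous_on_subset [OF continuous_on_mdist_path [OF q(4) x]] by auto
  then obtain t where t: "t \<in> {0..T}" "\<And>u. u \<in> {0..T} \<Longrightarrow> mdist X x (\<beta> t) \<le> mdist X x (\<beta> u)"
    using continuous_attains_inf [of "{0..T}" "\<lambda>t. mdist X x (\<beta> t)"] T by auto
  have min: "mdist X x (\<beta> t) \<le> mdist X x (\<beta> u)" if u: "0 \<le> u" for u
  proof (cases "u \<le> T")
    case False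
    then have "L * (2 * mdist X b x + A) < L * (mdist X b (\<beta> u) + A)"
      using q(11) [OF u] by (simp add: T_def)
    then have "2 * mdist X b x < mdist X b (\<beta> u)" using q(1) by (simp add: mult_less_cancel_left)
    then have "mdist X b x < mdist X x (\<beta> u)"
      using mdist_triangle [OF q(6) x q(7) [OF u]] by linarith
    moreover have "mdist X x (\<beta> t) \<le> mdist X x b" using t(2) [of 0] T q(5) by simp
    ultimately show ?thesis using mdist_commute [of X x b] by linarith
  qed (use t(2) u in auto)
  have "mdist X x (\<beta> t) \<le> mset_dist X {x} (ray_image \<beta>)"
    by (rule mset_dist_greatest) (use min in \<open>auto simp: ray_image_def\<close>)
  moreover have "mset_dist X {x} (ray_image \<beta>) \<le> mdist X x (\<beta> t)"
    using t by (intro mset_dist_le) (auto simp: ray_image_def)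
  ultimately have "\<beta> t \<in> closest_proj X (ray_image \<beta>) x"
    using t by (auto simp: closest_proj_def ray_image_def)
  then show ?thesis by blast
qed

section \<open>Points of the boundary\<close>

lemma finite_hausdorff_refl: "Z \<subseteq> mspace X \<Longrightarrow> finite_hausdorff X Z Z"
  unfolding finite_hausdorff_def by (intro exI [of _ 0]) force

lemma finite_hausdorff_sym: "finite_hausdorff X Y Z \<Longrightarrow> finite_hausdorff X Z Y"
  unfolding finite_hausdorff_def by (metis mdist_commute)

lemma finite_hausdorff_trans:
  assumes "finite_hausdorff X Y Z" "finite_hausdorff X Z W"
    "Y \<subseteq> mspace X" "Z \<subseteq> mspace X" "W \<subseteq> mspace X"
  shows "finite_hausdorff X Y W"
proof -
  obtain C where C: "\<forall>y\<in>Y. \<exists>z\<in>Z. mdist X y z \<le> C" "\<forall>z\<in>Z. \<exists>y\<in>Y. mdist X y z \<le> C"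
    using assms by (auto simp: finite_hausdorff_def)
  obtain D where D: "\<forall>y\<in>Z. \<exists>z\<in>W. mdist X y z \<le> D" "\<forall>z\<in>W. \<exists>y\<in>Z. mdist X y z \<le> D"
    using assms by (auto simp: finite_hausdorff_def)
  have tri: "mdist X y w \<le> C + D" if "mdist X y z \<le> C" "mdist X z w \<le> D" "y \<in> Y" "z \<in> Z" "w \<in> W" for y z w
    using mdist_triangle [of y X z w] that assms by fastforce
  have "\<exists>w\<in>W. mdist X y w \<le> C + D" if y: "y \<in> Y" for y
  proof -
    obtain z where z: "z \<in> Z" "mdist X y z \<le> C" using C(1) y by blast
    obtain w where "w \<in> W" "mdist X z w \<le> D" using D(1) z by blast
    then show ?thesis using tri z y by blast
  qed
  moreover have "\<exists>y\<in>Y. mdist X y w \<le> C + D" if w: "w \<in> W" for w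
  proof -
    obtain z where z: "z \<in> Z" "mdist X z w \<le> D" using D(2) w by blast
    obtain y where "y \<in> Y" "mdist X y z \<le> C" using C(2) z by blast
    then show ?thesis using tri z w by blast
  qed
  ultimately show ?thesis unfolding finite_hausdorff_def by blast
qed

lemma contracting_ray_subset: "c \<in> contracting_rays X b \<Longrightarrow> ray_image c \<subseteq> mspace X"
  by (auto simp: contracting_rays_def ray_image_def quasi_geodesic_def)

lemma equiv_fellow_rays: "equiv (contracting_rays X b) (fellow_rays X b)"
proof (rule equivI)
  show "fellow_rays X b \<subseteq> contracting_rays X b \<times> contracting_rays X b" by (auto simp: fellow_rays_def)
  show "refl_on (contracting_rays X b) (fellow_rays X b)"
    using finite_hausdorff_refl [OF contracting_ray_subset, of _ X b] by (simp add: refl_on_def fellow_rays_def)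
  show "sym (fellow_rays X b)" by (auto simp: sym_def fellow_rays_def intro: finite_hausdorff_sym)
  show "trans (fellow_rays X b)"
  proof (rule transI)
    fix x y z assume "(x, y) \<in> fellow_rays X b" "(y, z) \<in> fellow_rays X b"
    then have "x \<in> contracting_rays X b" "y \<in> contracting_rays X b" "z \<in> contracting_rays X b"
      "finite_hausdorff X (ray_image x) (ray_image y)" "finite_hausdorff X (ray_image y) (ray_image z)"
      by (simp_all add: fellow_rays_def)
    then show "(x, z) \<in> fellow_rays X b"
      using finite_hausdorff_trans [of X "ray_image x" "ray_image y" "ray_image z"]
        contracting_ray_subset [of _ X b] by (simp add: fellow_rays_def)
  qed
qed

lemma boundary_point_ray:
  "\<zeta> \<in> contracting_boundary X b \<Longrightarrow> c \<in> \<zeta> \<Longrightarrow> c \<in> contracting_rays X b"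
  unfolding contracting_boundary_def using in_quotient_imp_subset [OF equiv_fellow_rays, of \<zeta> X b] by auto

lemma boundary_point_hausdorff:
  "\<zeta> \<in> contracting_boundary X b \<Longrightarrow> c \<in> \<zeta> \<Longrightarrow> c' \<in> \<zeta> \<Longrightarrow> finite_hausdorff X (ray_image c) (ray_image c')"
  unfolding contracting_boundary_def using in_quotient_imp_in_rel [OF equiv_fellow_rays, of \<zeta> X b c c']
  by (simp add: fellow_rays_def)

lemma boundary_point_closed:
  assumes "\<zeta> \<in> contracting_boundary X b" "c \<in> \<zeta>" "c' \<in> contracting_rays X b"
    "finite_hausdorff X (ray_image c) (ray_image c')"
  shows "c' \<in> \<zeta>"
proof -
  have "(c, c') \<in> fellow_rays X b" using assms boundary_point_ray by (auto simp: fellow_rays_def)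
  then show ?thesis
    using assms(1,2) in_quotient_imp_closed [OF equiv_fellow_rays, of \<zeta> X b c c']
    by (simp add: contracting_boundary_def)
qed

lemma boundary_point_eqI:
  assumes "\<zeta> \<in> contracting_boundary X b" "\<eta> \<in> contracting_boundary X b" "c \<in> \<zeta>" "c' \<in> \<eta>"
    "finite_hausdorff X (ray_image c) (ray_image c')"
  shows "\<zeta> = \<eta>"
proof -
  have "c' \<in> \<zeta>" using boundary_point_closed assms boundary_point_ray by metis
  then show ?thesis
    using quotient_disj [OF equiv_fellow_rays, of \<zeta> X b \<eta>] assms(1,2,4)
    by (auto simp: contracting_boundary_def)
qed

lemma boundary_point_contracting:
  assumes "\<zeta> \<in> contracting_boundary X b" "c \<in> \<zeta>"
  obtains \<rho> where "sublinear \<rho>" "contracting_for X \<rho> (ray_image c)"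
  using boundary_point_ray [OF assms] by (auto simp: contracting_rays_def contracting_def)

lemma sublinear_threshold:
  assumes "sublinear \<rho>"
  obtains R where "0 < R" "\<And>r. R \<le> r \<Longrightarrow> 3 * L\<^sup>2 * \<rho> r \<le> r"
proof (cases "L = 0")
  case True
  then show ?thesis using that [of 1] by auto
next
  case False
  have "((\<lambda>r. \<rho> r / r) \<longlongrightarrow> 0) at_top" using assms by (simp add: sublinear_def)
  then have "\<forall>\<^sub>F r in at_top. \<rho> r / r < 1 / (3 * L\<^sup>2)"
    by (rule order_tendstoD) (use False in auto)
  then obtain R where R: "\<And>r. R \<le> r \<Longrightarrow> \<rho> r / r < 1 / (3 * L\<^sup>2)" by (auto simp: eventually_at_top_linorder)
  have "3 * L\<^sup>2 * \<rho> r \<le> r" if "max R 1 \<le> r" for r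
    using R [of r] that False by (simp add: field_simps)
  then show ?thesis using that [of "max R 1"] by auto
qed

lemma sublinear_clearing:
  assumes "sublinear \<rho>" "0 \<le> A"
  obtains k where "clearing \<rho> L A k"
proof -
  obtain R where "0 < R" "\<And>r. R \<le> r \<Longrightarrow> 3 * L\<^sup>2 * \<rho> r \<le> r" using sublinear_threshold [OF assms(1)] by metis
  then have "clearing \<rho> L A (max R (3 * A))" using assms by (auto simp: clearing_def)
  then show ?thesis using that by blast
qed

text \<open>Lying in one class gives a finite Hausdorff distance \<open>C\<close> without any
  control. \<open>fellow_travel_reach\<close> replaces it by \<open>k\<close>; the target
  \<open>s\<close> is taken further out than \<open>S\<close> by the depth lost.\<close>

lemma boundary_point_reach:
  assumes \<zeta>: "\<zeta> \<in> contracting_boundary X b" "\<alpha> \<in> \<zeta>" "\<beta> \<in> \<zeta>"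
    and \<alpha>: "geodesic_ray X b \<alpha>" "contracting_for X \<rho> (ray_image \<alpha>)"
    and k: "clearing \<rho> L A k" and \<beta>: "quasi_ray X b L A \<beta>"
  obtains t v where "0 \<le> t" "0 \<le> v" "S \<le> v" "mdist X (\<beta> t) (\<alpha> v) \<le> k"
proof -
  obtain C where C: "\<forall>y\<in>ray_image \<beta>. \<exists>z\<in>ray_image \<alpha>. mdist X y z \<le> C"
      "\<forall>z\<in>ray_image \<alpha>. \<exists>y\<in>ray_image \<beta>. mdist X y z \<le> C"
    using boundary_point_hausdorff [OF \<zeta>(1,3,2)] by (auto simp: finite_hausdorff_def)
  define s where "s = max 0 (S + travel_bound k L A (max C k))"
  have "\<alpha> s \<in> ray_image \<alpha>" by (auto simp: ray_image_def s_def)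
  then have "\<exists>y\<in>ray_image \<beta>. mdist X y (\<alpha> s) \<le> C" using C(2) by blast
  then obtain T where "0 \<le> T" "mdist X (\<beta> T) (\<alpha> s) \<le> C" by (auto simp: ray_image_def)
  then have T: "0 \<le> T" "0 \<le> s" "mdist X (\<beta> T) (\<alpha> s) \<le> max C k" "k \<le> max C k" by (auto simp: s_def)
  obtain t v where t: "0 \<le> t" "0 \<le> v" "mdist X (\<beta> t) (\<alpha> v) \<le> k" "s - travel_bound k L A (max C k) \<le> v"
    using fellow_travel_reach [OF \<alpha> k \<beta> T] by metis
  have "S \<le> v" using t(4) unfolding s_def by linarith
  then show ?thesis using that t by blast
qed

text \<open>The unknown Hausdorff distance drops out through \<open>boundary_point_reach\<close>, so
  the bound is the same for all geodesic rays \<open>\<beta>\<close> of the class.\<close>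

lemma geodesic_rays_close:
  assumes \<zeta>: "\<zeta> \<in> contracting_boundary X b" "\<alpha> \<in> \<zeta>" "\<beta> \<in> \<zeta>"
    and \<alpha>: "geodesic_ray X b \<alpha>" "contracting_for X \<rho> (ray_image \<alpha>)"
    and k: "clearing \<rho> 1 0 k" and \<beta>: "geodesic_ray X b \<beta>" and R: "0 \<le> R"
  shows "mdist X (\<beta> R) (\<alpha> R) \<le> 2 * travel_bound k 1 0 k"
proof -
  note q = geodesic_ray_quasi_ray [OF \<beta> order_refl order_refl]
  note g = geodesic_rayD [OF \<alpha>(1)] and h = geodesic_rayD [OF \<beta>]
  obtain t v where t: "0 \<le> t" "0 \<le> v" "R + k \<le> v" "mdist X (\<beta> t) (\<alpha> v) \<le> k"
    using boundary_point_reach [OF \<zeta> \<alpha> k q] by metis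
  have "v \<le> t + mdist X (\<beta> t) (\<alpha> v)"
    using mdist_triangle [OF g(2) h(3) [OF t(1)] g(3) [OF t(2)]] g(5) [OF t(2)] h(5) [OF t(1)] by simp
  then show ?thesis
    using t R h(5) by (intro fellow_travel_sphere [OF \<alpha> k q t(1,2,4)]) auto
qed

context coarse_geodesic
begin

text \<open>Contraction survives a finite Hausdorff distance, and continuity supplies the closest
  points that \<open>contracting\<close> demands. In this way rays built by hand become members of
  boundary points.\<close>

lemma quasi_ray_contracting:
  assumes \<beta>: "quasi_ray X b L A \<beta>" and Z: "contracting X Z" "Z \<subseteq> mspace X"
    and fin: "finite_hausdorff X Z (ray_image \<beta>)"
  shows "\<beta> \<in> contracting_rays X b"
proof -
  note q = quasi_rayD [OF \<beta>]
  obtain \<rho> where \<rho>: "sublinear \<rho>" "contracting_for X \<rho> Z" using Z by (auto simp: contracting_def)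
  obtain C where C: "\<forall>y\<in>Z. \<exists>z\<in>ray_image \<beta>. mdist X y z \<le> C" "\<forall>z\<in>ray_image \<beta>. \<exists>y\<in>Z. mdist X y z \<le> C"
    using fin by (auto simp: finite_hausdorff_def)
  let ?C = "max C 0"
  have "contracting_for X (\<lambda>r. 4 * \<rho> (2 * r + ?C) + (14 * ?C + 8)) (ray_image \<beta>)"
  proof (rule contracting_for_hausdorff [OF \<rho>(2) Z(2)])
    show "mono_on {0..} \<rho>" using \<rho>(1) by (simp add: sublinear_def)
    show "ray_image \<beta> \<subseteq> mspace X" using q(7) by (auto simp: ray_image_def)
    show "\<exists>z'\<in>ray_image \<beta>. mdist X z z' \<le> ?C" if "z \<in> Z" for z using C(1) that by (meson max.coboundedI1)
    show "\<exists>z\<in>Z. mdist X z z' \<le> ?C" if "z' \<in> ray_image \<beta>" for z' using C(2) that by (meson max.coboundedI1)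
  qed (use quasi_ray_closest_proj [OF \<beta>] in auto)
  moreover have "sublinear (\<lambda>r. 4 * \<rho> (2 * r + ?C) + (14 * ?C + 8))"
    by (rule sublinear_affine [OF \<rho>(1)]) auto
  ultimately show ?thesis
    using q by (auto simp: contracting_rays_def contracting_def)
qed

lemma quasi_ray_mem_boundary_point:
  assumes "\<zeta> \<in> contracting_boundary X b" "c \<in> \<zeta>" "quasi_ray X b L A \<beta>"
    "finite_hausdorff X (ray_image c) (ray_image \<beta>)"
  shows "\<beta> \<in> \<zeta>"
proof (rule boundary_point_closed [OF assms(1,2) _ assms(4)])
  have c: "c \<in> contracting_rays X b" by (rule boundary_point_ray [OF assms(1,2)])
  then show "\<beta> \<in> contracting_rays X b"
    by (intro quasi_ray_contracting [OF assms(3) _ contracting_ray_subset [OF c] assms(4)])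
      (simp add: contracting_rays_def)
qed

text \<open>\<open>rho_class\<close> is a supremum over all geodesic rays of the class; a common
  \<rho> is what makes it finite. It exists because all these rays stay within one distance
  \<open>C\<close> of \<open>\<alpha>\<close>.\<close>

lemma uniform_contraction:
  assumes \<zeta>: "\<zeta> \<in> contracting_boundary X b" "\<alpha> \<in> \<zeta>" "geodesic_ray X b \<alpha>"
  obtains \<rho> where "sublinear \<rho>" "\<And>a. a \<in> \<zeta> \<Longrightarrow> geodesic_ray X b a \<Longrightarrow> contracting_for X \<rho> (ray_image a)"
proof -
  obtain \<rho> where \<rho>: "sublinear \<rho>" "contracting_for X \<rho> (ray_image \<alpha>)"
    using boundary_point_contracting [OF \<zeta>(1,2)] .
  obtain k where k: "clearing \<rho> 1 0 k" using sublinear_clearing [OF \<rho>(1), of 0] by auto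
  define C where "C = 2 * travel_bound k 1 0 k"
  have C0: "0 \<le> C" using k by (auto simp: C_def travel_bound_def clearing_def)
  have "contracting_for X (\<lambda>r. 4 * \<rho> (2 * r + C) + (14 * C + 8)) (ray_image a)"
    if a: "a \<in> \<zeta>" "geodesic_ray X b a" for a
  proof (rule contracting_for_hausdorff [OF \<rho>(2) geodesic_rayD(6) [OF \<zeta>(3)] _ geodesic_rayD(6) [OF a(2)] _ _ _ C0])
    have close: "mdist X (\<alpha> R) (a R) \<le> C" if "0 \<le> R" for R
      using geodesic_rays_close [OF \<zeta>(1,2) a(1) \<zeta>(3) \<rho>(2) k a(2) that] mdist_commute [of X "\<alpha> R" "a R"]
      by (simp add: C_def)
    show "mono_on {0..} \<rho>" using \<rho>(1) by (simp add: sublinear_def)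
    show "closest_proj X (ray_image a) x \<noteq> {}" if "x \<in> mspace X" for x
      using quasi_ray_closest_proj [OF geodesic_ray_quasi_ray [OF a(2), of 1 0]] that by simp
    show "\<exists>z'\<in>ray_image a. mdist X z z' \<le> C" if "z \<in> ray_image \<alpha>" for z
      using that close by (auto simp: ray_image_def)
    show "\<exists>z\<in>ray_image \<alpha>. mdist X z z' \<le> C" if "z' \<in> ray_image a" for z'
      using that close by (auto simp: ray_image_def)
  qed
  moreover have "sublinear (\<lambda>r. 4 * \<rho> (2 * r + C) + (14 * C + 8))"
    by (rule sublinear_affine [OF \<rho>(1)]) (use C0 in auto)
  ultimately show ?thesis using that by blast
qed

end

section \<open>Surgery\<close>

lemma finite_hausdorff_bounded_parts:
  assumes "x \<in> T" "T \<subseteq> mspace X" "\<And>y. y \<in> P \<union> Q \<Longrightarrow> mdist X y x \<le> B" 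
  shows "finite_hausdorff X (P \<union> T) (Q \<union> T)"
  unfolding finite_hausdorff_def
proof (intro exI [of _ "max B 0"] conjI ballI)
  fix y assume "y \<in> P \<union> T"
  then show "\<exists>z\<in>Q \<union> T. mdist X y z \<le> max B 0"
    using assms by (cases "y \<in> T") (force intro: bexI [of _ y], force intro: bexI [of _ x])
next
  fix y assume "y \<in> Q \<union> T"
  then show "\<exists>z\<in>P \<union> T. mdist X z y \<le> max B 0"
    using assms mdist_commute [of X x y] by (cases "y \<in> T") (force intro: bexI [of _ y], force intro: bexI [of _ x])
qed

lemma continuous_path_shift:
  assumes "continuous_path X {0..} c" "0 \<le> q"
  shows "continuous_path X {0..} (\<lambda>t. c (q + t))"
proof -
  have "continuous_map (top_of_set {0..}) (top_of_set {0..}) (\<lambda>t. q + t)"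
    using assms(2) by (auto intro!: continuous_intros)
  then have "continuous_map (top_of_set {0..}) (mtopology_of X) (c \<circ> (\<lambda>t. q + t))"
    using assms(1) unfolding continuous_path_def by (rule continuous_map_compose)
  then show ?thesis by (simp add: continuous_path_def o_def)
qed

text \<open>If the whole path is longer than the distance of its ends by at most \<open>e\<close>,
  the same holds for each subpath.\<close>

lemma coarse_segment_quasi_geodesic:
  assumes c: "0 \<le> l" "l \<le> mdist X (c 0) (c l) + e" "c ` {0..l} \<subseteq> mspace X"
    "\<And>s t. s \<in> {0..l} \<Longrightarrow> t \<in> {0..l} \<Longrightarrow> mdist X (c s) (c t) \<le> \<bar>s - t\<bar>"
    and L: "1 \<le> L" "e \<le> A" "0 \<le> A"
  shows "quasi_geodesic X L A {0..l} c"
proof -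
  have *: "t - s - e \<le> mdist X (c s) (c t)" if "0 \<le> s" "s \<le> t" "t \<le> l" for s t
  proof -
    have "c 0 \<in> mspace X" "c s \<in> mspace X" "c t \<in> mspace X" "c l \<in> mspace X" using c(3) that by auto
    then have "mdist X (c 0) (c l) \<le> mdist X (c 0) (c s) + mdist X (c s) (c t) + mdist X (c t) (c l)"
      using mdist_triangle [of "c 0" X "c s" "c l"] mdist_triangle [of "c s" X "c t" "c l"] by linarith
    then show ?thesis using c(2) c(4) [of 0 s] c(4) [of t l] that by auto
  qed
  have lo: "\<bar>s - t\<bar> - e \<le> mdist X (c s) (c t)" if "s \<in> {0..l}" "t \<in> {0..l}" for s t
    using *[of s t] *[of t s] that mdist_commute [of X "c s" "c t"] by (cases "s \<le> t") auto
  have "1 / L * \<bar>s - t\<bar> \<le> \<bar>s - t\<bar>" "\<bar>s - t\<bar> \<le> L * \<bar>s - t\<bar>" for s t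
    using L(1) by (simp_all add: divide_le_eq mult_le_cancel_right1 mult_le_cancel_left1)
  then show ?thesis
    unfolding quasi_geodesic_def using c(3,4) lo L(2,3) by (smt (verit, best) is_interval_cc)
qed

context coarse_geodesic
begin

text \<open>
  A ray \<open>\<beta>\<close> is followed up to \<open>\<beta> p\<close>, left along a segment, and continued along the geodesic
  ray \<open>a\<close> from \<open>a q\<close> on. Taking \<open>(p, q)\<close> to be an almost minimum of
  \<open>2 L d(\<beta> u, a v) + u - v / (2 L)\<close> makes the three competing terms add up in the lower bound for
  \<open>d(\<beta> u, a v)\<close> when \<open>u \<le> p\<close> and \<open>q \<le> v\<close>. Hence the constants of the result depend on
  \<open>L\<close> and \<open>A\<close> only, and not on the distance between \<open>\<beta>\<close> and \<open>a\<close>.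
\<close>

lemma surgery:
  assumes \<beta>: "quasi_ray X b L A \<beta>" and a: "geodesic_ray X b a" and s: "0 \<le> s"
  obtains p q \<beta>' where "0 \<le> p" "s \<le> q" "quasi_ray X b (4 * L\<^sup>2) (2 * A + 8) \<beta>'"
    "\<And>t. 0 \<le> t \<Longrightarrow> t \<le> p \<Longrightarrow> \<beta>' t = \<beta> t" "finite_hausdorff X (ray_image a) (ray_image \<beta>')"
    "\<And>u v. 0 \<le> u \<Longrightarrow> s \<le> v \<Longrightarrow> 2 * L * mdist X (\<beta> p) (a q) + p - q / (2 * L)
       \<le> 2 * L * mdist X (\<beta> u) (a v) + u - v / (2 * L) + 1"
proof -
  note qr = quasi_rayD [OF \<beta>] and g = geodesic_rayD [OF a]
  define F where "F u v = 2 * L * mdist X (\<beta> u) (a v) + u - v / (2 * L)" for u v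
  \<comment> \<open>Makes the infimum of \<open>F\<close> exist. Reaching \<open>a v\<close> through
    \<open>\<beta> u\<close> gives \<open>v \<le> L * u + A + mdist X (\<beta> u) (a v)\<close>;
    divided by \<open>2 * L\<close>, the right side is dominated by the first two terms of
    \<open>F\<close> up to \<open>A\<close>.\<close>
  have bound: "- A \<le> F u v" if "0 \<le> u" "s \<le> v" for u v
  proof -
    have v: "0 \<le> v" using that s by simp
    have "v \<le> L * u + A + mdist X (\<beta> u) (a v)"
      using mdist_triangle [OF g(2) qr(7) [OF that(1)] g(3) [OF v]] g(5) [OF v] qr(10) [OF that(1)] by simp
    then have "v / (2 * L) \<le> (L * u + A + mdist X (\<beta> u) (a v)) / (2 * L)"
      using qr(1) by (intro divide_right_mono) auto
    also have "\<dots> = u / 2 + A / (2 * L) + mdist X (\<beta> u) (a v) / (2 * L)"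
      using qr(1) by (simp add: field_simps)
    also have "A / (2 * L) \<le> A" using qr(1,2) by (simp add: divide_le_eq mult_le_cancel_left1)
    also have "mdist X (\<beta> u) (a v) / (2 * L) \<le> 2 * L * mdist X (\<beta> u) (a v)"
    proof -
      have "mdist X (\<beta> u) (a v) / (2 * L) \<le> mdist X (\<beta> u) (a v) / 1"
        using qr(1) by (intro divide_left_mono) auto
      then have "mdist X (\<beta> u) (a v) / (2 * L) \<le> 1 * mdist X (\<beta> u) (a v)" by simp
      also have "1 * mdist X (\<beta> u) (a v) \<le> 2 * L * mdist X (\<beta> u) (a v)"
        using qr(1) by (intro mult_right_mono) auto
      finally show ?thesis .
    qed
    finally show ?thesis using that(1) by (simp add: F_def)
  qed
  define V where "V = {F u v | u v. 0 \<le> u \<and> s \<le> v}"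
  have V: "V \<noteq> {}" "bdd_below V" using bound by (auto simp: V_def intro!: bdd_belowI [of _ "- A"])
  then obtain p q where p: "0 \<le> p" and q: "s \<le> q" and "F p q < Inf V + 1"
    using cInf_lessD [of V "Inf V + 1"] by (auto simp: V_def)
  moreover have "Inf V \<le> F u v" if "0 \<le> u" "s \<le> v" for u v
    by (rule cInf_lower [OF _ V(2)]) (use that in \<open>auto simp: V_def\<close>)
  ultimately have min: "F p q \<le> F u v + 1" if "0 \<le> u" "s \<le> v" for u v using that by fastforce
  have q0: "0 \<le> q" using s q by simp
  let ?D = "mdist X (\<beta> p) (a q)"
  \<comment> \<open>Almost minimality divided by \<open>2 * L\<close>, which is the origin of the
    factor \<open>4 * L\<^sup>2\<close>. The \<open>1\<close> pays for the infimum not being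
    attained.\<close>
  have apart: "?D + (p - u) / (2 * L) + (v - q) / (4 * L\<^sup>2) - 1 \<le> mdist X (\<beta> u) (a v)"
    if "0 \<le> u" "s \<le> v" for u v
  proof -
    have "2 * L * ?D + (p - u) + (v - q) / (2 * L) \<le> 2 * L * mdist X (\<beta> u) (a v) + 1"
      using min [OF that] by (simp add: F_def diff_divide_distrib)
    then have "(2 * L * ?D + (p - u) + (v - q) / (2 * L)) / (2 * L) \<le> (2 * L * mdist X (\<beta> u) (a v) + 1) / (2 * L)"
      using qr(1) by (intro divide_right_mono) auto
    moreover have "(2 * L * ?D + (p - u) + (v - q) / (2 * L)) / (2 * L) = ?D + (p - u) / (2 * L) + (v - q) / (4 * L\<^sup>2)"
      using qr(1) by (simp add: add_divide_distrib power2_eq_square)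
    moreover have "(2 * L * mdist X (\<beta> u) (a v) + 1) / (2 * L) \<le> mdist X (\<beta> u) (a v) + 1"
      using qr(1) by (simp add: add_divide_distrib)
    ultimately show ?thesis by linarith
  qed
  obtain c l where c: "0 \<le> l" "l \<le> ?D + 1" "c 0 = \<beta> p" "c l = a q" "c ` {0..l} \<subseteq> mspace X"
    "\<And>s t. s \<in> {0..l} \<Longrightarrow> t \<in> {0..l} \<Longrightarrow> mdist X (c s) (c t) \<le> \<bar>s - t\<bar>"
    using coarse_geodesic [OF qr(7) [OF p] g(3) [OF q0]] by metis
  have cM: "c w \<in> mspace X" if "0 \<le> w" "w \<le> l" for w using c(5) that by auto
  have L4: "1 \<le> 4 * L\<^sup>2" "L \<le> 4 * L\<^sup>2" "2 * L \<le> 4 * L\<^sup>2"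
  proof -
    have "L * 1 \<le> L * L" using qr(1) by (intro mult_left_mono) auto
    then have "L \<le> L\<^sup>2" by (simp add: power2_eq_square)
    then show "1 \<le> 4 * L\<^sup>2" "L \<le> 4 * L\<^sup>2" "2 * L \<le> 4 * L\<^sup>2"
      using qr(1) by linarith+
  qed
  have frac: "x / (4 * L\<^sup>2) \<le> x" "x / (4 * L\<^sup>2) \<le> x / (2 * L)" if "0 \<le> x" for x
    using that L4(1) divide_left_mono [OF L4(3) that] qr(1) by (auto simp: divide_le_eq mult_le_cancel_left1)
  let ?tail = "\<lambda>t. a (q + t)"
  define \<gamma> where "\<gamma> = path_join l c ?tail"
  \<comment> \<open>Additive constants: 2 for the segment and the tail, doubled to 4 by their join,
    raised to \<open>A + 4\<close> to suit \<open>\<beta>\<close>, and doubled again to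
    \<open>2 * A + 8\<close>.\<close>
  have seg: "quasi_geodesic X (4 * L\<^sup>2) 2 {0..l} c"
    by (rule coarse_segment_quasi_geodesic [where e = 1]) (use c L4 in auto)
  have tail: "quasi_geodesic X (4 * L\<^sup>2) 2 {0..} ?tail"
  proof -
    have "quasi_geodesic X 1 0 {0..} ?tail"
      using g(3,4) q0 by (auto simp: quasi_geodesic_def is_interval_ci)
    then show ?thesis by (rule quasi_geodesic_mono) (use L4 in auto)
  qed
  have "quasi_geodesic X (4 * L\<^sup>2) (2 * 2) {0..} \<gamma>"
    unfolding \<gamma>_def
  proof (rule quasi_geodesic_join [OF seg tail])
    fix w v :: real assume w: "0 \<le> w" "w \<le> l" and v: "0 \<le> v"
    have "?D + v / (4 * L\<^sup>2) - 1 \<le> mdist X (\<beta> p) (a (q + v))"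
      using apart [of p "q + v"] p q v by simp
    moreover have "mdist X (\<beta> p) (a (q + v)) \<le> w + mdist X (c w) (a (q + v))"
      using mdist_triangle [OF qr(7) [OF p] cM [OF w] g(3) [of "q + v"]] c(6) [of 0 w] c(3) w v q0 by auto
    moreover have "(l - w + v) / (4 * L\<^sup>2) \<le> (l - w) + v / (4 * L\<^sup>2)"
      using frac(1) [of "l - w"] w by (simp add: add_divide_distrib)
    ultimately show "(l - w + v) / (4 * L\<^sup>2) - 2 \<le> mdist X (c w) (a (q + v))" using c(2) by linarith
  qed (use c L4 in auto)
  then have \<gamma>: "quasi_geodesic X (4 * L\<^sup>2) (A + 4) {0..} \<gamma>"
    by (rule quasi_geodesic_mono) (use qr(2) L4 in auto)
  have "quasi_geodesic X (4 * L\<^sup>2) (A + 4) {0..} \<beta>"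
    by (rule quasi_geodesic_mono [OF qr(3)]) (use qr L4 in auto)
  then have \<beta>p: "quasi_geodesic X (4 * L\<^sup>2) (A + 4) {0..p} \<beta>"
    by (auto simp: quasi_geodesic_def is_interval_cc)
  define \<beta>' where "\<beta>' = path_join p \<beta> \<gamma>"
  have \<gamma>0: "\<beta> p = \<gamma> 0" using c by (simp add: \<gamma>_def path_join_def)
  have "quasi_geodesic X (4 * L\<^sup>2) (2 * (A + 4)) {0..} \<beta>'"
    unfolding \<beta>'_def
  proof (rule quasi_geodesic_join [OF \<beta>p \<gamma> \<gamma>0 p L4(1)])
    fix u t :: real assume u: "0 \<le> u" "u \<le> p" and t: "0 \<le> t"
    note split = add_divide_distrib [of "p - u" t "4 * L\<^sup>2"]
    show "(p - u + t) / (4 * L\<^sup>2) - (A + 4) \<le> mdist X (\<beta> u) (\<gamma> t)"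
    proof (cases "t \<le> l")
      case True
      have "?D + (p - u) / (2 * L) - 1 \<le> mdist X (\<beta> u) (a q)" using apart [of u q] u q by simp
      moreover have "mdist X (\<beta> u) (a q) \<le> mdist X (\<beta> u) (c t) + (l - t)"
        using mdist_triangle [OF qr(7) [OF u(1)] cM [OF t True] g(3) [OF q0]] c(6) [of t l] c(4) t True c(1) by auto
      ultimately show ?thesis
        using frac(1) [of t] frac(2) [of "p - u"] t u c(2) split qr(2) True by (simp add: \<gamma>_def path_join_def)
    next
      case False
      have "?D + (p - u) / (2 * L) + (t - l) / (4 * L\<^sup>2) - 1 \<le> mdist X (\<beta> u) (\<gamma> t)"
        using apart [of u "q + (t - l)"] u q False by (simp add: \<gamma>_def path_join_def)
      moreover have "t / (4 * L\<^sup>2) \<le> l + (t - l) / (4 * L\<^sup>2)"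
        using frac(1) [OF c(1)] by (simp add: diff_divide_distrib)
      ultimately show ?thesis using frac(2) [of "p - u"] u c(2) split qr(2) by linarith
    qed
  qed (use qr(2) in auto)
  moreover have "continuous_path X {0..} \<beta>'"
    unfolding \<beta>'_def
  proof (rule continuous_path_join)
    show "continuous_path X {0..p} \<beta>" by (rule continuous_path_subset [OF qr(4)]) auto
    have "continuous_path X {0..l} c" using c by (intro continuous_path_lipschitz) auto
    moreover have "continuous_path X {0..} a"
      using quasi_rayD(4) [OF geodesic_ray_quasi_ray [OF a, of 1 0]] by simp
    ultimately show "continuous_path X {0..} \<gamma>"
      unfolding \<gamma>_def using c q0 by (intro continuous_path_join continuous_path_shift) auto
  qed (use \<gamma>0 p in auto)
  ultimately have q\<beta>': "quasi_ray X b (4 * L\<^sup>2) (2 * A + 8) \<beta>'"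
    using L4 qr(2,5) p by (auto simp: quasi_ray_def \<beta>'_def path_join_def)
  have "ray_image \<beta>' = (\<beta> ` {0..p} \<union> c ` {0..l}) \<union> ray_image ?tail"
    using p c \<gamma>0 by (simp add: \<beta>'_def \<gamma>_def ray_image_join Un_assoc)
  moreover have "ray_image a = a ` {0..q} \<union> ray_image ?tail"
  proof -
    have "t \<in> (\<lambda>t. q + t) ` {0..}" if "q \<le> t" for t
      using that by (intro image_eqI [of _ _ "t - q"]) auto
    then have "{0..} = {0..q} \<union> (\<lambda>t. q + t) ` {0..}" using q0 by force
    then show ?thesis unfolding ray_image_def by (metis image_Un image_image)
  qed
  moreover have "finite_hausdorff X (a ` {0..q} \<union> ray_image ?tail) ((\<beta> ` {0..p} \<union> c ` {0..l}) \<union> ray_image ?tail)"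
  proof (rule finite_hausdorff_bounded_parts)
    show "a q \<in> ray_image ?tail" by (auto simp: ray_image_def intro!: image_eqI [of _ _ 0])
    show "ray_image ?tail \<subseteq> mspace X" using g(3) q0 by (auto simp: ray_image_def)
    fix y assume "y \<in> a ` {0..q} \<union> (\<beta> ` {0..p} \<union> c ` {0..l})"
    then consider t where "y = a t" "0 \<le> t" "t \<le> q" | u where "y = \<beta> u" "0 \<le> u" "u \<le> p"
      | w where "y = c w" "0 \<le> w" "w \<le> l" by auto
    moreover have "0 \<le> L * p" "0 \<le> ?D" using qr(1) p by auto
    ultimately show "mdist X y (a q) \<le> q + (L * p + A + ?D) + l"
    proof cases
      case 1
      show ?thesis unfolding 1(1) using 1(2,3) g(4) [OF 1(2) q0] c(1) p qr(1,2) \<open>0 \<le> L * p\<close> \<open>0 \<le> ?D\<close> by linarith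
    next
      case 2
      have "L * (p - u) \<le> L * p" using 2 qr(1) by (intro mult_left_mono) auto
      then show ?thesis
        using mdist_triangle [OF qr(7) [OF 2(2)] qr(7) [OF p] g(3) [OF q0]] qr(8) [of u p] 2 p q0 c(1) by simp
    next
      case 3
      have "mdist X (c w) (a q) \<le> l - w" using 3 c(6) [of w l] c(1,4) by simp
      then show ?thesis unfolding 3(1) using 3(2) q0 p qr(1,2) \<open>0 \<le> L * p\<close> \<open>0 \<le> ?D\<close> by linarith
    qed
  qed
  ultimately have "finite_hausdorff X (ray_image a) (ray_image \<beta>')" by simp
  then show ?thesis
    using that [OF p q q\<beta>'] min by (simp add: \<beta>'_def path_join_def F_def)
qed

text \<open>Compare the almost minimum with the value at \<open>(t, v)\<close>. If
  \<open>p \<le> N\<close>, then \<open>\<beta> p\<close> is at least \<open>q - L * N - A\<close>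
  away from \<open>a q\<close>, so the first term of the functional is about
  \<open>2 * L * q\<close>, against at most \<open>q / (2 * L)\<close> subtracted. At
  \<open>(t, v)\<close> the value grows only like \<open>L * v\<close>, which is impossible for
  \<open>v\<close> as large as assumed.\<close>

lemma surgery_far:
  assumes \<beta>: "quasi_ray X b L A \<beta>" and a: "geodesic_ray X b a"
    and C: "0 \<le> t" "mdist X (\<beta> t) (a v) \<le> C" and v: "2 * L * N + 3 * A + 3 * C + 1 < v" "0 \<le> N"
  obtains p \<beta>' where "N < p" "quasi_ray X b (4 * L\<^sup>2) (2 * A + 8) \<beta>'"
    "\<And>t. 0 \<le> t \<Longrightarrow> t \<le> p \<Longrightarrow> \<beta>' t = \<beta> t" "finite_hausdorff X (ray_image a) (ray_image \<beta>')"
proof -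
  note qr = quasi_rayD [OF \<beta>] and g = geodesic_rayD [OF a]
  have C0: "0 \<le> C" using C(2) mdist_nonneg [of X "\<beta> t" "a v"] by linarith
  have v0: "0 \<le> v" using v qr(1,2) C0 by (smt (verit) mult_nonneg_nonneg)
  obtain p q \<beta>' where p: "0 \<le> p" "v \<le> q" and \<beta>': "quasi_ray X b (4 * L\<^sup>2) (2 * A + 8) \<beta>'"
    "\<And>t. 0 \<le> t \<Longrightarrow> t \<le> p \<Longrightarrow> \<beta>' t = \<beta> t" "finite_hausdorff X (ray_image a) (ray_image \<beta>')"
    and min: "2 * L * mdist X (\<beta> p) (a q) + p - q / (2 * L) \<le> 2 * L * mdist X (\<beta> t) (a v) + t - v / (2 * L) + 1"
    using surgery [OF \<beta> a v0] C(1) by (metis order_refl)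
  have "N < p"
  proof (rule ccontr)
    assume "\<not> N < p"
    then have pN: "p \<le> N" by simp
    have q0: "0 \<le> q" using v0 p by simp
    have "q \<le> L * p + A + mdist X (\<beta> p) (a q)"
      using mdist_triangle [OF g(2) qr(7) [OF p(1)] g(3) [OF q0]] g(5) [OF q0] qr(10) [OF p(1)] by simp
    moreover have "L * p \<le> L * N" using pN qr(1) by (intro mult_left_mono) auto
    ultimately have "q - L * N - A \<le> mdist X (\<beta> p) (a q)" by linarith
    then have "2 * L * (q - L * N - A) \<le> 2 * L * mdist X (\<beta> p) (a q)"
      using qr(1) by (intro mult_left_mono) auto
    moreover have "t \<le> L * (v + C + A)"
    proof -
      have "mdist X b (\<beta> t) \<le> v + C"
        using mdist_triangle [OF g(2) g(3) [OF v0] qr(7) [OF C(1)]] g(5) [OF v0] C(2)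
          mdist_commute [of X "\<beta> t" "a v"] by simp
      then have "L * (mdist X b (\<beta> t) + A) \<le> L * (v + C + A)" using qr(1) by (intro mult_left_mono) auto
      then show ?thesis using qr(11) [OF C(1)] by linarith
    qed
    moreover have "2 * L * mdist X (\<beta> t) (a v) \<le> 2 * L * C" using C(2) qr(1) by (intro mult_left_mono) auto
    ultimately have *: "2 * L * (q - L * N - A) - q / (2 * L) + v / (2 * L) \<le> 2 * L * C + L * (v + C + A) + 1"
      using min p(1) by linarith
    have "(q - v) / (2 * L) \<le> q - v" using qr(1) p(2) by (simp add: divide_le_eq mult_le_cancel_left1)
    also have "\<dots> \<le> 2 * L * (q - v)" using qr(1) p(2) by (simp add: mult_le_cancel_right1)
    finally have "2 * L * v \<le> 2 * L * q - q / (2 * L) + v / (2 * L)"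
      by (simp add: diff_divide_distrib right_diff_distrib)
    with * have "2 * L * (v - L * N - A) \<le> 2 * L * C + L * (v + C + A) + 1"
      by (simp add: algebra_simps)
    then have "L * v \<le> L * (2 * L * N + 3 * A + 3 * C) + 1" by (simp add: algebra_simps)
    also have "\<dots> \<le> L * (2 * L * N + 3 * A + 3 * C + 1)" using qr(1) by (simp add: algebra_simps)
    finally show False using v(1) qr(1) by (simp add: mult_le_cancel_left)
  qed
  then show ?thesis using that \<beta>' by blast
qed

end

section \<open>Neighbourhoods in the boundary\<close>

text \<open>The distance between sets is an infimum; the extra 1 buys actual points.\<close>

lemma boundary_nbhdD:
  assumes "\<eta> \<in> boundary_nbhd X b \<alpha> \<zeta> r" "\<beta> \<in> \<eta>" "quasi_ray X b L A \<beta>"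
    and \<alpha>: "geodesic_ray X b (\<alpha> \<zeta>)"
  obtains t v where "0 \<le> t" "0 \<le> v" "r \<le> v" "mdist X (\<beta> t) (\<alpha> \<zeta> v) \<le> kappa (rho_class X b \<zeta>) L A + 1"
proof -
  let ?F = "ray_image (\<alpha> \<zeta>) \<inter> far_points X b r"
  note q = quasi_rayD [OF assms(3)]
  have "mset_dist X (ray_image \<beta>) ?F \<le> kappa (rho_class X b \<zeta>) L A"
    using assms q by (auto simp: boundary_nbhd_def)
  moreover have "ray_image \<beta> \<noteq> {}" by (simp add: ray_image_def)
  then obtain x y where "x \<in> ray_image \<beta>" "y \<in> ?F" "mdist X x y < mset_dist X (ray_image \<beta>) ?F + 1"
    using mset_dist_approx [of "ray_image \<beta>" ?F 1 X] geodesic_ray_far [OF \<alpha>] by auto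
  ultimately show ?thesis
    using that geodesic_rayD(5) [OF \<alpha>] by (force simp: ray_image_def far_points_def)
qed

lemma boundary_nbhdI:
  assumes "\<eta> \<in> contracting_boundary X b" and \<alpha>: "geodesic_ray X b (\<alpha> \<zeta>)"
    and "\<And>L A \<beta>. \<beta> \<in> \<eta> \<Longrightarrow> quasi_ray X b L A \<beta> \<Longrightarrow>
      \<exists>t\<ge>0. \<exists>v\<ge>0. r \<le> v \<and> mdist X (\<beta> t) (\<alpha> \<zeta> v) \<le> kappa (rho_class X b \<zeta>) L A"
  shows "\<eta> \<in> boundary_nbhd X b \<alpha> \<zeta> r"
proof -
  have "mset_dist X (ray_image \<beta>) (ray_image (\<alpha> \<zeta>) \<inter> far_points X b r) \<le> kappa (rho_class X b \<zeta>) L A"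
    if h: "1 \<le> L" "0 \<le> A" "\<beta> \<in> \<eta>" "quasi_geodesic X L A {0..} \<beta>" "continuous_path X {0..} \<beta>" for L A \<beta>
  proof -
    have "\<beta> 0 = b" using boundary_point_ray [OF assms(1) that(3)] by (simp add: contracting_rays_def)
    then have "quasi_ray X b L A \<beta>" using that by (simp add: quasi_ray_def)
    then obtain t v where tv: "0 \<le> t" "0 \<le> v" "r \<le> v"
        "mdist X (\<beta> t) (\<alpha> \<zeta> v) \<le> kappa (rho_class X b \<zeta>) L A"
      using assms(3) [OF h(3)] by metis
    have "mset_dist X (ray_image \<beta>) (ray_image (\<alpha> \<zeta>) \<inter> far_points X b r) \<le> mdist X (\<beta> t) (\<alpha> \<zeta> v)"
      using tv geodesic_rayD(3,5) [OF \<alpha>] by (intro mset_dist_le) (auto simp: ray_image_def far_points_def)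
    with tv(4) show ?thesis by linarith
  qed
  then show ?thesis using assms(1) by (auto simp: boundary_nbhd_def)
qed

locale based_space = coarse_geodesic X for X :: "'p metric" +
  fixes b :: 'p and \<alpha> :: "'p path set \<Rightarrow> 'p path"
  assumes base: "b \<in> mspace X" and choice: "ray_choice X b \<alpha>"
begin

abbreviation "bdry \<equiv> contracting_boundary X b"
abbreviation "nbhd \<equiv> boundary_nbhd X b \<alpha>"
abbreviation "\<kappa> \<zeta> \<equiv> kappa (rho_class X b \<zeta>)"

lemma choiceD: "\<zeta> \<in> bdry \<Longrightarrow> \<alpha> \<zeta> \<in> \<zeta>" "\<zeta> \<in> bdry \<Longrightarrow> geodesic_ray X b (\<alpha> \<zeta>)"
  using choice by (auto simp: ray_choice_def)

text \<open>The uniform contraction function dominates every member of the set behind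
  \<open>rho_class\<close>, so the supremum is genuine and lies below a sublinear function. This
  domination later yields the thresholds in \<open>kappa\<close>.\<close>

lemma rho_class_contracting:
  assumes \<zeta>: "\<zeta> \<in> bdry"
  obtains \<rho> where "sublinear \<rho>" "\<And>r. 0 \<le> r \<Longrightarrow> 0 \<le> rho_class X b \<zeta> r" "\<And>r. 0 \<le> r \<Longrightarrow> rho_class X b \<zeta> r \<le> \<rho> r"
    "contracting_for X (rho_class X b \<zeta>) (ray_image (\<alpha> \<zeta>))"
proof -
  obtain \<rho> where \<rho>: "sublinear \<rho>" "\<And>a. a \<in> \<zeta> \<Longrightarrow> geodesic_ray X b a \<Longrightarrow> contracting_for X \<rho> (ray_image a)"
    using uniform_contraction [OF \<zeta> choiceD [OF \<zeta>]] by metis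
  have mono: "mono_on {0..} \<rho>" using \<rho>(1) by (simp add: sublinear_def)
  let ?P = "\<lambda>a x y. closest_proj X (ray_image a) x \<union> closest_proj X (ray_image a) y"
  define V where "V r = {mdiam X (?P a x y)
     | a x y. a \<in> \<zeta> \<and> geodesic_ray X b a \<and> x \<in> mspace X \<and> y \<in> mspace X \<and>
       mdist X x y \<le> mset_dist X {x} (ray_image a) \<and> mset_dist X {x} (ray_image a) \<le> r}" for r
  have rV: "rho_class X b \<zeta> r = Sup (V r)" for r by (simp add: rho_class_def V_def)
  have up: "m \<le> \<rho> r" if m: "m \<in> V r" for m r
  proof -
    obtain a x y where a: "m = mdiam X (?P a x y)" "a \<in> \<zeta>" "geodesic_ray X b a" "x \<in> mspace X" "y \<in> mspace X"
       "mdist X x y \<le> mset_dist X {x} (ray_image a)" "mset_dist X {x} (ray_image a) \<le> r"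
      using m unfolding V_def by blast
    have "m \<le> \<rho> (mset_dist X {x} (ray_image a))"
      using \<rho>(2) [OF a(2,3)] a by (simp add: contracting_for_def)
    moreover have "0 \<le> mset_dist X {x} (ray_image a)" by (rule mset_dist_nonneg) (auto simp: ray_image_def)
    then have "\<rho> (mset_dist X {x} (ray_image a)) \<le> \<rho> r" using a(7) by (intro mono_onD [OF mono]) auto
    ultimately show ?thesis by simp
  qed
  then have bdd: "bdd_above (V r)" for r by (intro bdd_aboveI)
  note g = geodesic_rayD [OF choiceD(2) [OF \<zeta>]] and c = choiceD [OF \<zeta>]
  have con: "contracting_for X \<rho> (ray_image (\<alpha> \<zeta>))" using \<rho>(2) c by blast
  have ge: "mdiam X (?P (\<alpha> \<zeta>) x y) \<le> rho_class X b \<zeta> r"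
    if "x \<in> mspace X" "y \<in> mspace X" "mdist X x y \<le> mset_dist X {x} (ray_image (\<alpha> \<zeta>))"
      "mset_dist X {x} (ray_image (\<alpha> \<zeta>)) \<le> r" for x y r
    unfolding rV by (rule cSup_upper [OF _ bdd]) (use that c in \<open>auto simp: V_def\<close>)
  \<comment> \<open>The choice \<open>x = y = b\<close> is admissible for every
    \<open>r \<ge> 0\<close>. It shows that the set is nonempty and its supremum
    nonnegative.\<close>
  have b0: "mset_dist X {b} (ray_image (\<alpha> \<zeta>)) = 0"
    using mset_dist_le [of b "{b}" b "ray_image (\<alpha> \<zeta>)" X] g(2,7)
      mset_dist_nonneg [of "{b}" "ray_image (\<alpha> \<zeta>)" X] by fastforce
  have nonneg: "0 \<le> rho_class X b \<zeta> r" and le: "rho_class X b \<zeta> r \<le> \<rho> r" if r: "0 \<le> r" for r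
  proof -
    obtain p where p: "p \<in> closest_proj X (ray_image (\<alpha> \<zeta>)) b" using contracting_for_proj [OF con g(2)] .
    have "mdist X p p \<le> mdiam X (?P (\<alpha> \<zeta>) b b)"
      by (rule mdist_le_mdiam [OF closest_proj_union_bounded [OF g(6,2,2)]]) (use p in auto)
    then have "0 \<le> mdiam X (?P (\<alpha> \<zeta>) b b)" using mdist_nonneg [of X p p] by linarith
    also have "\<dots> \<le> rho_class X b \<zeta> r" using b0 g(2) r by (intro ge) auto
    finally show "0 \<le> rho_class X b \<zeta> r" .
    have "mdiam X (?P (\<alpha> \<zeta>) b b) \<in> V r" using b0 g(2) r c by (force simp: V_def)
    then show "rho_class X b \<zeta> r \<le> \<rho> r" unfolding rV using up by (intro cSup_least) auto
  qed
  have "contracting_for X (rho_class X b \<zeta>) (ray_image (\<alpha> \<zeta>))"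
    using con ge unfolding contracting_for_def by blast
  then show ?thesis using that \<rho>(1) nonneg le by blast
qed

lemma rho_class_threshold:
  assumes "\<zeta> \<in> bdry"
  obtains R where "0 < R" "\<And>r. R \<le> r \<Longrightarrow> 3 * L\<^sup>2 * rho_class X b \<zeta> r \<le> r"
proof -
  obtain \<rho> where \<rho>: "sublinear \<rho>" "\<And>r. 0 \<le> r \<Longrightarrow> rho_class X b \<zeta> r \<le> \<rho> r"
    using rho_class_contracting [OF assms] by metis
  obtain R where R: "0 < R" "\<And>r. R \<le> r \<Longrightarrow> 3 * L\<^sup>2 * \<rho> r \<le> r" using sublinear_threshold [OF \<rho>(1)] by metis
  have "3 * L\<^sup>2 * rho_class X b \<zeta> r \<le> r" if r: "R \<le> r" for r
  proof -
    have "3 * L\<^sup>2 * rho_class X b \<zeta> r \<le> 3 * L\<^sup>2 * \<rho> r" using \<rho>(2) R(1) r by (intro mult_left_mono) auto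
    then show ?thesis using R(2) [OF r] by linarith
  qed
  then show ?thesis using that R(1) by blast
qed

lemma kappa_ge: "3 * A \<le> \<kappa> \<zeta> L A" "3 * L\<^sup>2 \<le> \<kappa> \<zeta> L A"
  "1 + Inf {R. R > 0 \<and> (\<forall>r\<ge>R. 3 * L\<^sup>2 * rho_class X b \<zeta> r \<le> r)} \<le> \<kappa> \<zeta> L A"
  by (simp_all add: kappa_def)

text \<open>The summand 1 puts \<open>kappa\<close> strictly above the infimum of the thresholds,
  which need not be attained. A genuine threshold then lies below every \<open>r\<close> from
  \<open>kappa\<close> on.\<close>

lemma kappa_clearing:
  assumes "\<zeta> \<in> bdry"
  shows "clearing (rho_class X b \<zeta>) L A (\<kappa> \<zeta> L A)"
proof -
  define S where "S = {R. R > 0 \<and> (\<forall>r\<ge>R. 3 * L\<^sup>2 * rho_class X b \<zeta> r \<le> r)}"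
  have S: "S \<noteq> {}" using rho_class_threshold [OF assms, of L] by (auto simp: S_def)
  have inf: "1 + Inf S \<le> \<kappa> \<zeta> L A" using kappa_ge(3) by (simp add: S_def)
  have "0 \<le> Inf S" using S by (intro cInf_greatest) (auto simp: S_def)
  moreover have "3 * L\<^sup>2 * rho_class X b \<zeta> r \<le> r" if r: "\<kappa> \<zeta> L A \<le> r" for r
  proof -
    have "Inf S < r" using r inf by linarith
    then obtain R where "R \<in> S" "R < r" using cInf_lessD [OF S] by blast
    then show ?thesis by (auto simp: S_def)
  qed
  ultimately show ?thesis using inf kappa_ge(1) [of A \<zeta> L] by (auto simp: clearing_def)
qed

text \<open>As \<open>rho_class\<close> is nonnegative, thresholds for \<open>L'\<close> are
  thresholds for \<open>L\<close>, so the infimum for \<open>L'\<close> runs over a smaller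
  set.\<close>

lemma kappa_mono:
  assumes \<zeta>: "\<zeta> \<in> bdry" and L: "0 \<le> L" "L \<le> L'" "A \<le> A'"
  shows "\<kappa> \<zeta> L A \<le> \<kappa> \<zeta> L' A'"
proof -
  define S where "S L = {R. R > 0 \<and> (\<forall>r\<ge>R. 3 * L\<^sup>2 * rho_class X b \<zeta> r \<le> r)}" for L
  have sq: "L\<^sup>2 \<le> L'\<^sup>2" using L by (intro power_mono)
  have nn: "0 \<le> rho_class X b \<zeta> r" if "0 \<le> r" for r using rho_class_contracting [OF \<zeta>] that by metis
  have "S L' \<subseteq> S L"
  proof
    fix R assume R: "R \<in> S L'"
    have "3 * L\<^sup>2 * rho_class X b \<zeta> r \<le> r" if r: "R \<le> r" for r
    proof -
      have "0 \<le> rho_class X b \<zeta> r" using nn R r by (auto simp: S_def)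
      then have "3 * L\<^sup>2 * rho_class X b \<zeta> r \<le> 3 * L'\<^sup>2 * rho_class X b \<zeta> r"
        using sq by (intro mult_right_mono) auto
      moreover have "3 * L'\<^sup>2 * rho_class X b \<zeta> r \<le> r" using R r by (simp add: S_def)
      ultimately show ?thesis by linarith
    qed
    then show "R \<in> S L" using R by (simp add: S_def)
  qed
  moreover have "S L' \<noteq> {}" using rho_class_threshold [OF \<zeta>, of L'] by (auto simp: S_def)
  moreover have "bdd_below (S L)" by (auto simp: S_def intro!: bdd_belowI [of _ 0])
  ultimately have "Inf (S L) \<le> Inf (S L')" by (intro cInf_superset_mono)
  then show ?thesis using L(3) sq unfolding kappa_def S_def by (auto simp: max_def)
qed

lemma travel_bound_mono:
  assumes "k \<le> k'" "0 \<le> L" "L \<le> L'" "A \<le> A'" "C \<le> C'" "0 \<le> k" "0 \<le> A" "0 \<le> C"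
  shows "travel_bound k L A C \<le> travel_bound k' L' A' C'"
proof -
  have "L\<^sup>2 \<le> L'\<^sup>2" using assms by (intro power_mono)
  then have "L\<^sup>2 * (k + C + A) \<le> L'\<^sup>2 * (k' + C' + A')" using assms by (intro mult_mono) auto
  then show ?thesis using assms by (simp add: travel_bound_def)
qed

section \<open>Separation of boundary points and interiors of neighbourhoods\<close>

lemma boundary_nbhd_self:
  assumes \<zeta>: "\<zeta> \<in> bdry"
  shows "\<zeta> \<in> nbhd \<zeta> r"
proof (rule boundary_nbhdI [where \<alpha> = \<alpha> and \<zeta> = \<zeta>, OF \<zeta> choiceD(2) [OF \<zeta>]])
  fix L A \<beta> assume \<beta>: "\<beta> \<in> \<zeta>" "quasi_ray X b L A \<beta>"
  obtain \<rho> where "contracting_for X (rho_class X b \<zeta>) (ray_image (\<alpha> \<zeta>))"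
    using rho_class_contracting [OF \<zeta>] by metis
  then show "\<exists>t\<ge>0. \<exists>v\<ge>0. r \<le> v \<and> mdist X (\<beta> t) (\<alpha> \<zeta> v) \<le> \<kappa> \<zeta> L A"
    using boundary_point_reach [OF \<zeta> choiceD(1) [OF \<zeta>] \<beta>(1) choiceD(2) [OF \<zeta>] _ kappa_clearing [OF \<zeta>] \<beta>(2)]
    by metis
qed

text \<open>Fix a radius \<open>R\<close> at which the rays of \<open>y\<close> and \<open>z\<close>
  are further apart than the sum of the two fellow-travelling errors. A point common to
  \<open>\<beta>\<close> and \<open>\<gamma>\<close> on the sphere of radius \<open>R\<close> would
  be close to both, and \<open>\<beta>\<close> meets this sphere by time \<open>N\<close>.\<close>

lemma agreement_bound:
  assumes yz: "y \<in> bdry" "z \<in> bdry" "y \<noteq> z" and LA: "1 \<le> L" "0 \<le> A"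
  obtains r N where "1 \<le> r" "0 \<le> N"
    "\<And>\<eta> \<theta> \<beta> \<gamma> T. \<lbrakk>\<eta> \<in> nbhd y r; \<theta> \<in> nbhd z r; \<beta> \<in> \<eta>; \<gamma> \<in> \<theta>; quasi_ray X b L A \<beta>; quasi_ray X b L A \<gamma>;
      \<And>t. 0 \<le> t \<Longrightarrow> t \<le> T \<Longrightarrow> \<beta> t = \<gamma> t\<rbrakk> \<Longrightarrow> T \<le> N"
proof -
  define E where "E x = 2 * travel_bound (\<kappa> x L A) L A (\<kappa> x L A + 1)" for x
  have pos: "0 \<le> E x" "0 < \<kappa> x L A" if "x \<in> bdry" for x
    using kappa_clearing [OF that, of L A] LA by (auto simp: E_def travel_bound_def clearing_def)
  have con: "contracting_for X (rho_class X b x) (ray_image (\<alpha> x))" if "x \<in> bdry" for x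
    using rho_class_contracting [OF that] by metis
  note cy = choiceD [OF yz(1)] and cz = choiceD [OF yz(2)]
  \<comment> \<open>Without such a radius the two rays would be at finite Hausdorff distance, which
    forces \<open>y = z\<close>.\<close>
  have "\<exists>R\<ge>0. E y + E z < mdist X (\<alpha> y R) (\<alpha> z R)"
  proof (rule ccontr)
    assume "\<not> ?thesis"
    then have "\<And>R. 0 \<le> R \<Longrightarrow> mdist X (\<alpha> y R) (\<alpha> z R) \<le> E y + E z" by force
    then have "finite_hausdorff X (ray_image (\<alpha> y)) (ray_image (\<alpha> z))"
      unfolding finite_hausdorff_def by (intro exI [of _ "E y + E z"]) (auto simp: ray_image_def)
    then show False using boundary_point_eqI [OF yz(1,2) cy(1) cz(1)] yz(3) by blast
  qed
  then obtain R where R: "0 \<le> R" "E y + E z < mdist X (\<alpha> y R) (\<alpha> z R)" by blast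
  define N where "N = L * (R + A)"
  define C where "C x = \<kappa> x L A + 1" for x
  have N: "0 \<le> N" using R LA by (simp add: N_def)
  \<comment> \<open>Large enough that the place where a ray is known to be close to
    \<open>\<alpha> x\<close> comes after time \<open>N\<close> and beyond the sphere of radius
    \<open>R\<close>.\<close>
  define r where "r = 1 + R + C y + C z + L * N + A"
  have r: "1 \<le> r" using R pos [OF yz(1)] pos [OF yz(2)] LA N by (simp add: r_def C_def)
  have near: "mdist X (\<beta> t) (\<alpha> x R) \<le> E x"
    if x: "x \<in> {y, z}" and \<beta>: "\<eta> \<in> nbhd x r" "\<beta> \<in> \<eta>" "quasi_ray X b L A \<beta>"
      and t: "0 \<le> t" "t \<le> N" "mdist X b (\<beta> t) = R" for x \<eta> \<beta> t
  proof -
    have xb: "x \<in> bdry" using x yz by auto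
    note q = quasi_rayD [OF \<beta>(3)] and g = geodesic_rayD [OF choiceD(2) [OF xb]]
    obtain T v where T: "0 \<le> T" "0 \<le> v" "r \<le> v" "mdist X (\<beta> T) (\<alpha> x v) \<le> C x"
      using boundary_nbhdD [of _ X b \<alpha>, OF \<beta> choiceD(2) [OF xb]] unfolding C_def by metis
    have "C x \<le> C y + C z" using x pos [OF yz(1)] pos [OF yz(2)] by (auto simp: C_def)
    moreover have "v \<le> mdist X b (\<beta> T) + C x"
      using mdist_triangle [OF g(2) q(7) [OF T(1)] g(3) [OF T(2)]] g(5) [OF T(2)] T(4) by simp
    ultimately have far: "R + C x \<le> v" "L * N + A < mdist X b (\<beta> T)"
      using T(3) R LA N mult_nonneg_nonneg [of L N] unfolding r_def by linarith+
    have "t \<le> T"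
    proof (rule ccontr)
      assume "\<not> t \<le> T"
      then have "L * T \<le> L * N" using t LA by (intro mult_left_mono) auto
      then show False using far(2) q(10) [OF T(1)] by linarith
    qed
    then show ?thesis
      unfolding E_def C_def [symmetric] using far R t
      by (intro fellow_travel_sphere [OF choiceD(2) [OF xb] con [OF xb] kappa_clearing [OF xb] \<beta>(3) T(1,2,4)])
        (auto simp: C_def)
  qed
  have bound: "T \<le> N" if h: "\<eta> \<in> nbhd y r" "\<theta> \<in> nbhd z r" "\<beta> \<in> \<eta>" "\<gamma> \<in> \<theta>" "quasi_ray X b L A \<beta>" "quasi_ray X b L A \<gamma>"
    and eq: "\<And>t. 0 \<le> t \<Longrightarrow> t \<le> T \<Longrightarrow> \<beta> t = \<gamma> t" for \<eta> \<theta> \<beta> \<gamma> T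
  proof (rule ccontr)
    assume "\<not> T \<le> N"
    then have TN: "N < T" by simp
    note q = quasi_rayD [OF h(5)]
    obtain T1 v where T1: "0 \<le> T1" "0 \<le> v" "r \<le> v" "mdist X (\<beta> T1) (\<alpha> y v) \<le> C y"
      using boundary_nbhdD [of _ X b \<alpha>, OF h(1,3,5) cy(2)] unfolding C_def by metis
    note g = geodesic_rayD [OF cy(2)]
    have "v \<le> mdist X b (\<beta> T1) + C y"
      using mdist_triangle [OF g(2) q(7) [OF T1(1)] g(3) [OF T1(2)]] g(5) [OF T1(2)] T1(4) by simp
    moreover have "0 \<le> C z" "0 \<le> L * N" using pos [OF yz(2)] N LA by (auto simp: C_def)
    ultimately have "R \<le> mdist X b (\<beta> T1)" using T1(3) LA by (simp add: r_def)
    then obtain t where t: "0 \<le> t" "mdist X b (\<beta> t) = R" "t \<le> N"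
      using quasi_ray_sphere [OF h(5) T1(1) R(1)] unfolding N_def by metis
    have eqt: "\<beta> t = \<gamma> t" using eq t TN by simp
    have "mdist X (\<beta> t) (\<alpha> y R) \<le> E y" by (rule near [OF _ h(1,3,5) t(1,3,2)]) simp
    moreover have "mdist X (\<beta> t) (\<alpha> z R) \<le> E z"
      using near [OF _ h(2,4,6) t(1,3)] t(2) eqt by simp
    moreover have "mdist X (\<alpha> y R) (\<alpha> z R) \<le> mdist X (\<beta> t) (\<alpha> y R) + mdist X (\<beta> t) (\<alpha> z R)"
      using mdist_triangle [OF g(3) [OF R(1)] q(7) [OF t(1)] geodesic_rayD(3) [OF cz(2) R(1)]]
        mdist_commute [of X "\<beta> t" "\<alpha> y R"] by simp
    ultimately show False using R(2) by linarith
  qed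
  show ?thesis by (rule that [OF r N], rule bound)
qed

text \<open>A ray \<open>\<beta>\<close> to a point near \<open>\<eta>\<close> is redirected by
  surgery to end at \<open>\<eta>\<close>. The new ray is close to \<open>\<alpha> \<zeta>\<close>
  at radius \<open>R0\<close>, and if it leaves \<open>\<beta>\<close> only later,
  \<open>\<beta>\<close> is close there too. \<open>fellow_travel_reach\<close> then improves this
  closeness to the required \<open>\<kappa> \<zeta> L A\<close>. Here \<open>R\<close> must not
  depend on \<open>\<eta>\<close>, whereas \<open>R'\<close> may.\<close>

lemma boundary_nbhd_refine:
  assumes \<zeta>: "\<zeta> \<in> bdry" and r: "1 \<le> r"
  obtains R where "1 \<le> R" "\<And>\<eta>. \<eta> \<in> nbhd \<zeta> R \<Longrightarrow> \<exists>R'\<ge>1. nbhd \<eta> R' \<subseteq> nbhd \<zeta> r"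
proof -
  \<comment> \<open>The quality of redirected rays: surgery applied to rays with both constants
    equal to \<open>r\<close>.\<close>
  define L' A' where "L' = 4 * r\<^sup>2" and "A' = 2 * r + 8"
  define C' where "C' = \<kappa> \<zeta> L' A' + 1"
  define K where "K = \<kappa> \<zeta> r r"
  define E where "E = max K (2 * travel_bound (\<kappa> \<zeta> L' A') L' A' C')"
  \<comment> \<open>Depth \<open>r\<close> with a reserve for the loss in the final improvement from
    \<open>E\<close> to \<open>\<kappa> \<zeta> L A\<close>. \<open>R\<close> adds the slack
    \<open>C'\<close>, and \<open>N\<close> bounds the time at which a redirected ray meets the
    sphere of radius \<open>R0\<close>.\<close>
  define R0 where "R0 = r + travel_bound K r r E"
  define R where "R = R0 + C'"
  define N where "N = L' * (R0 + A')"
  note c\<zeta> = choiceD [OF \<zeta>]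
  obtain \<rho> where con: "contracting_for X (rho_class X b \<zeta>) (ray_image (\<alpha> \<zeta>))"
    using rho_class_contracting [OF \<zeta>] by metis
  have K: "0 < K" "0 < C'" "K \<le> E" "0 \<le> E"
    using kappa_clearing [OF \<zeta>, of r r] kappa_clearing [OF \<zeta>, of L' A']
    by (auto simp: K_def C'_def E_def clearing_def)
  have R0: "r \<le> R0" using K r by (auto simp: R0_def travel_bound_def)
  have N0: "0 \<le> N" using R0 r by (auto simp: N_def L'_def A'_def)
  have R1: "1 \<le> R" using R0 K r by (simp add: R_def)
  have "\<exists>R'\<ge>1. nbhd \<eta> R' \<subseteq> nbhd \<zeta> r" if \<eta>: "\<eta> \<in> nbhd \<zeta> R" for \<eta>
  proof -
    have \<eta>b: "\<eta> \<in> bdry" using \<eta> by (simp add: boundary_nbhd_def)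
    note c\<eta> = choiceD [OF \<eta>b]
    define C where "C = \<kappa> \<eta> r r + 1"
    \<comment> \<open>The threshold of \<open>surgery_far\<close>, made strict; it pushes the point
      of departure beyond time \<open>N\<close>.\<close>
    define R' where "R' = max 1 (2 * r * N + 3 * r + 3 * C + 2)"
    have "\<theta> \<in> nbhd \<zeta> r" if \<theta>: "\<theta> \<in> nbhd \<eta> R'" for \<theta>
    proof (rule boundary_nbhdI [where \<alpha> = \<alpha> and \<zeta> = \<zeta>, OF _ c\<zeta>(2)])
      show \<theta>b: "\<theta> \<in> bdry" using \<theta> by (simp add: boundary_nbhd_def)
      fix L A \<beta> assume \<beta>: "\<beta> \<in> \<theta>" "quasi_ray X b L A \<beta>"
      note q = quasi_rayD [OF \<beta>(2)] and g = geodesic_rayD [OF c\<zeta>(2)]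
      show "\<exists>t\<ge>0. \<exists>v\<ge>0. r \<le> v \<and> mdist X (\<beta> t) (\<alpha> \<zeta> v) \<le> \<kappa> \<zeta> L A"
      proof (cases "r \<le> 3 * A \<or> r \<le> 3 * L\<^sup>2")
        case True
        \<comment> \<open>The base point \<open>\<beta> 0 = b\<close> is close enough. Otherwise \<open>L\<close> and \<open>A\<close> are bounded by \<open>r\<close>.\<close>
        then have "r \<le> \<kappa> \<zeta> L A" using kappa_ge(1,2) order_trans by blast
        then have "mdist X (\<beta> 0) (\<alpha> \<zeta> r) \<le> \<kappa> \<zeta> L A" using g(5) [of r] q(5) r by simp
        then show ?thesis using r by (intro exI [of _ 0] exI [of _ r] conjI) auto
      next
        case False
        have "L * 1 \<le> L * L" using q(1) by (intro mult_left_mono) auto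
        then have "L \<le> L\<^sup>2" by (simp add: power2_eq_square)
        then have LA: "L \<le> r" "A \<le> r" using False q(1,2) by linarith+
        have \<beta>r: "quasi_ray X b r r \<beta>"
          using quasi_geodesic_mono [OF q(3) LA q(1)] q r by (simp add: quasi_ray_def)
        obtain t0 v0 where v0: "0 \<le> t0" "0 \<le> v0" "R' \<le> v0" "mdist X (\<beta> t0) (\<alpha> \<eta> v0) \<le> C"
          using boundary_nbhdD [of _ X b \<alpha>, OF \<theta> \<beta>(1) \<beta>r c\<eta>(2)] unfolding C_def by metis
        have "2 * r * N + 3 * r + 3 * C + 1 < v0" using v0(3) by (simp add: R'_def)
        then obtain p \<beta>' where \<beta>': "N < p" "quasi_ray X b L' A' \<beta>'"
            "\<And>t. 0 \<le> t \<Longrightarrow> t \<le> p \<Longrightarrow> \<beta>' t = \<beta> t" "finite_hausdorff X (ray_image (\<alpha> \<eta>)) (ray_image \<beta>')"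
          using surgery_far [OF \<beta>r c\<eta>(2) v0(1,4) _ N0] unfolding L'_def A'_def by metis
        have "\<beta>' \<in> \<eta>" by (rule quasi_ray_mem_boundary_point [OF \<eta>b c\<eta>(1) \<beta>'(2,4)])
        then obtain t1 v1 where v1: "0 \<le> t1" "0 \<le> v1" "R \<le> v1" "mdist X (\<beta>' t1) (\<alpha> \<zeta> v1) \<le> C'"
          using boundary_nbhdD [of _ X b \<alpha>, OF \<eta> _ \<beta>'(2) c\<zeta>(2)] unfolding C'_def by metis
        note q' = quasi_rayD [OF \<beta>'(2)]
        have "v1 \<le> mdist X b (\<beta>' t1) + C'"
          using mdist_triangle [OF g(2) q'(7) [OF v1(1)] g(3) [OF v1(2)]] g(5) [OF v1(2)] v1(4) by simp
        then have "R0 \<le> mdist X b (\<beta>' t1)" using v1(3) by (simp add: R_def)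
        moreover have R00: "0 \<le> R0" using R0 r by simp
        ultimately obtain t where t: "0 \<le> t" "t \<le> t1" "mdist X b (\<beta>' t) = R0" "t \<le> N"
          using quasi_ray_sphere [OF \<beta>'(2) v1(1)] unfolding N_def by metis
        have "mdist X (\<beta>' t) (\<alpha> \<zeta> R0) \<le> 2 * travel_bound (\<kappa> \<zeta> L' A') L' A' C'"
          using v1(3) R00 t by (intro fellow_travel_sphere [OF c\<zeta>(2) con kappa_clearing [OF \<zeta>] \<beta>'(2) v1(1,2,4)])
            (auto simp: C'_def R_def)
        then have tE: "mdist X (\<beta> t) (\<alpha> \<zeta> R0) \<le> E" using \<beta>'(1,3) t by (simp add: E_def)
        have \<kappa>K: "\<kappa> \<zeta> L A \<le> K" unfolding K_def using LA q(1) by (intro kappa_mono [OF \<zeta>]) auto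
        then have "\<kappa> \<zeta> L A \<le> E" using K by simp
        then obtain t' v where tv: "0 \<le> t'" "0 \<le> v" "mdist X (\<beta> t') (\<alpha> \<zeta> v) \<le> \<kappa> \<zeta> L A"
            "R0 - travel_bound (\<kappa> \<zeta> L A) L A E \<le> v"
          using fellow_travel_reach [OF c\<zeta>(2) con kappa_clearing [OF \<zeta>] \<beta>(2) t(1) R00 tE] by metis
        have "0 < \<kappa> \<zeta> L A" using kappa_clearing [OF \<zeta>, of L A] by (simp add: clearing_def)
        then have "travel_bound (\<kappa> \<zeta> L A) L A E \<le> travel_bound K r r E"
          using \<kappa>K LA K q(1,2) by (intro travel_bound_mono) auto
        then have "r \<le> v" using tv(4) by (simp add: R0_def)
        then show ?thesis using tv by blast
      qed
    qed
    then show ?thesis by (intro exI [of _ R']) (auto simp: R'_def)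
  qed
  then show ?thesis using that R1 by blast
qed

text \<open>The usual interior in a neighbourhood system: the points having some neighbourhood
  inside \<open>nbhd \<zeta> r\<close>. That it is open is what \<open>boundary_nbhd_refine\<close>
  provides.\<close>

lemma boundary_nbhd_open:
  assumes \<zeta>: "\<zeta> \<in> bdry" and r: "1 \<le> r"
  obtains U where "openin (FQ_topology X b \<alpha>) U" "\<zeta> \<in> U" "U \<subseteq> nbhd \<zeta> r"
proof -
  define U where "U = {\<eta> \<in> bdry. \<exists>R\<ge>1. nbhd \<eta> R \<subseteq> nbhd \<zeta> r}"
  have "\<exists>R\<ge>1. nbhd \<eta> R \<subseteq> U" if \<eta>: "\<eta> \<in> U" for \<eta>
  proof -
    obtain R where R: "\<eta> \<in> bdry" "1 \<le> R" "nbhd \<eta> R \<subseteq> nbhd \<zeta> r" using \<eta> by (auto simp: U_def)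
    obtain R' where R': "1 \<le> R'" "\<And>\<theta>. \<theta> \<in> nbhd \<eta> R' \<Longrightarrow> \<exists>R''\<ge>1. nbhd \<theta> R'' \<subseteq> nbhd \<eta> R"
      using boundary_nbhd_refine [OF R(1,2)] by metis
    have "nbhd \<eta> R' \<subseteq> U"
    proof
      fix \<theta> assume \<theta>: "\<theta> \<in> nbhd \<eta> R'"
      then have "\<theta> \<in> bdry" by (simp add: boundary_nbhd_def)
      then show "\<theta> \<in> U" using R'(2) [OF \<theta>] R(3) by (auto simp: U_def)
    qed
    then show ?thesis using R'(1) by blast
  qed
  then have "openin (FQ_topology X b \<alpha>) U" using openin_FQ_topology [OF choice] by (auto simp: U_def)
  moreover have "\<zeta> \<in> U" using \<zeta> r by (auto simp: U_def)
  moreover have "U \<subseteq> nbhd \<zeta> r" using boundary_nbhd_self by (auto simp: U_def)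
  ultimately show ?thesis using that by blast
qed

text \<open>Surgery from \<open>\<alpha> \<eta>\<close> to \<open>\<alpha> \<xi>\<close> with
  \<open>L = 1\<close> and \<open>A = 0\<close> produces a ray in \<open>\<xi>\<close> with
  constants 4 and 8 that agrees with \<open>\<alpha> \<eta>\<close> up to \<open>p\<close>, so
  \<open>p \<le> N\<close>. The almost minimum is thus taken early on
  \<open>\<alpha> \<eta>\<close>, which bounds the functional at \<open>(u, s)\<close> from
  below.\<close>

lemma rays_diverge:
  assumes xy: "x \<in> bdry" "y \<in> bdry" "x \<noteq> y"
  obtains r N where "1 \<le> r" "0 \<le> N"
    "\<And>\<xi> \<eta> s u. \<xi> \<in> nbhd x r \<Longrightarrow> \<eta> \<in> nbhd y r \<Longrightarrow> 0 \<le> s \<Longrightarrow> 0 \<le> u \<Longrightarrow>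
      (s + u) / 7 - N \<le> mdist X (\<alpha> \<xi> s) (\<alpha> \<eta> u)"
proof -
  obtain r N where r: "1 \<le> r" "0 \<le> N" and agree:
    "\<And>\<eta> \<theta> \<beta> \<gamma> T. \<lbrakk>\<eta> \<in> nbhd x r; \<theta> \<in> nbhd y r; \<beta> \<in> \<eta>; \<gamma> \<in> \<theta>; quasi_ray X b 4 8 \<beta>; quasi_ray X b 4 8 \<gamma>;
      \<And>t. 0 \<le> t \<Longrightarrow> t \<le> T \<Longrightarrow> \<beta> t = \<gamma> t\<rbrakk> \<Longrightarrow> T \<le> N"
    using agreement_bound [OF xy, of 4 8] by (metis one_le_numeral zero_le_numeral)
  have "(s + u) / 7 - (N + 1) \<le> mdist X (\<alpha> \<xi> s) (\<alpha> \<eta> u)"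
    if \<xi>: "\<xi> \<in> nbhd x r" and \<eta>: "\<eta> \<in> nbhd y r" and su: "0 \<le> s" "0 \<le> u" for \<xi> \<eta> s u
  proof -
    have b: "\<xi> \<in> bdry" "\<eta> \<in> bdry" using \<xi> \<eta> by (simp_all add: boundary_nbhd_def)
    note c\<xi> = choiceD [OF b(1)] and c\<eta> = choiceD [OF b(2)]
    note g\<xi> = geodesic_rayD [OF c\<xi>(2)] and g\<eta> = geodesic_rayD [OF c\<eta>(2)]
    obtain p q \<beta>' where p: "0 \<le> p" "s \<le> q" and \<beta>': "quasi_ray X b 4 8 \<beta>'"
      "\<And>t. 0 \<le> t \<Longrightarrow> t \<le> p \<Longrightarrow> \<beta>' t = \<alpha> \<eta> t" "finite_hausdorff X (ray_image (\<alpha> \<xi>)) (ray_image \<beta>')"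
      and almost_min: "\<And>u v. 0 \<le> u \<Longrightarrow> s \<le> v \<Longrightarrow>
        2 * mdist X (\<alpha> \<eta> p) (\<alpha> \<xi> q) + p - q / 2 \<le> 2 * mdist X (\<alpha> \<eta> u) (\<alpha> \<xi> v) + u - v / 2 + 1"
      using surgery [OF geodesic_ray_quasi_ray [OF c\<eta>(2) order_refl order_refl] c\<xi>(2) su(1)]
      by (simp only: power_one mult_1_right mult_zero_right add_0_left) blast
    have min: "2 * mdist X (\<alpha> \<eta> p) (\<alpha> \<xi> q) + p - q / 2 \<le> 2 * mdist X (\<alpha> \<eta> u) (\<alpha> \<xi> s) + u - s / 2 + 1"
      using almost_min su(2) by blast
    have "\<beta>' \<in> \<xi>" by (rule quasi_ray_mem_boundary_point [OF b(1) c\<xi>(1) \<beta>'(1,3)])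
    then have "p \<le> N"
      using agree [OF \<xi> \<eta> _ c\<eta>(1) \<beta>'(1) geodesic_ray_quasi_ray [OF c\<eta>(2)]] \<beta>'(2) by simp
    moreover have q0: "0 \<le> q" using p su by simp
    have "q \<le> p + mdist X (\<alpha> \<eta> p) (\<alpha> \<xi> q)"
      using mdist_triangle [OF g\<xi>(2) g\<eta>(3) [OF p(1)] g\<xi>(3) [OF q0]] g\<xi>(5) [OF q0] g\<eta>(5) [OF p(1)] by simp
    moreover have "u \<le> s + mdist X (\<alpha> \<eta> u) (\<alpha> \<xi> s)"
      using mdist_triangle [OF g\<xi>(2) g\<xi>(3) [OF su(1)] g\<eta>(3) [OF su(2)]] g\<xi>(5) [OF su(1)] g\<eta>(5) [OF su(2)]
        mdist_commute [of X "\<alpha> \<eta> u" "\<alpha> \<xi> s"] by simp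
    \<comment> \<open>With d the distance in question, these two inequalities give s <= 3 d + N + 1
      and u <= 4 d + N + 1; hence the 7.\<close>
    ultimately have "2 * s \<le> 2 * mdist X (\<alpha> \<eta> u) (\<alpha> \<xi> s) + u + N + 1"
      "u \<le> s + mdist X (\<alpha> \<eta> u) (\<alpha> \<xi> s)"
      using min p(2) by linarith+
    then have "s + u \<le> 7 * mdist X (\<alpha> \<eta> u) (\<alpha> \<xi> s) + 7 * N + 7" using r(2) by linarith
    then show ?thesis unfolding mdist_commute [of X "\<alpha> \<xi> s"] add_divide_distrib by linarith
  qed
  then show ?thesis using that [of r "N + 1"] r by fastforce
qed

end

section \<open>Quasi-geodesics to the legs of a tripod\<close>

context coarse_geodesic
begin

text \<open>Divergence of the two legs is precisely the \<open>cross\<close> condition for a path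
  that runs back to \<open>b\<close> along one leg and out along the other.\<close>

lemma leg_join_quasi_geodesic:
  assumes a: "geodesic_ray X b a" "geodesic_ray X b a'" and N: "0 \<le> N" and q: "0 \<le> q"
    and div: "\<And>s u. 0 \<le> s \<Longrightarrow> 0 \<le> u \<Longrightarrow> (s + u) / 7 - N \<le> mdist X (a s) (a' u)"
  shows "quasi_geodesic X 7 (2 * N) {0..} (path_join q (\<lambda>t. a (q - t)) a')"
proof (rule quasi_geodesic_join)
  note g = geodesic_rayD [OF a(1)] and g' = geodesic_rayD [OF a(2)]
  have "quasi_geodesic X 1 0 {0..q} (\<lambda>t. a (q - t))"
    using g(3,4) by (auto simp: quasi_geodesic_def is_interval_cc)
  then show "quasi_geodesic X 7 N {0..q} (\<lambda>t. a (q - t))" by (rule quasi_geodesic_mono) (use N in auto)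
  have "quasi_geodesic X 1 0 {0..} a'" using a(2) by (simp add: geodesic_ray_def)
  then show "quasi_geodesic X 7 N {0..} a'" by (rule quasi_geodesic_mono) (use N in auto)
  show "a (q - q) = a' 0" using g(1) g'(1) by simp
  fix u v :: real assume "0 \<le> u" "u \<le> q" "0 \<le> v"
  then show "(q - u + v) / 7 - N \<le> mdist X (a (q - u)) (a' v)" using div [of "q - u" v] by simp
qed (use q N in auto)

text \<open>
  Since \<open>a i q\<close> is an almost closest point to \<open>p\<close> on the tripod, running from \<open>p\<close> to \<open>a i q\<close>, back
  along the leg \<open>i\<close> and out along any other leg is a quasi-geodesic. All these rays share their
  part from \<open>p\<close> to \<open>b\<close>.
\<close>

lemma tripod_rays:
  assumes a: "\<And>i. i \<in> I \<Longrightarrow> geodesic_ray X b (a i)" and I: "I \<noteq> {}" and N: "0 \<le> N"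
    and div: "\<And>i j s u. i \<in> I \<Longrightarrow> j \<in> I \<Longrightarrow> i \<noteq> j \<Longrightarrow> 0 \<le> s \<Longrightarrow> 0 \<le> u \<Longrightarrow>
      (s + u) / 7 - N \<le> mdist X (a i s) (a j u)"
    and p: "p \<in> mspace X"
  obtains i \<beta> T where "i \<in> I" "mdist X p b \<le> T"
    "\<And>j. j \<in> I \<Longrightarrow> j \<noteq> i \<Longrightarrow> quasi_ray X p 21 (4 * N + 8) (\<beta> j)"
    "\<And>j. j \<in> I \<Longrightarrow> j \<noteq> i \<Longrightarrow> finite_hausdorff X (ray_image (a j)) (ray_image (\<beta> j))"
    "\<And>j k t. t \<le> T \<Longrightarrow> j \<in> I \<Longrightarrow> k \<in> I \<Longrightarrow> \<beta> j t = \<beta> k t"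
proof -
  note g = geodesic_rayD [OF a]
  define V where "V = {mdist X p (a i t) | i t. i \<in> I \<and> 0 \<le> t}"
  have V: "V \<noteq> {}" "bdd_below V" using I by (auto simp: V_def intro!: bdd_belowI [of _ 0])
  then obtain i q where i: "i \<in> I" and q: "0 \<le> q" and "mdist X p (a i q) < Inf V + 1"
    using cInf_lessD [of V "Inf V + 1"] by (auto simp: V_def)
  moreover have "Inf V \<le> mdist X p (a j t)" if "j \<in> I" "0 \<le> t" for j t
    by (rule cInf_lower [OF _ V(2)]) (use that in \<open>auto simp: V_def\<close>)
  ultimately have near: "mdist X p (a i q) \<le> mdist X p (a j t) + 1" if "j \<in> I" "0 \<le> t" for j t
    using that by fastforce
  have iq: "a i q \<in> mspace X" by (rule g(3) [OF i q])
  obtain c l where c: "0 \<le> l" "l \<le> mdist X p (a i q) + 1" "c 0 = p" "c l = a i q" "c ` {0..l} \<subseteq> mspace X"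
    "\<And>s t. s \<in> {0..l} \<Longrightarrow> t \<in> {0..l} \<Longrightarrow> mdist X (c s) (c t) \<le> \<bar>s - t\<bar>"
    using coarse_geodesic [OF p iq] by metis
  have cM: "c w \<in> mspace X" if "0 \<le> w" "w \<le> l" for w using c(5) that by auto
  define \<delta> where "\<delta> j = path_join q (\<lambda>t. a i (q - t)) (a j)" for j
  define \<beta> where "\<beta> j = path_join l c (\<delta> j)" for j
  have j0: "a i 0 = a j 0" if "j \<in> I" for j using g(1) i that by simp
  have \<delta>0: "\<delta> j 0 = a i q" for j using q by (simp add: \<delta>_def path_join_def)
  have \<beta>: "quasi_ray X p 21 (4 * N + 8) (\<beta> j)" if j: "j \<in> I" "j \<noteq> i" for j
  proof -
    have \<delta>7: "quasi_geodesic X 7 (2 * N) {0..} (\<delta> j)"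
      unfolding \<delta>_def by (rule leg_join_quasi_geodesic [OF a [OF i] a [OF j(1)] N q div]) (use i j in auto)
    have "quasi_geodesic X 21 (2 * (2 * N + 4)) {0..} (\<beta> j)"
      unfolding \<beta>_def
    proof (rule quasi_geodesic_join)
      show "quasi_geodesic X 21 (2 * N + 4) {0..l} c"
        by (rule coarse_segment_quasi_geodesic [where e = 1]) (use c N in auto)
      show "quasi_geodesic X 21 (2 * N + 4) {0..} (\<delta> j)" by (rule quasi_geodesic_mono [OF \<delta>7]) (use N in auto)
      \<comment> \<open>Let d be the distance to be bounded. As \<open>a i q\<close> is almost
        closest, l - w <= d + 2, and then t / 7 <= 2 d + 2 + 2 N. The sum carries 3 d, whence 21 = 3
        * 7.\<close>
      fix w t :: real assume w: "0 \<le> w" "w \<le> l" and t: "0 \<le> t"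
      have M: "\<delta> j t \<in> mspace X" using quasi_geodesicD(3) [OF \<delta>7, of t t] t by simp
      have "mdist X p (a i q) \<le> mdist X p (\<delta> j t) + 1"
        using near [OF i, of "q - t"] near [OF j(1), of "t - q"] by (auto simp: \<delta>_def path_join_def)
      moreover have "mdist X p (\<delta> j t) \<le> w + mdist X (c w) (\<delta> j t)"
        using mdist_triangle [OF p cM [OF w] M] c(6) [of 0 w] c(3) w by simp
      moreover have "mdist X (\<delta> j t) (a i q) \<le> mdist X (c w) (\<delta> j t) + (l - w)"
        using mdist_triangle [OF M cM [OF w] iq] c(6) [of w l] c(1,4) w mdist_commute [of X "\<delta> j t" "c w"] by simp
      moreover have "t / 7 - 2 * N \<le> mdist X (\<delta> j t) (a i q)"
        using quasi_geodesicD(2) [OF \<delta>7, of t 0] t \<delta>0 by simp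
      ultimately show "(l - w + t) / 21 - (2 * N + 4) \<le> mdist X (c w) (\<delta> j t)"
        using c(2) w N by argo
    qed (use c \<delta>0 N in auto)
    moreover have "continuous_path X {0..} (\<beta> j)"
      unfolding \<beta>_def \<delta>_def
    proof (intro continuous_path_join)
      show "continuous_path X {0..l} c" using c by (intro continuous_path_lipschitz) auto
      show "continuous_path X {0..q} (\<lambda>t. a i (q - t))"
        using g(3,4) [OF i] by (intro continuous_path_lipschitz) auto
      show "continuous_path X {0..} (a j)"
        using quasi_rayD(4) [OF geodesic_ray_quasi_ray [OF a [OF j(1)], of 1 0]] by simp
    qed (use c q j0 [OF j(1)] in \<open>auto simp: path_join_def\<close>)
    ultimately show ?thesis using N c by (simp add: quasi_ray_def \<beta>_def path_join_def)
  qed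
  moreover have "finite_hausdorff X (ray_image (a j)) (ray_image (\<beta> j))" if j: "j \<in> I" "j \<noteq> i" for j
  proof -
    have "ray_image (\<beta> j) = (c ` {0..l} \<union> (\<lambda>t. a i (q - t)) ` {0..q}) \<union> ray_image (a j)"
      using c q j0 [OF j(1)] \<delta>0 unfolding \<beta>_def by (simp add: ray_image_join \<delta>_def Un_assoc)
    moreover have "finite_hausdorff X ({} \<union> ray_image (a j))
        ((c ` {0..l} \<union> (\<lambda>t. a i (q - t)) ` {0..q}) \<union> ray_image (a j))"
    proof (rule finite_hausdorff_bounded_parts)
      show "b \<in> ray_image (a j)" "ray_image (a j) \<subseteq> mspace X" using g(6,7) [OF j(1)] by auto
      fix y assume "y \<in> {} \<union> (c ` {0..l} \<union> (\<lambda>t. a i (q - t)) ` {0..q})"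
      then consider w where "y = c w" "0 \<le> w" "w \<le> l" | t where "y = a i t" "0 \<le> t" "t \<le> q" by force
      then show "mdist X y b \<le> l + q"
      proof cases
        case 1
        have "mdist X (c w) (a i q) \<le> l" using c(6) [of w l] c(1,4) 1 by simp
        then show ?thesis
          using mdist_triangle [OF cM [OF 1(2,3)] iq g(2) [OF i]] g(5) [OF i q] 1(1) mdist_commute [of X b "a i q"]
          by simp
      next
        case 2
        then show ?thesis using g(5) [OF i 2(2)] c(1) mdist_commute [of X b y] by simp
      qed
    qed
    ultimately show ?thesis by simp
  qed
  \<comment> \<open>Until time \<open>l + q\<close>, when the path is back at \<open>b\<close>, the
    outgoing leg does not enter the definition.\<close>
  moreover have "\<beta> j t = \<beta> k t" if t: "t \<le> l + q" and jk: "j \<in> I" "k \<in> I" for j k t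
    using t by (simp add: \<beta>_def \<delta>_def path_join_def)
  moreover have "mdist X p b \<le> l + q"
  proof -
    have "mdist X p (a i q) \<le> l" using c(6) [of 0 l] c(1,3,4) by simp
    then show ?thesis
      using mdist_triangle [OF p iq g(2) [OF i]] g(5) [OF i q] mdist_commute [of X b "a i q"] by simp
  qed
  ultimately show ?thesis using that [of i "l + q" \<beta>] i by blast
qed

end

section \<open>Proper discontinuity\<close>

lemma compactin_uniform_bound:
  fixes P :: "real \<Rightarrow> 'y \<Rightarrow> bool"
  assumes K: "compactin Y K"
    and mono: "\<And>M N t. M \<le> N \<Longrightarrow> P M t \<Longrightarrow> P N t"
    and loc: "\<And>t. t \<in> K \<Longrightarrow> \<exists>U N. openin Y U \<and> t \<in> U \<and> (\<forall>t'\<in>U. P N t')"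
  shows "\<exists>N\<ge>0. \<forall>t\<in>K. P N t"
proof -
  obtain U M where UM: "\<And>t. t \<in> K \<Longrightarrow> openin Y (U t) \<and> t \<in> U t \<and> (\<forall>t'\<in>U t. P (M t) t')"
    using loc by metis
  have "\<forall>V\<in>U ` K. openin Y V" "K \<subseteq> \<Union>(U ` K)" using UM by blast+
  then have "\<exists>\<F>. finite \<F> \<and> \<F> \<subseteq> U ` K \<and> K \<subseteq> \<Union>\<F>"
    using K unfolding compactin_def by simp
  then obtain F where F: "finite F" "F \<subseteq> K" "K \<subseteq> \<Union>(U ` F)" by (metis finite_subset_image)
  define N where "N = Max (insert 0 (M ` F))"
  have "P N t" if t: "t \<in> K" for t
  proof -
    obtain s where s: "s \<in> F" "t \<in> U s" using F(3) t by blast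
    then have "M s \<le> N" using F(1) by (auto simp: N_def)
    then show ?thesis using mono UM s F(2) by blast
  qed
  moreover have "0 \<le> N" using F(1) by (auto simp: N_def)
  ultimately show ?thesis by blast
qed

text \<open>Pairwise bounds suffice: each entry of a triple is confined to the intersection of the
  neighbourhoods that its two pairs provide.\<close>

lemma triples_uniform_bound:
  fixes R :: "real \<Rightarrow> 'm \<Rightarrow> 'm \<Rightarrow> bool"
  assumes K: "compactin (prod_topology Y (prod_topology Y Y)) K"
    and dist: "\<And>x y z. (x, y, z) \<in> K \<Longrightarrow> x \<noteq> y \<and> y \<noteq> z \<and> x \<noteq> z"
    and mono: "\<And>M N x y. M \<le> N \<Longrightarrow> R M x y \<Longrightarrow> R N x y"
    and loc: "\<And>x y. x \<in> topspace Y \<Longrightarrow> y \<in> topspace Y \<Longrightarrow> x \<noteq> y \<Longrightarrow>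
      \<exists>U V N. openin Y U \<and> openin Y V \<and> x \<in> U \<and> y \<in> V \<and> (\<forall>u\<in>U. \<forall>v\<in>V. R N u v)"
  shows "\<exists>N\<ge>0. \<forall>x y z. (x, y, z) \<in> K \<longrightarrow> R N x y \<and> R N y z \<and> R N x z"
proof -
  define P where "P N = (\<lambda>(x, y, z). R N x y \<and> R N y z \<and> R N x z)" for N
  have loc': "\<exists>U N. openin (prod_topology Y (prod_topology Y Y)) U \<and> t \<in> U \<and> (\<forall>t'\<in>U. P N t')" if t: "t \<in> K" for t
  proof -
    obtain x y z where xyz: "t = (x, y, z)" by (cases t)
    have "t \<in> topspace (prod_topology Y (prod_topology Y Y))" using K t by (auto simp: compactin_def)
    then have top: "x \<in> topspace Y" "y \<in> topspace Y" "z \<in> topspace Y" using xyz by auto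
    have ne: "x \<noteq> y" "y \<noteq> z" "x \<noteq> z" using dist t xyz by blast+
    obtain U1 V1 N1 where 1: "openin Y U1" "openin Y V1" "x \<in> U1" "y \<in> V1" "\<forall>u\<in>U1. \<forall>v\<in>V1. R N1 u v"
      using loc [OF top(1,2) ne(1)] by metis
    obtain U2 V2 N2 where 2: "openin Y U2" "openin Y V2" "y \<in> U2" "z \<in> V2" "\<forall>u\<in>U2. \<forall>v\<in>V2. R N2 u v"
      using loc [OF top(2,3) ne(2)] by metis
    obtain U3 V3 N3 where 3: "openin Y U3" "openin Y V3" "x \<in> U3" "z \<in> V3" "\<forall>u\<in>U3. \<forall>v\<in>V3. R N3 u v"
      using loc [OF top(1,3) ne(3)] by metis
    let ?N = "max N1 (max N2 N3)" and ?U = "(U1 \<inter> U3) \<times> (V1 \<inter> U2) \<times> (V2 \<inter> V3)"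
    have "openin (prod_topology Y (prod_topology Y Y)) ?U"
      using 1 2 3 by (auto simp: openin_prod_Times_iff)
    moreover have "\<forall>t'\<in>?U. P ?N t'"
      unfolding P_def using 1(5) 2(5) 3(5) mono [of N1 ?N] mono [of N2 ?N] mono [of N3 ?N] by auto
    moreover have "t \<in> ?U" using 1 2 3 xyz by simp
    ultimately show ?thesis by blast
  qed
  have mono': "P N t" if "M \<le> N" "P M t" for M N t using that mono by (auto simp: P_def)
  have "\<exists>N\<ge>0. \<forall>t\<in>K. P N t"
    by (rule compactin_uniform_bound [OF K, of P], erule (1) mono', erule loc')
  then show ?thesis unfolding P_def by fast
qed

context based_space
begin

lemma topspace_FQ: "topspace (FQ_topology X b \<alpha>) = bdry"
proof -
  have "openin (FQ_topology X b \<alpha>) bdry"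
    unfolding openin_FQ_topology [OF choice] by (auto simp: boundary_nbhd_def)
  then show ?thesis
    using openin_FQ_topology [OF choice] openin_subset by (metis openin_topspace subset_antisym)
qed

text \<open>\<open>diverging\<close> and \<open>forking\<close> restate the conclusions of
  \<open>rays_diverge\<close> and \<open>agreement_bound\<close> as relations monotone in their
  constant, the form required by the compactness argument.\<close>

definition diverging :: "real \<Rightarrow> 'p path set \<Rightarrow> 'p path set \<Rightarrow> bool" where
  "diverging N \<xi> \<eta> \<longleftrightarrow> (\<forall>s u. 0 \<le> s \<longrightarrow> 0 \<le> u \<longrightarrow> (s + u) / 7 - N \<le> mdist X (\<alpha> \<xi> s) (\<alpha> \<eta> u))"

definition forking :: "real \<Rightarrow> real \<Rightarrow> real \<Rightarrow> 'p path set \<Rightarrow> 'p path set \<Rightarrow> bool" where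
  "forking L A N \<xi> \<eta> \<longleftrightarrow> (\<forall>\<beta>\<in>\<xi>. \<forall>\<gamma>\<in>\<eta>. \<forall>T. quasi_ray X b L A \<beta> \<longrightarrow> quasi_ray X b L A \<gamma> \<longrightarrow>
     (\<forall>t. 0 \<le> t \<longrightarrow> t \<le> T \<longrightarrow> \<beta> t = \<gamma> t) \<longrightarrow> T \<le> N)"

lemma diverging_commute: "diverging N \<xi> \<eta> \<Longrightarrow> diverging N \<eta> \<xi>"
  unfolding diverging_def by (metis add.commute mdist_commute)

lemma forking_commute: "forking L A N \<xi> \<eta> \<Longrightarrow> forking L A N \<eta> \<xi>"
  unfolding forking_def by metis

lemma separating_nbhds:
  assumes "x \<in> bdry" "y \<in> bdry" "1 \<le> r" "\<And>u v. u \<in> nbhd x r \<Longrightarrow> v \<in> nbhd y r \<Longrightarrow> R u v"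
  shows "\<exists>U V. openin (FQ_topology X b \<alpha>) U \<and> openin (FQ_topology X b \<alpha>) V \<and> x \<in> U \<and> y \<in> V \<and>
    (\<forall>u\<in>U. \<forall>v\<in>V. R u v)"
proof -
  obtain U where "openin (FQ_topology X b \<alpha>) U" "x \<in> U" "U \<subseteq> nbhd x r"
    using boundary_nbhd_open [OF assms(1,3)] by metis
  moreover obtain V where "openin (FQ_topology X b \<alpha>) V" "y \<in> V" "V \<subseteq> nbhd y r"
    using boundary_nbhd_open [OF assms(2,3)] by metis
  ultimately show ?thesis using assms(4) by (metis subsetD)
qed

text \<open>\<open>boundary_act\<close> with the translation replaced by an arbitrary map, which
  keeps the main estimate free of groups.\<close>

definition boundary_map :: "('p \<Rightarrow> 'p) \<Rightarrow> 'p path set \<Rightarrow> 'p path set" where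
  "boundary_map f \<zeta> =
     {c \<in> contracting_rays X b. \<exists>c'\<in>\<zeta>. finite_hausdorff X (ray_image c) (f ` ray_image c')}"

text \<open>That the image class is a boundary point comes, in the application, from the image
  triple lying in \<open>K\<close>. It is therefore nonempty: some member is at finite distance from
  the image of a ray of \<zeta>, and that ray is at finite distance from
  \<open>\<beta>\<close>.\<close>

lemma isometry_boundary_ray:
  assumes f: "f ` mspace X \<subseteq> mspace X" "\<And>x y. x \<in> mspace X \<Longrightarrow> y \<in> mspace X \<Longrightarrow> mdist X (f x) (f y) = mdist X x y"
    and \<beta>: "quasi_ray X p L A \<beta>" "f p = b"
    and \<zeta>: "\<zeta> \<in> bdry" "c \<in> \<zeta>" "finite_hausdorff X (ray_image c) (ray_image \<beta>)"
    and \<eta>: "boundary_map f \<zeta> \<in> bdry"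
  shows "f \<circ> \<beta> \<in> boundary_map f \<zeta>" "quasi_ray X b L A (f \<circ> \<beta>)"
proof -
  note q = quasi_rayD [OF \<beta>(1)]
  have "Lipschitz_continuous_map X X f"
    unfolding Lipschitz_continuous_map_def using f by (auto intro!: exI [of _ 1])
  then have "continuous_map (mtopology_of X) (mtopology_of X) f" by (rule Lipschitz_continuous_imp_continuous_map)
  then have "continuous_path X {0..} (f \<circ> \<beta>)"
    using q(4) unfolding continuous_path_def by (metis continuous_map_compose)
  moreover have "quasi_geodesic X L A {0..} (f \<circ> \<beta>)"
    using q(3) f unfolding quasi_geodesic_def by (auto simp: image_subset_iff)
  ultimately show qf: "quasi_ray X b L A (f \<circ> \<beta>)" using q(1,2,5) \<beta>(2) by (simp add: quasi_ray_def)
  have "boundary_map f \<zeta> \<noteq> {}" using \<eta> unfolding contracting_boundary_def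
    using in_quotient_imp_non_empty [OF equiv_fellow_rays, of "boundary_map f \<zeta>" X b] by simp
  then obtain e c' where e: "e \<in> boundary_map f \<zeta>" "c' \<in> \<zeta>" "finite_hausdorff X (ray_image e) (f ` ray_image c')"
    by (auto simp: boundary_map_def)
  have sub: "ray_image e \<subseteq> mspace X" "ray_image c' \<subseteq> mspace X" "ray_image c \<subseteq> mspace X"
    using boundary_point_ray contracting_ray_subset e \<eta> \<zeta>(1,2) by metis+
  have sub\<beta>: "ray_image \<beta> \<subseteq> mspace X" using q(7) by (auto simp: ray_image_def)
  have "finite_hausdorff X (ray_image c') (ray_image \<beta>)"
    by (rule finite_hausdorff_trans [OF boundary_point_hausdorff [OF \<zeta>(1) e(2) \<zeta>(2)] \<zeta>(3) sub(2,3) sub\<beta>])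
  then have "finite_hausdorff X (f ` ray_image c') (f ` ray_image \<beta>)"
    unfolding finite_hausdorff_def using f(2) sub(2) sub\<beta> by (simp add: subset_iff)
  moreover have "f ` ray_image \<beta> = ray_image (f \<circ> \<beta>)" by (auto simp: ray_image_def)
  ultimately have "finite_hausdorff X (ray_image e) (ray_image (f \<circ> \<beta>))"
    using finite_hausdorff_trans [OF e(3)] sub sub\<beta> f(1) by (metis image_mono order_trans)
  then show "f \<circ> \<beta> \<in> boundary_map f \<zeta>" by (rule quasi_ray_mem_boundary_point [OF \<eta> e(1) qf])
qed

theorem displacement_bound:
  assumes K: "compactin (prod_topology (FQ_topology X b \<alpha>) (prod_topology (FQ_topology X b \<alpha>) (FQ_topology X b \<alpha>))) K"
    and dist: "\<And>x y z. (x, y, z) \<in> K \<Longrightarrow> x \<noteq> y \<and> y \<noteq> z \<and> x \<noteq> z"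
  shows "\<exists>B. \<forall>f p x y z. f ` mspace X \<subseteq> mspace X \<longrightarrow>
      (\<forall>x\<in>mspace X. \<forall>y\<in>mspace X. mdist X (f x) (f y) = mdist X x y) \<longrightarrow> p \<in> mspace X \<longrightarrow> f p = b \<longrightarrow>
      (x, y, z) \<in> K \<longrightarrow> (boundary_map f x, boundary_map f y, boundary_map f z) \<in> K \<longrightarrow> mdist X p b \<le> B"
proof -
  let ?Y = "FQ_topology X b \<alpha>"
  have top: "x \<in> bdry" "y \<in> bdry" "z \<in> bdry" if "(x, y, z) \<in> K" for x y z
    using K that unfolding compactin_def by (auto simp: topspace_FQ)
  have "\<exists>N\<ge>0. \<forall>x y z. (x, y, z) \<in> K \<longrightarrow> diverging N x y \<and> diverging N y z \<and> diverging N x z"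
  proof (rule triples_uniform_bound [OF K dist, of diverging])
    show "diverging N x y" if "M \<le> N" "diverging M x y" for M N x y
      using that unfolding diverging_def by (metis diff_mono order_refl order_trans)
    show "\<exists>U V N. openin ?Y U \<and> openin ?Y V \<and> x \<in> U \<and> y \<in> V \<and> (\<forall>u\<in>U. \<forall>v\<in>V. diverging N u v)"
      if xy: "x \<in> topspace ?Y" "y \<in> topspace ?Y" "x \<noteq> y" for x y
    proof -
      have b: "x \<in> bdry" "y \<in> bdry" using xy topspace_FQ by auto
      obtain r N where "1 \<le> r" "\<And>u v. u \<in> nbhd x r \<Longrightarrow> v \<in> nbhd y r \<Longrightarrow> diverging N u v"
        using rays_diverge [OF b xy(3)] unfolding diverging_def by metis
      then show ?thesis using separating_nbhds [OF b] by metis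
    qed
  qed
  then obtain N where N: "0 \<le> N" "\<And>x y z. (x, y, z) \<in> K \<Longrightarrow> diverging N x y \<and> diverging N y z \<and> diverging N x z"
    by blast
  let ?A = "4 * N + 8"
  have "\<exists>B\<ge>0. \<forall>x y z. (x, y, z) \<in> K \<longrightarrow> forking 21 ?A B x y \<and> forking 21 ?A B y z \<and> forking 21 ?A B x z"
  proof (rule triples_uniform_bound [OF K dist, of "forking 21 ?A"])
    show "forking 21 ?A N x y" if "M \<le> N" "forking 21 ?A M x y" for M N x y
      using that unfolding forking_def by (meson order_trans)
    show "\<exists>U V N. openin ?Y U \<and> openin ?Y V \<and> x \<in> U \<and> y \<in> V \<and> (\<forall>u\<in>U. \<forall>v\<in>V. forking 21 ?A N u v)"
      if xy: "x \<in> topspace ?Y" "y \<in> topspace ?Y" "x \<noteq> y" for x y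
    proof -
      have b: "x \<in> bdry" "y \<in> bdry" using xy topspace_FQ by auto
      have A: "0 \<le> ?A" using N(1) by simp
      obtain r B where r: "1 \<le> r" "0 \<le> B" and agree:
          "\<And>\<eta> \<theta> \<beta> \<gamma> T. \<lbrakk>\<eta> \<in> nbhd x r; \<theta> \<in> nbhd y r; \<beta> \<in> \<eta>; \<gamma> \<in> \<theta>; quasi_ray X b 21 ?A \<beta>; quasi_ray X b 21 ?A \<gamma>;
            \<And>t. 0 \<le> t \<Longrightarrow> t \<le> T \<Longrightarrow> \<beta> t = \<gamma> t\<rbrakk> \<Longrightarrow> T \<le> B"
        using agreement_bound [OF b xy(3) one_le_numeral A] by metis
      have "forking 21 ?A B u v" if "u \<in> nbhd x r" "v \<in> nbhd y r" for u v
        unfolding forking_def using agree [OF that] by blast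
      then show ?thesis using separating_nbhds [OF b r(1)] by metis
    qed
  qed
  then obtain B where B: "\<And>x y z. (x, y, z) \<in> K \<Longrightarrow>
      forking 21 ?A B x y \<and> forking 21 ?A B y z \<and> forking 21 ?A B x z" by blast
  have "mdist X p b \<le> B"
    if f: "f ` mspace X \<subseteq> mspace X" "\<forall>x\<in>mspace X. \<forall>y\<in>mspace X. mdist X (f x) (f y) = mdist X x y"
      and p: "p \<in> mspace X" "f p = b"
      and xyz: "(x, y, z) \<in> K" and \<phi>xyz: "(boundary_map f x, boundary_map f y, boundary_map f z) \<in> K" for f p x y z
  proof -
    let ?I = "{x, y, z}"
    have ne: "x \<noteq> y" "y \<noteq> z" "x \<noteq> z" using dist [OF xyz] by auto
    have Ib: "j \<in> bdry" "boundary_map f j \<in> bdry" if "j \<in> ?I" for j using that top [OF xyz] top [OF \<phi>xyz] by auto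
    have div: "diverging N i j" if "i \<in> ?I" "j \<in> ?I" "i \<noteq> j" for i j
      using that N(2) [OF xyz] diverging_commute by auto
    have fork: "forking 21 ?A B (boundary_map f i) (boundary_map f j)" if "i \<in> ?I" "j \<in> ?I" "i \<noteq> j" for i j
      using that B [OF \<phi>xyz] forking_commute by auto
    obtain i \<beta> T where i: "i \<in> ?I" "mdist X p b \<le> T"
      and \<beta>: "\<And>j. j \<in> ?I \<Longrightarrow> j \<noteq> i \<Longrightarrow> quasi_ray X p 21 ?A (\<beta> j)"
        "\<And>j. j \<in> ?I \<Longrightarrow> j \<noteq> i \<Longrightarrow> finite_hausdorff X (ray_image (\<alpha> j)) (ray_image (\<beta> j))"
        "\<And>j k t. t \<le> T \<Longrightarrow> j \<in> ?I \<Longrightarrow> k \<in> ?I \<Longrightarrow> \<beta> j t = \<beta> k t"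
    proof (rule tripod_rays [of ?I b \<alpha> N p])
      show "geodesic_ray X b (\<alpha> i)" if "i \<in> ?I" for i using choiceD(2) Ib that by blast
      show "(s + u) / 7 - N \<le> mdist X (\<alpha> i s) (\<alpha> j u)"
        if "i \<in> ?I" "j \<in> ?I" "i \<noteq> j" "0 \<le> s" "0 \<le> u" for i j s u
        using div [OF that(1-3)] that(4,5) by (simp add: diverging_def)
    qed (use N(1) p in auto)
    \<comment> \<open>The leg \<open>i\<close> that carries the path back to \<open>b\<close> is
      lost as an end, since going out along it again would backtrack. Two distinct ends
      remain.\<close>
    obtain j k where jk: "j \<in> ?I" "k \<in> ?I" "j \<noteq> k" "j \<noteq> i" "k \<noteq> i" using i(1) ne by blast
    have ray: "f \<circ> \<beta> m \<in> boundary_map f m" "quasi_ray X b 21 ?A (f \<circ> \<beta> m)" if m: "m \<in> ?I" "m \<noteq> i" for m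
      using isometry_boundary_ray [OF f(1) f(2) [rule_format] \<beta>(1) [OF m] p(2) Ib(1) [OF m(1)] choiceD(1) [OF Ib(1) [OF m(1)]]
        \<beta>(2) [OF m] Ib(2) [OF m(1)]] by auto
    have "T \<le> B"
      using fork [OF jk(1-3)] ray [OF jk(1,4)] ray [OF jk(2,5)] \<beta>(3) [OF _ jk(1,2)]
      unfolding forking_def by (metis comp_apply)
    then show ?thesis using i(2) by linarith
  qed
  then show ?thesis by blast
qed

end

section \<open>Cayley graphs\<close>

lemma lipschitz_join:
  assumes c: "c ` {0..p} \<subseteq> mspace X" "\<And>s t. s \<in> {0..p} \<Longrightarrow> t \<in> {0..p} \<Longrightarrow> mdist X (c s) (c t) \<le> \<bar>s - t\<bar>"
    and c': "c' ` {0..q} \<subseteq> mspace X" "\<And>s t. s \<in> {0..q} \<Longrightarrow> t \<in> {0..q} \<Longrightarrow> mdist X (c' s) (c' t) \<le> \<bar>s - t\<bar>"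
    and pq: "c p = c' 0" "0 \<le> p" "0 \<le> q"
  shows "path_join p c c' ` {0..p + q} \<subseteq> mspace X"
    "\<And>s t. s \<in> {0..p + q} \<Longrightarrow> t \<in> {0..p + q} \<Longrightarrow>
       mdist X (path_join p c c' s) (path_join p c c' t) \<le> \<bar>s - t\<bar>"
proof -
  let ?j = "path_join p c c'"
  show sub: "?j ` {0..p + q} \<subseteq> mspace X" using c(1) c'(1) by (auto simp: path_join_def image_subset_iff)
  have *: "mdist X (?j s) (?j t) \<le> t - s" if st: "0 \<le> s" "s \<le> t" "t \<le> p + q" for s t
  proof -
    consider "t \<le> p" | "s \<le> p" "p < t" | "p < s" by linarith
    then show ?thesis
    proof cases
      case 1
      then show ?thesis using c(2) [of s t] st by (simp add: path_join_def)
    next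
      case 2
      have "c s \<in> mspace X" "c p \<in> mspace X" "c' (t - p) \<in> mspace X" using c(1) c'(1) 2 st pq by auto
      then have "mdist X (c s) (c' (t - p)) \<le> mdist X (c s) (c p) + mdist X (c' 0) (c' (t - p))"
        using mdist_triangle [of "c s" X "c p" "c' (t - p)"] pq by simp
      then show ?thesis using c(2) [of s p] c'(2) [of 0 "t - p"] 2 st pq by (simp add: path_join_def)
    next
      case 3
      then show ?thesis using c'(2) [of "s - p" "t - p"] st pq by (simp add: path_join_def)
    qed
  qed
  show "mdist X (?j s) (?j t) \<le> \<bar>s - t\<bar>" if "s \<in> {0..p + q}" "t \<in> {0..p + q}" for s t
    using *[of s t] *[of t s] that mdist_commute [of X "?j s" "?j t"] by (cases "s \<le> t") auto
qed

text \<open>Linear interpolation of barycentric coordinates, run at unit speed. Distance 0 is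
  treated apart because the parameter is divided by it.\<close>

lemma cell_segment:
  assumes e: "finite e" and x: "x \<in> cell_points e" and y: "y \<in> cell_points e"
  obtains c where "c 0 = x" "c (bary_dist x y) = y" "c ` {0..bary_dist x y} \<subseteq> cell_points e"
    "\<And>s t. bary_dist (c s) (c t) \<le> \<bar>s - t\<bar>"
proof (cases "bary_dist x y = 0")
  case True
  have "finite {g. x g \<noteq> 0}" "finite {g. y g \<noteq> 0}"
    by (rule finite_subset [OF _ e]; use x y in \<open>auto simp: cell_points_def\<close>)+
  then have "x = y" using bary_dist_eq_0 True by blast
  then show ?thesis using that [of "\<lambda>_. x"] x True by (simp add: bary_dist_self image_subset_iff)
next
  case False
  define D where "D = bary_dist x y"
  have D: "0 < D" using False bary_dist_nonneg [of x y] by (simp add: D_def)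
  define c where "c t = (\<lambda>g. x g + t / D * (y g - x g))" for t
  have out: "x g = 0" "y g = 0" if "g \<notin> e" for g
    using x y that by (auto simp: cell_points_def)
  have sums: "(\<Sum>g\<in>e. x g) = 1" "(\<Sum>g\<in>e. y g) = 1" using x y by (auto simp: cell_points_def)
  have "c t \<in> cell_points e" if t: "t \<in> {0..D}" for t
  proof -
    have r: "0 \<le> t / D" "t / D \<le> 1" using t D by auto
    have "0 \<le> c t g" for g
    proof -
      have "c t g = (1 - t / D) * x g + t / D * y g" by (simp add: c_def algebra_simps)
      moreover have "0 \<le> (1 - t / D) * x g" "0 \<le> t / D * y g"
        by (rule mult_nonneg_nonneg; use r x y in \<open>simp add: cell_points_def\<close>)+
      ultimately show ?thesis by linarith
    qed
    moreover have "(\<Sum>g\<in>e. c t g) = (\<Sum>g\<in>e. x g) + t / D * ((\<Sum>g\<in>e. y g) - (\<Sum>g\<in>e. x g))"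
      by (simp only: c_def sum.distrib sum_distrib_left [symmetric] sum_subtractf)
    moreover from this have "(\<Sum>g\<in>e. c t g) = 1" using sums by simp
    moreover have "c t g = 0" if "g \<notin> e" for g using out [OF that] by (simp add: c_def)
    ultimately show ?thesis by (simp add: cell_points_def)
  qed
  moreover have "bary_dist (c s) (c t) \<le> \<bar>s - t\<bar>" for s t
  proof -
    have "bary_dist (c s) (c t) = (\<Sum>g\<in>e. \<bar>c s g - c t g\<bar>) / 2"
    proof (rule bary_dist_alt [OF e])
      have "c r g = 0" if "g \<notin> e" for r g using out [OF that] by (simp add: c_def)
      then show "{g. c s g \<noteq> 0 \<or> c t g \<noteq> 0} \<subseteq> e" by blast
    qed
    also have "(\<Sum>g\<in>e. \<bar>c s g - c t g\<bar>) = (\<Sum>g\<in>e. \<bar>s - t\<bar> / D * \<bar>x g - y g\<bar>)"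
    proof (rule sum.cong [OF refl])
      fix g
      have "c s g - c t g = (s - t) / D * (y g - x g)" by (simp add: c_def diff_divide_distrib algebra_simps)
      then show "\<bar>c s g - c t g\<bar> = \<bar>s - t\<bar> / D * \<bar>x g - y g\<bar>" using D by (simp add: abs_mult abs_minus_commute)
    qed
    also have "\<dots> / 2 = \<bar>s - t\<bar> / D * bary_dist x y"
    proof -
      have "bary_dist x y = (\<Sum>g\<in>e. \<bar>x g - y g\<bar>) / 2"
        by (rule bary_dist_alt [OF e]) (use out in blast)
      then show ?thesis by (simp only: sum_distrib_left [symmetric] times_divide_eq_right)
    qed
    finally show ?thesis using D by (simp add: D_def)
  qed
  moreover have "c 0 = x" "c D = y" using D by (auto simp: c_def)
  ultimately show ?thesis using that [of c] unfolding D_def by blast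
qed

locale finite_cayley = group G for G (structure) +
  fixes S
  assumes fin_S: "finite S" and S: "S \<subseteq> carrier G" "generate G S = carrier G"
begin

abbreviation "\<Gamma> \<equiv> cayley_graph G S"
abbreviation "act \<equiv> cayley_act G"

lemma mspace_\<Gamma>: "mspace \<Gamma> = cayley_points G S" and mdist_\<Gamma>: "mdist \<Gamma> = cayley_dist G S"
  by (rule mspace_cayley_graph [OF group_axioms S] mdist_cayley_graph [OF group_axioms S])+

lemma cell_point: "e \<in> cayley_cells G S \<Longrightarrow> x \<in> cell_points e \<Longrightarrow> x \<in> cayley_points G S"
  by (auto simp: cayley_points_def)

lemma cayley_dist_le_chain:
  assumes "x \<in> cayley_points G S" "y \<in> cayley_points G S" "cayley_chain G S x y ps"
  shows "cayley_dist G S x y \<le> chain_length ps"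
proof -
  have "Inf (chain_length ` {ps. cayley_chain G S x y ps}) \<le> chain_length ps"
    using assms by (intro cInf_lower) (auto intro!: bdd_belowI [of _ 0] simp: chain_length_nonneg)
  then show ?thesis using assms by (simp add: cayley_dist_def)
qed

lemma cayley_dist_greatest:
  assumes xy: "x \<in> cayley_points G S" "y \<in> cayley_points G S"
    and "\<And>ps. cayley_chain G S x y ps \<Longrightarrow> m \<le> chain_length ps"
  shows "m \<le> cayley_dist G S x y"
proof -
  have "m \<le> Inf (chain_length ` {ps. cayley_chain G S x y ps})"
    using cayley_connected [OF group_axioms S xy] assms(3) by (intro cInf_greatest) auto
  then show ?thesis using xy by (simp add: cayley_dist_def)
qed

lemma cayley_dist_approx:
  assumes xy: "x \<in> cayley_points G S" "y \<in> cayley_points G S"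
  obtains ps where "cayley_chain G S x y ps" "chain_length ps < cayley_dist G S x y + 1"
proof -
  have "\<exists>ps. cayley_chain G S x y ps \<and> chain_length ps < cayley_dist G S x y + 1"
  proof (rule ccontr)
    assume "\<not> ?thesis"
    then have "cayley_dist G S x y + 1 \<le> cayley_dist G S x y"
      by (intro cayley_dist_greatest [OF xy]) (auto simp: not_less)
    then show False by simp
  qed
  then show ?thesis using that by blast
qed

lemma cayley_dist_le_bary:
  assumes "e \<in> cayley_cells G S" "x \<in> cell_points e" "y \<in> cell_points e"
  shows "cayley_dist G S x y \<le> bary_dist x y"
proof -
  have "cayley_chain G S x y [x, y]" using assms by (auto simp: cayley_chain_def)
  then show ?thesis using cayley_dist_le_chain [of x y "[x, y]"] assms cell_point by simp
qed

lemma chain_path: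
  assumes "cayley_chain G S x y ps" "x \<in> cayley_points G S"
  shows "\<exists>c. c 0 = x \<and> c (chain_length ps) = y \<and> c ` {0..chain_length ps} \<subseteq> mspace \<Gamma> \<and>
    (\<forall>s\<in>{0..chain_length ps}. \<forall>t\<in>{0..chain_length ps}. mdist \<Gamma> (c s) (c t) \<le> \<bar>s - t\<bar>)"
  using assms
proof (induction ps arbitrary: x rule: induct_list012)
  case 1
  then show ?case by (simp add: cayley_chain_def)
next
  case (2 p)
  then show ?case by (intro exI [of _ "\<lambda>_. x"]) (auto simp: cayley_chain_def mspace_\<Gamma>)
next
  case (3 p q ps)
  have p: "p = x" and ch: "cayley_chain G S q y (q # ps)" using 3 by (auto simp: cayley_chain_def)
  obtain e where e: "e \<in> cayley_cells G S" "x \<in> cell_points e" "q \<in> cell_points e"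
    using 3 by (auto simp: cayley_chain_def)
  let ?l = "bary_dist x q" and ?m = "chain_length (q # ps)"
  obtain c' where c': "c' 0 = q" "c' ?m = y" "c' ` {0..?m} \<subseteq> mspace \<Gamma>"
    "\<forall>s\<in>{0..?m}. \<forall>t\<in>{0..?m}. mdist \<Gamma> (c' s) (c' t) \<le> \<bar>s - t\<bar>"
    using 3(2) [OF ch cell_point [OF e(1,3)]] by blast
  obtain c where c: "c 0 = x" "c ?l = q" "c ` {0..?l} \<subseteq> cell_points e" "\<And>s t. bary_dist (c s) (c t) \<le> \<bar>s - t\<bar>"
    using cell_segment [OF finite_cayley_cell [OF e(1)] e(2,3)] by metis
  have lip: "mdist \<Gamma> (c s) (c t) \<le> \<bar>s - t\<bar>" if "s \<in> {0..?l}" "t \<in> {0..?l}" for s t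
    using cayley_dist_le_bary [OF e(1), of "c s" "c t"] c(3) c(4) [of s t] that unfolding mdist_\<Gamma>
    by (meson image_subset_iff order_trans)
  have sub: "c ` {0..?l} \<subseteq> mspace \<Gamma>" using c(3) cell_point [OF e(1)] mspace_\<Gamma> by auto
  have nn: "0 \<le> ?l" "0 \<le> ?m" by (rule bary_dist_nonneg chain_length_nonneg)+
  have cc': "c ?l = c' 0" using c c' by simp
  \<comment> \<open>At time \<open>?l\<close> the join still follows \<open>c\<close>, so for
    \<open>?m = 0\<close> the end point is \<open>c ?l\<close>.\<close>
  have end_y: "path_join ?l c c' (?l + ?m) = y"
    using c' cc' nn by (cases "?m = 0") (auto simp: path_join_def)
  show ?case
    by (rule exI [of _ "path_join ?l c c'"])
      (use lipschitz_join [OF sub lip c'(3) c'(4) [rule_format] cc' nn] p c(1) nn end_y in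
        \<open>simp add: path_join_def\<close>)
qed

lemma coarse_geodesic_cayley: "coarse_geodesic \<Gamma>"
proof
  fix x y assume "x \<in> mspace \<Gamma>" "y \<in> mspace \<Gamma>"
  then have xy: "x \<in> cayley_points G S" "y \<in> cayley_points G S" by (simp_all add: mspace_\<Gamma>)
  obtain ps where ps: "cayley_chain G S x y ps" "chain_length ps < cayley_dist G S x y + 1"
    using cayley_dist_approx [OF xy] .
  have "chain_length ps \<le> mdist \<Gamma> x y + 1" using ps(2) by (simp add: mdist_\<Gamma>)
  then show "\<exists>c l. 0 \<le> l \<and> l \<le> mdist \<Gamma> x y + 1 \<and> c 0 = x \<and> c l = y \<and> c ` {0..l} \<subseteq> mspace \<Gamma> \<and>
      (\<forall>s\<in>{0..l}. \<forall>t\<in>{0..l}. mdist \<Gamma> (c s) (c t) \<le> \<bar>s - t\<bar>)"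
    using chain_path [OF ps(1) xy(1)] chain_length_nonneg [of ps] by blast
qed

section \<open>Left translations are isometries\<close>

lemma cell_subset_carrier: "e \<in> cayley_cells G S \<Longrightarrow> e \<subseteq> carrier G"
  using S(1) by (auto simp: cayley_cells_def)

lemma inj_on_translation: "h \<in> carrier G \<Longrightarrow> inj_on (\<lambda>g. h \<otimes> g) (carrier G)"
  by (auto simp: inj_on_def)

lemma translate_cell:
  assumes "h \<in> carrier G" "e \<in> cayley_cells G S"
  shows "(\<lambda>g. h \<otimes> g) ` e \<in> cayley_cells G S"
proof -
  obtain g s where gs: "e = {g, g \<otimes> s}" "g \<in> carrier G" "s \<in> insert \<one> S" using assms(2) by (auto simp: cayley_cells_def)
  then have "(\<lambda>g. h \<otimes> g) ` e = {h \<otimes> g, (h \<otimes> g) \<otimes> s}" using assms(1) S(1) by (auto simp: m_assoc)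
  then show ?thesis using gs assms(1) by (auto simp: cayley_cells_def)
qed

lemma act_translate:
  assumes "h \<in> carrier G" "g \<in> carrier G"
  shows "act h x (h \<otimes> g) = x g"
proof -
  have "inv h \<otimes> (h \<otimes> g) = g" using assms by (simp add: m_assoc [symmetric])
  then show ?thesis using assms by (simp add: cayley_act_def)
qed

lemma act_cell:
  assumes h: "h \<in> carrier G" and e: "e \<in> cayley_cells G S" and x: "x \<in> cell_points e"
  shows "act h x \<in> cell_points ((\<lambda>g. h \<otimes> g) ` e)"
proof -
  have sub: "e \<subseteq> carrier G" by (rule cell_subset_carrier [OF e])
  have "act h x g = 0" if g: "g \<notin> (\<lambda>g. h \<otimes> g) ` e" for g
  proof (cases "g \<in> carrier G")
    case True
    have "h \<otimes> (inv h \<otimes> g) = g" using h True by (simp add: m_assoc [symmetric])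
    then have "inv h \<otimes> g \<notin> e" using g by force
    then show ?thesis using x by (simp add: cayley_act_def cell_points_def)
  qed (simp add: cayley_act_def)
  moreover have "(\<Sum>g\<in>(\<lambda>g. h \<otimes> g) ` e. act h x g) = (\<Sum>g\<in>e. x g)"
    using inj_on_subset [OF inj_on_translation [OF h] sub] act_translate [OF h] sub
    by (subst sum.reindex) (auto intro!: sum.cong)
  ultimately show ?thesis using x by (auto simp: cell_points_def cayley_act_def)
qed

lemma act_point: "h \<in> carrier G \<Longrightarrow> x \<in> cayley_points G S \<Longrightarrow> act h x \<in> cayley_points G S"
  unfolding cayley_points_def using act_cell translate_cell by blast

lemma act_inv:
  assumes h: "h \<in> carrier G" and x: "x \<in> cayley_points G S"
  shows "act (inv h) (act h x) = x"
proof
  fix g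
  have "x g = 0" if "g \<notin> carrier G"
    using x cell_subset_carrier that by (auto simp: cayley_points_def cell_points_def)
  moreover have "inv h \<otimes> (h \<otimes> g) = g" if "g \<in> carrier G" using h that by (simp add: m_assoc [symmetric])
  ultimately show "act (inv h) (act h x) g = x g" using h by (simp add: cayley_act_def)
qed

lemma bary_dist_act:
  assumes h: "h \<in> carrier G" and e: "e \<in> cayley_cells G S" "x \<in> cell_points e" "y \<in> cell_points e"
  shows "bary_dist (act h x) (act h y) = bary_dist x y"
proof -
  have sub: "e \<subseteq> carrier G" by (rule cell_subset_carrier [OF e(1)])
  have "bary_dist (act h x) (act h y) = (\<Sum>g\<in>(\<lambda>g. h \<otimes> g) ` e. \<bar>act h x g - act h y g\<bar>) / 2"
    using act_cell [OF h e(1,2)] act_cell [OF h e(1,3)] finite_cayley_cell [OF e(1)]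
    by (intro bary_dist_alt) (auto simp: cell_points_def)
  also have "(\<Sum>g\<in>(\<lambda>g. h \<otimes> g) ` e. \<bar>act h x g - act h y g\<bar>) = (\<Sum>g\<in>e. \<bar>x g - y g\<bar>)"
    using inj_on_subset [OF inj_on_translation [OF h] sub] act_translate [OF h] sub
    by (subst sum.reindex) (auto intro!: sum.cong)
  also have "(\<Sum>g\<in>e. \<bar>x g - y g\<bar>) / 2 = bary_dist x y"
    using e finite_cayley_cell [OF e(1)] by (intro bary_dist_alt [symmetric]) (auto simp: cell_points_def)
  finally show ?thesis .
qed

lemma chain_act:
  assumes h: "h \<in> carrier G" and "cayley_chain G S x y ps"
  shows "cayley_chain G S (act h x) (act h y) (map (act h) ps) \<and> chain_length (map (act h) ps) = chain_length ps"
  using assms(2)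
proof (induction ps arbitrary: x rule: induct_list012)
  case (3 p q ps)
  have p: "p = x" and ch: "cayley_chain G S q y (q # ps)" using 3 by (auto simp: cayley_chain_def)
  obtain e where e: "e \<in> cayley_cells G S" "x \<in> cell_points e" "q \<in> cell_points e"
    using 3 by (auto simp: cayley_chain_def)
  have "\<exists>e\<in>cayley_cells G S. act h x \<in> cell_points e \<and> act h q \<in> cell_points e"
    using act_cell [OF h e(1)] e translate_cell [OF h e(1)] by blast
  then show ?case
    using 3(2) [OF ch] p bary_dist_act [OF h e] by (simp add: cayley_chain_def)
qed (auto simp: cayley_chain_def)

lemma cayley_dist_act:
  assumes h: "h \<in> carrier G" and xy: "x \<in> cayley_points G S" "y \<in> cayley_points G S"
  shows "cayley_dist G S (act h x) (act h y) = cayley_dist G S x y"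
proof -
  have le: "cayley_dist G S (act h x) (act h y) \<le> cayley_dist G S x y"
    if "h \<in> carrier G" "x \<in> cayley_points G S" "y \<in> cayley_points G S" for h x y
  proof (rule cayley_dist_greatest [OF that(2,3)])
    fix ps assume "cayley_chain G S x y ps"
    then show "cayley_dist G S (act h x) (act h y) \<le> chain_length ps"
      using chain_act [OF that(1)] cayley_dist_le_chain act_point that by metis
  qed
  show ?thesis
    using le [OF h xy] le [of "inv h" "act h x" "act h y"] act_inv [OF h] act_point [OF h] xy h by force
qed

section \<open>Word length and finiteness of the set of small displacements\<close>

fun word_ball :: "nat \<Rightarrow> 'a set" where
  "word_ball 0 = {\<one>}"
| "word_ball (Suc n) = word_ball n \<union> (\<lambda>(g, s). g \<otimes> s) ` (word_ball n \<times> S) \<union>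
     (\<lambda>(g, s). g \<otimes> inv s) ` (word_ball n \<times> S)"

lemma finite_word_ball: "finite (word_ball n)"
  by (induction n) (use fin_S in auto)

lemma word_ball_carrier: "word_ball n \<subseteq> carrier G"
  by (induction n) (use S(1) in auto)

lemma word_ball_mono: "m \<le> n \<Longrightarrow> word_ball m \<subseteq> word_ball n"
  by (induction n) (auto simp: le_Suc_eq)

lemma word_ball_mult: "g \<in> word_ball m \<Longrightarrow> h \<in> word_ball n \<Longrightarrow> g \<otimes> h \<in> word_ball (m + n)"
proof (induction n arbitrary: h)
  case 0
  then show ?case using word_ball_carrier by (auto simp: subset_iff)
next
  case (Suc n)
  have g: "g \<in> carrier G" using Suc.prems word_ball_carrier by blast
  consider "h \<in> word_ball n" | k s where "h = k \<otimes> s" "k \<in> word_ball n" "s \<in> S"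
    | k s where "h = k \<otimes> inv s" "k \<in> word_ball n" "s \<in> S" using Suc.prems(2) by auto
  then show ?case
  proof cases
    case 1
    then show ?thesis using Suc by simp
  next
    case 2
    then have "g \<otimes> h = (g \<otimes> k) \<otimes> s" using g S(1) word_ball_carrier by (auto simp: m_assoc subset_iff)
    then show ?thesis using Suc 2 by force
  next
    case 3
    then have "g \<otimes> h = (g \<otimes> k) \<otimes> inv s" using g S(1) word_ball_carrier by (auto simp: m_assoc subset_iff)
    then show ?thesis using Suc 3 by force
  qed
qed

lemma word_ball_exhausts:
  assumes "g \<in> carrier G"
  shows "\<exists>n. g \<in> word_ball n"
proof -
  have "g \<in> generate G S" using assms S(2) by simp
  then show ?thesis
  proof induction
    case one
    then show ?case by (intro exI [of _ 0]) simp
  next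
    case (incl h)
    then show ?case using S(1) by (intro exI [of _ 1]) force
  next
    case (inv h)
    then show ?case using S(1) by (intro exI [of _ 1]) force
  next
    case (eng h1 h2)
    then show ?case using word_ball_mult by blast
  qed
qed

definition word_length :: "'a \<Rightarrow> nat" where
  "word_length g = (LEAST n. g \<in> word_ball n)"

lemma word_length_ball: "g \<in> carrier G \<Longrightarrow> g \<in> word_ball (word_length g)"
  unfolding word_length_def using word_ball_exhausts LeastI_ex by metis

lemma word_length_le: "g \<in> word_ball n \<Longrightarrow> word_length g \<le> n"
  unfolding word_length_def by (rule Least_le)

lemma word_length_cell:
  assumes e: "e \<in> cayley_cells G S" "g \<in> e" "k \<in> e"
  shows "word_length g \<le> word_length k + 1"
proof -
  have step: "word_length (a \<otimes> s) \<le> word_length a + 1" "word_length a \<le> word_length (a \<otimes> s) + 1"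
    if a: "a \<in> carrier G" and s: "s \<in> S" for a s
  proof -
    have "a \<otimes> s \<in> word_ball (Suc (word_length a))" using word_length_ball [OF a] s by force
    then show "word_length (a \<otimes> s) \<le> word_length a + 1" using word_length_le by fastforce
    have sc: "s \<in> carrier G" using s S(1) by auto
    have "(a \<otimes> s) \<otimes> inv s \<in> word_ball (Suc (word_length (a \<otimes> s)))"
      using word_length_ball [of "a \<otimes> s"] a sc s by force
    then show "word_length a \<le> word_length (a \<otimes> s) + 1" using word_length_le a sc by (fastforce simp: m_assoc)
  qed
  obtain a s where as: "e = {a, a \<otimes> s}" "a \<in> carrier G" "s \<in> insert \<one> S" using e(1) by (auto simp: cayley_cells_def)
  show ?thesis
  proof (cases "s \<in> S")
    case True
    then show ?thesis using step [OF as(2) True] e(2,3) as(1) by auto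
  next
    case False
    then show ?thesis using as e(2,3) by auto
  qed
qed

text \<open>Word length, interpolated linearly along the edges. It is 1-Lipschitz along chains,
  which yields lower bounds for \<open>cayley_dist\<close> without finding shortest chains.\<close>

definition height :: "('a \<Rightarrow> real) \<Rightarrow> real" where
  "height x = (\<Sum>g | x g \<noteq> 0. x g * real (word_length g))"

lemma height_cell:
  assumes "finite e" "x \<in> cell_points e"
  shows "height x = (\<Sum>g\<in>e. x g * real (word_length g))"
  unfolding height_def using assms by (intro sum.mono_neutral_left) (auto simp: cell_points_def)

lemma height_ge:
  assumes e: "e \<in> cayley_cells G S" "x \<in> cell_points e" "g \<in> e"
  shows "real (word_length g) - 1 \<le> height x"
proof -
  have "(\<Sum>k\<in>e. x k) = 1" using e by (simp add: cell_points_def)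
  then have "real (word_length g) - 1 = (\<Sum>k\<in>e. x k * (real (word_length g) - 1))"
    by (simp add: sum_distrib_right [symmetric])
  also have "\<dots> \<le> (\<Sum>k\<in>e. x k * real (word_length k))"
  proof (intro sum_mono mult_left_mono)
    fix k assume "k \<in> e"
    then show "real (word_length g) - 1 \<le> real (word_length k)" using word_length_cell [OF e(1,3)] by fastforce
    show "0 \<le> x k" using e by (simp add: cell_points_def)
  qed
  finally show ?thesis using height_cell [OF finite_cayley_cell [OF e(1)] e(2)] by simp
qed

lemma height_lipschitz_cell:
  assumes e: "e \<in> cayley_cells G S" "x \<in> cell_points e" "y \<in> cell_points e"
  shows "height y \<le> height x + bary_dist x y"
proof -
  obtain a s where as: "e = {a, a \<otimes> s}" "a \<in> carrier G" using e(1) by (auto simp: cayley_cells_def)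
  define c where "c = a \<otimes> s"
  have ec: "e = {a, c}" using as by (simp add: c_def)
  note f = finite_cayley_cell [OF e(1)]
  note h = height_cell [OF f e(2)] height_cell [OF f e(3)]
  have b: "bary_dist x y = (\<Sum>g\<in>e. \<bar>x g - y g\<bar>) / 2"
    by (rule bary_dist_alt [OF f]) (use e in \<open>auto simp: cell_points_def\<close>)
  have sums: "(\<Sum>g\<in>e. x g) = 1" "(\<Sum>g\<in>e. y g) = 1" using e by (auto simp: cell_points_def)
  show ?thesis
  proof (cases "a = c")
    case True
    then have "x a = 1" "y a = 1" using sums ec by auto
    then show ?thesis using h b True ec by simp
  next
    case False
    then have s: "x c = 1 - x a" "y c = 1 - y a" using sums ec by (auto simp: algebra_simps)
    have w: "\<bar>real (word_length a) - real (word_length c)\<bar> \<le> 1"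
      using word_length_cell [OF e(1), of a c] word_length_cell [OF e(1), of c a] ec by auto
    have "height y - height x = (y a - x a) * (real (word_length a) - real (word_length c))"
      using h ec False s by (simp add: algebra_simps)
    also have "\<dots> \<le> \<bar>y a - x a\<bar> * \<bar>real (word_length a) - real (word_length c)\<bar>"
      by (metis abs_ge_self abs_mult)
    also have "\<dots> \<le> \<bar>y a - x a\<bar> * 1" by (rule mult_left_mono [OF w]) simp
    also have "\<dots> = bary_dist x y" using b ec False s by (simp add: abs_minus_commute)
    finally show ?thesis by simp
  qed
qed

lemma height_lipschitz_chain:
  assumes "cayley_chain G S x y ps"
  shows "height y \<le> height x + chain_length ps"
  using assms
proof (induction ps arbitrary: x rule: induct_list012)
  case (3 p q ps)
  have p: "p = x" and ch: "cayley_chain G S q y (q # ps)" using 3 by (auto simp: cayley_chain_def)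
  obtain e where e: "e \<in> cayley_cells G S" "x \<in> cell_points e" "q \<in> cell_points e"
    using 3 by (auto simp: cayley_chain_def)
  show ?case using 3(2) [OF ch] height_lipschitz_cell [OF e] p by simp
qed (auto simp: cayley_chain_def)

text \<open>\<open>height\<close> turns bounded displacement into bounded word length. As
  \<open>b\<close> may lie inside an edge, the bound is for \<open>h \<otimes> g\<close>, where
  \<open>g\<close> is a vertex of a cell containing \<open>b\<close>; \<open>h\<close> is recovered
  by cancelling \<open>g\<close>.\<close>

lemma finite_displacement:
  assumes b: "b \<in> cayley_points G S"
  shows "finite {h \<in> carrier G. cayley_dist G S (act h b) b \<le> B}"
proof -
  obtain e where e: "e \<in> cayley_cells G S" "b \<in> cell_points e" using b by (auto simp: cayley_points_def)
  then obtain g where g: "g \<in> e" "g \<in> carrier G" using cell_subset_carrier by (auto simp: cayley_cells_def)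
  define n where "n = nat \<lceil>height b + B + 1\<rceil>"
  have "h \<otimes> g \<in> word_ball n" if h: "h \<in> carrier G" "cayley_dist G S (act h b) b \<le> B" for h
  proof -
    have hb: "act h b \<in> cayley_points G S" by (rule act_point [OF h(1) b])
    have "height (act h b) - height b \<le> cayley_dist G S b (act h b)"
      by (rule cayley_dist_greatest [OF b hb]) (use height_lipschitz_chain in force)
    moreover have "cayley_dist G S b (act h b) = cayley_dist G S (act h b) b"
      using mdist_commute [of \<Gamma>] unfolding mdist_\<Gamma> .
    moreover have "real (word_length (h \<otimes> g)) - 1 \<le> height (act h b)"
      by (rule height_ge [OF translate_cell [OF h(1) e(1)] act_cell [OF h(1) e]]) (use g in auto)
    ultimately have "real (word_length (h \<otimes> g)) \<le> height b + B + 1" using h(2) by linarith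
    then have "word_length (h \<otimes> g) \<le> n" unfolding n_def by linarith
    then show ?thesis using word_length_ball [of "h \<otimes> g"] word_ball_mono h g by (meson m_closed subsetD)
  qed
  then have "(\<lambda>h. h \<otimes> g) ` {h \<in> carrier G. cayley_dist G S (act h b) b \<le> B} \<subseteq> word_ball n" by auto
  then show ?thesis
    by (rule inj_on_finite [rotated, OF _ finite_word_ball]) (use g in \<open>auto simp: inj_on_def\<close>)
qed

end

theorem theorem1p1:
  fixes G :: "('a, 'b) monoid_scheme" and S H :: "'a set" and b :: "'a \<Rightarrow> real"
    and \<alpha> :: "('a \<Rightarrow> real) path set \<Rightarrow> ('a \<Rightarrow> real) path"
  assumes "group G"
    and "finite S" and "S \<subseteq> carrier G" and "generate G S = carrier G"
    and "b \<in> mspace (cayley_graph G S)"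
    and "ray_choice (cayley_graph G S) b \<alpha>"
    and "subgroup H G"
    and "\<exists>T \<subseteq> limit_set G S b \<alpha> H. card T = 3"
    and "compactin (FQ_topology (cayley_graph G S) b \<alpha>) (limit_set G S b \<alpha> H)"
  shows "properly_discontinuous H (diagonal_act (boundary_act G S b))
           (distinct_triples (subtopology (FQ_topology (cayley_graph G S) b \<alpha>)
              (limit_set G S b \<alpha> H)))"
  unfolding properly_discontinuous_def
proof (intro allI impI)
  let ?Y = "FQ_topology (cayley_graph G S) b \<alpha>" and ?\<Lambda> = "limit_set G S b \<alpha> H"
  let ?X = "cayley_graph G S"
  fix K assume "compactin (distinct_triples (subtopology ?Y ?\<Lambda>)) K"
  \<comment> \<open>Compactness in the space of distinct triples amounts to compactness in the full
    product together with containment, and the containment supplies the distinctness.\<close>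
  then have K: "compactin (prod_topology ?Y (prod_topology ?Y ?Y)) K"
    and dist: "\<And>x y z. (x, y, z) \<in> K \<Longrightarrow> x \<noteq> y \<and> y \<noteq> z \<and> x \<noteq> z"
    unfolding distinct_triples_def
    by (auto simp: compactin_subtopology prod_topology_subtopology subtopology_subtopology)
  interpret group G by fact
  interpret finite_cayley G S using assms(2-4) by unfold_locales
  interpret based_space ?X b \<alpha>
    by (intro based_space.intro coarse_geodesic_cayley based_space_axioms.intro) fact+
  have act_map: "boundary_act G S b h \<zeta> = boundary_map (act h) \<zeta>" for h \<zeta>
    by (simp add: boundary_act_def boundary_map_def)
  obtain B where B: "mdist ?X p b \<le> B"
    if "f ` mspace ?X \<subseteq> mspace ?X" "\<forall>x\<in>mspace ?X. \<forall>y\<in>mspace ?X. mdist ?X (f x) (f y) = mdist ?X x y"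
      "p \<in> mspace ?X" "f p = b" "(x, y, z) \<in> K" "(boundary_map f x, boundary_map f y, boundary_map f z) \<in> K"
    for f p x y z
    using displacement_bound [OF K dist] by metis
  let ?F = "{h \<in> carrier G. cayley_dist G S (act h b) b \<le> B}"
  have bp: "b \<in> cayley_points G S" using base mspace_\<Gamma> by simp
  \<comment> \<open>The point that \<open>h\<close> carries to \<open>b\<close> is the translate of
    \<open>b\<close> by \<open>inv h\<close>, so the displacement bound puts \<open>inv h\<close>,
    rather than \<open>h\<close>, into the finite set.\<close>
  have "h \<in> (\<lambda>g. inv\<^bsub>G\<^esub> g) ` ?F" if h: "h \<in> H" and meet: "diagonal_act (boundary_act G S b) h ` K \<inter> K \<noteq> {}" for h
  proof -
    have hG: "h \<in> carrier G" using h subgroup.mem_carrier [OF assms(7)] by blast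
    obtain x y z where xyz: "(x, y, z) \<in> K" "(boundary_map (act h) x, boundary_map (act h) y, boundary_map (act h) z) \<in> K"
      using meet by (auto simp: diagonal_act_def act_map)
    have "mdist ?X (act (inv\<^bsub>G\<^esub> h) b) b \<le> B"
    proof (rule B [OF _ _ _ _ xyz])
      show "act h ` mspace ?X \<subseteq> mspace ?X" using act_point [OF hG] by (auto simp: mspace_\<Gamma>)
      show "\<forall>x\<in>mspace ?X. \<forall>y\<in>mspace ?X. mdist ?X (act h x) (act h y) = mdist ?X x y"
        using cayley_dist_act [OF hG] by (simp add: mspace_\<Gamma> mdist_\<Gamma>)
      show "act (inv\<^bsub>G\<^esub> h) b \<in> mspace ?X" using act_point bp hG by (simp add: mspace_\<Gamma>)
      show "act h (act (inv\<^bsub>G\<^esub> h) b) = b" using act_inv [of "inv\<^bsub>G\<^esub> h" b] bp hG by simp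
    qed
    then have "inv\<^bsub>G\<^esub> h \<in> ?F" using hG by (simp add: mdist_\<Gamma>)
    then show ?thesis using hG by (intro image_eqI [of _ _ "inv\<^bsub>G\<^esub> h"]) auto
  qed
  then have "{h \<in> H. diagonal_act (boundary_act G S b) h ` K \<inter> K \<noteq> {}} \<subseteq> (\<lambda>g. inv\<^bsub>G\<^esub> g) ` ?F" by blast
  then show "finite {h \<in> H. diagonal_act (boundary_act G S b) h ` K \<inter> K \<noteq> {}}"
    by (rule finite_subset) (intro finite_imageI finite_displacement bp)
qed

end
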